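(* Let $\mathbf{B}$ be a finite relational structure and $F$ an encoding for $\mathbf{B}$ with underlying finite set $D$. Suppose that $\mathbf{B}$ is $F$-stable and that $\mathbf{D}$ is an $F$-induced template of $\mathbf{B}$. Then $\mathsf{CSP}(\mathbf{D})$ polynomial-time many-one reduces to $\mathsf{SCSP}(\mathbf{B})$.
   Context: Structures have a finite signature of relation symbols with arities and a finite universe; $R^{\mathbf{B}}\subseteq B^{\mathrm{ar}(R)}$. A $\wedge$-formula is a conjunction of atoms $R(v_1,\dots,v_k)$ and variable equalities, with the usual notion of satisfying assignment. $\mathsf{CSP}(\mathbf{B})$: given a $\wedge$-formula $\phi$ over the signature of $\mathbf{B}$, decide whether some map from its variables to $B$ satisfies it. $\mathsf{SCSP}(\mathbf{B})$: given a finite set $U$ of variables and a $\wedge$-formula $\phi$ with variables from $U$, decide whether there is a surjective map $U \to B$ satisfying $\phi$. For a finite set $S$, a set of maps $S\to B$ is $\wedge$-definable if it is the set of satisfying assignments $S\to B$ of some $\wedge$-formula with variables from $S$; $\langle T\rangle_{\mathbf{B}}$ is the smallest $\wedge$-definable set containing $T$. An automorphism of $\mathbf{B}$ is a bijection of $B$ preserving each relation in both directions. A set $T$ of maps $I\to B$ is surjectively closed over $\mathbf{B}$ if every surjective map in $\langle T\rangle_{\mathbf{B}}$ equals $\gamma\circ t$ for some automorphism $\gamma$ and some $t\in T$. An encoding for $\mathbf{B}$: a finite set $D$ and a finite set $F$ of maps $f: D^k\to B$ ($k\ge0$ is the arity; $D^0$ is the one-element set containing the empty tuple). For a finite set $V$: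 $G_{V,D}$ is the set of maps $V\to D$; a $(V,F)$-application is a pair $(\bar v,f)$, $f\in F$, $\bar v$ a tuple over $V$ of length the arity of $f$; $A_{V,F}$ is the set of them; for $g\in G_{V,D}$ and $\alpha=((v_1,\dots,v_k),f)$, $\alpha[g]=f(g(v_1),\dots,g(v_k))$; $t[g]:A_{V,F}\to B$, $\alpha\mapsto \alpha[g]$; $T_V=\{t[g]\mid g\in G_{V,D}\}$. $\mathbf{B}$ is $F$-stable if for every non-empty finite set $V$, every map in $T_V$ is surjective and $T_V$ is surjectively closed over $\mathbf{B}$. An $F$-induced relation of $\mathbf{B}$ is a relation $Q'\subseteq D^s$ ($s\ge1$) such that, for pairwise distinct variables $u_1,\dots,u_s$ and $U=\{u_1,\dots,u_s\}$, there exist a relation $Q\subseteq B^r$ that is either a relation of $\mathbf{B}$ or the equality relation on $B$, and a tuple $(\alpha_1,\dots,\alpha_r)\in A_{U,F}^r$, with $Q'=\{(g(u_1),\dots,g(u_s)) \mid g\in G_{U,D},\ ((t[g])(\alpha_1),\dots,(t[g])(\alpha_r))\in Q\}$. An $F$-induced template of $\mathbf{B}$ is a structure with universe $D$ (finite signature) all of whose relations are $F$-induced relations of $\mathbf{B}$. *)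

theory Defs
  imports "HOL-Library.FuncSet" "HOL-Computational_Algebra.Polynomial"
begin

section \<open>Relational structures and conjunctive formulas\<close>

text \<open>
  Relation symbols and the variables of problem instances are bit strings, so that instances can be
  written down. Tuples are lists, and a map with domain \<open>S\<close> is an extensional function
  (\<open>S \<rightarrow>\<^sub>E X\<close>), so that equality of maps is HOL equality.
\<close>

type_synonym name = "bool list"

definition tuples :: "'a set \<Rightarrow> nat \<Rightarrow> 'a list set" where
  "tuples A k = {xs. set xs \<subseteq> A \<and> length xs = k}"

record 'b rel_structure =
  univ :: "'b set"
  sig :: "name set"
  arity :: "name \<Rightarrow> nat"
  interp :: "name \<Rightarrow> 'b list set"

definition finite_structure :: "'b rel_structure \<Rightarrow> bool" where
  "finite_structure B \<longleftrightarrow> finite (univ B) \<and> finite (sig B) \<and>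
     (\<forall>R\<in>sig B. interp B R \<subseteq> tuples (univ B) (arity B R))"

datatype 'v atom = Rel name "'v list" | Eq 'v 'v

fun atom_vars :: "'v atom \<Rightarrow> 'v set" where
  "atom_vars (Rel R vs) = set vs"
| "atom_vars (Eq u v) = {u, v}"

fun atom_over :: "'b rel_structure \<Rightarrow> 'v atom \<Rightarrow> bool" where
  "atom_over B (Rel R vs) \<longleftrightarrow> R \<in> sig B \<and> length vs = arity B R"
| "atom_over B (Eq u v) \<longleftrightarrow> True"

fun sat_atom :: "'b rel_structure \<Rightarrow> ('v \<Rightarrow> 'b) \<Rightarrow> 'v atom \<Rightarrow> bool" where
  "sat_atom B h (Rel R vs) \<longleftrightarrow> map h vs \<in> interp B R"
| "sat_atom B h (Eq u v) \<longleftrightarrow> h u = h v"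

text \<open>A list of atoms stands for their conjunction; the empty conjunction is true.\<close>

type_synonym 'v wedge_formula = "'v atom list"

definition formula_vars :: "'v wedge_formula \<Rightarrow> 'v set" where
  "formula_vars \<phi> = (\<Union>a\<in>set \<phi>. atom_vars a)"

definition formula_over :: "'b rel_structure \<Rightarrow> 'v wedge_formula \<Rightarrow> bool" where
  "formula_over B \<phi> \<longleftrightarrow> (\<forall>a\<in>set \<phi>. atom_over B a)"

definition sat :: "'b rel_structure \<Rightarrow> ('v \<Rightarrow> 'b) \<Rightarrow> 'v wedge_formula \<Rightarrow> bool" where
  "sat B h \<phi> \<longleftrightarrow> (\<forall>a\<in>set \<phi>. sat_atom B h a)"

definition wedge_definable :: "'b rel_structure \<Rightarrow> 'v set \<Rightarrow> ('v \<Rightarrow> 'b) set \<Rightarrow> bool" where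
  "wedge_definable B S X \<longleftrightarrow>
     (\<exists>\<phi>. formula_over B \<phi> \<and> formula_vars \<phi> \<subseteq> S \<and> X = {h \<in> S \<rightarrow>\<^sub>E univ B. sat B h \<phi>})"

definition wedge_closure :: "'b rel_structure \<Rightarrow> 'v set \<Rightarrow> ('v \<Rightarrow> 'b) set \<Rightarrow> ('v \<Rightarrow> 'b) set" where
  "wedge_closure B S T = (LEAST X. wedge_definable B S X \<and> T \<subseteq> X)"

lemma wedge_definable_Int:
  assumes "wedge_definable B S X" "wedge_definable B S Y"
  shows "wedge_definable B S (X \<inter> Y)"
proof -
  obtain \<phi> \<psi> where
    "formula_over B \<phi>" "formula_vars \<phi> \<subseteq> S" "X = {h \<in> S \<rightarrow>\<^sub>E univ B. sat B h \<phi>}"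
    "formula_over B \<psi>" "formula_vars \<psi> \<subseteq> S" "Y = {h \<in> S \<rightarrow>\<^sub>E univ B. sat B h \<psi>}"
    using assms unfolding wedge_definable_def by blast
  then show ?thesis
    unfolding wedge_definable_def
    by (intro exI[of _ "\<phi> @ \<psi>"]) (auto simp: formula_over_def formula_vars_def sat_def)
qed

lemma wedge_closure_least:
  assumes "finite_structure B" "finite S" "T \<subseteq> S \<rightarrow>\<^sub>E univ B"
  shows "wedge_definable B S (wedge_closure B S T)"
    and "wedge_closure B S T = \<Inter>{X. wedge_definable B S X \<and> T \<subseteq> X}"
proof -
  let ?C = "{X. wedge_definable B S X \<and> T \<subseteq> X}"
  have "finite (S \<rightarrow>\<^sub>E univ B)"
    using assms by (auto simp: finite_structure_def intro: finite_PiE)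
  moreover have "?C \<subseteq> Pow (S \<rightarrow>\<^sub>E univ B)"
    by (auto simp: wedge_definable_def)
  ultimately have fin: "finite ?C"
    by (meson finite_Pow_iff finite_subset)
  have "wedge_definable B S (S \<rightarrow>\<^sub>E univ B)"
    unfolding wedge_definable_def
    by (intro exI[of _ "[]"]) (auto simp: formula_over_def formula_vars_def sat_def)
  with assms have ne: "?C \<noteq> {}" by blast
  have "wedge_definable B S (\<Inter>\<X>)"
    if "finite \<X>" "\<X> \<noteq> {}" "\<And>X. X \<in> \<X> \<Longrightarrow> wedge_definable B S X" for \<X>
    using that by (induction rule: finite_ne_induct) (auto intro: wedge_definable_Int)
  from this[OF fin ne] have def: "wedge_definable B S (\<Inter>?C)" by blast
  then show eq: "wedge_closure B S T = \<Inter>?C"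
    unfolding wedge_closure_def by (intro Least_equality) auto
  show "wedge_definable B S (wedge_closure B S T)"
    using def by (simp add: eq)
qed

definition automorphism :: "'b rel_structure \<Rightarrow> ('b \<Rightarrow> 'b) \<Rightarrow> bool" where
  "automorphism B \<gamma> \<longleftrightarrow> bij_betw \<gamma> (univ B) (univ B) \<and>
     (\<forall>R\<in>sig B. \<forall>xs\<in>tuples (univ B) (arity B R). xs \<in> interp B R \<longleftrightarrow> map \<gamma> xs \<in> interp B R)"

definition surjectively_closed :: "'b rel_structure \<Rightarrow> 'v set \<Rightarrow> ('v \<Rightarrow> 'b) set \<Rightarrow> bool" where
  "surjectively_closed B S T \<longleftrightarrow>
     (\<forall>h\<in>wedge_closure B S T. h ` S = univ B \<longrightarrow>
        (\<exists>\<gamma> t. automorphism B \<gamma> \<and> t \<in> T \<and> h = compose S \<gamma> t))"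


section \<open>Encodings, stability and induced templates\<close>

text \<open>
  The arity is stored with each map, since it cannot be read off the function when \<open>D\<close> is empty.
\<close>

type_synonym ('d, 'b) enc_map = "nat \<times> ('d list \<Rightarrow> 'b)"

type_synonym ('d, 'b) application = "name list \<times> ('d, 'b) enc_map"

definition encoding :: "'b rel_structure \<Rightarrow> 'd set \<Rightarrow> ('d, 'b) enc_map set \<Rightarrow> bool" where
  "encoding B D F \<longleftrightarrow> finite D \<and> finite F \<and> (\<forall>(k, f)\<in>F. f \<in> tuples D k \<rightarrow>\<^sub>E univ B)"

definition applications :: "name set \<Rightarrow> ('d, 'b) enc_map set \<Rightarrow> ('d, 'b) application set" where
  "applications V F = {(vs, k, f). (k, f) \<in> F \<and> vs \<in> tuples V k}"

definition apply_at :: "('d, 'b) application \<Rightarrow> (name \<Rightarrow> 'd) \<Rightarrow> 'b" where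
  "apply_at = (\<lambda>(vs, k, f) g. f (map g vs))"

definition app_map ::
  "name set \<Rightarrow> ('d, 'b) enc_map set \<Rightarrow> (name \<Rightarrow> 'd) \<Rightarrow> ('d, 'b) application \<Rightarrow> 'b" where
  "app_map V F g = (\<lambda>\<alpha>\<in>applications V F. apply_at \<alpha> g)"

definition app_maps ::
  "name set \<Rightarrow> 'd set \<Rightarrow> ('d, 'b) enc_map set \<Rightarrow> (('d, 'b) application \<Rightarrow> 'b) set" where
  "app_maps V D F = app_map V F ` (V \<rightarrow>\<^sub>E D)"

definition F_stable :: "'b rel_structure \<Rightarrow> 'd set \<Rightarrow> ('d, 'b) enc_map set \<Rightarrow> bool" where
  "F_stable B D F \<longleftrightarrow>
     (\<forall>V. finite V \<and> V \<noteq> {} \<longrightarrow>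
        (\<forall>t\<in>app_maps V D F. t ` applications V F = univ B) \<and>
        surjectively_closed B (applications V F) (app_maps V D F))"

definition base_relation :: "'b rel_structure \<Rightarrow> nat \<Rightarrow> 'b list set \<Rightarrow> bool" where
  "base_relation B r Q \<longleftrightarrow>
     (\<exists>R\<in>sig B. r = arity B R \<and> Q = interp B R) \<or> (r = 2 \<and> Q = {[b, b] |b. b \<in> univ B})"

definition induced_relation ::
  "'b rel_structure \<Rightarrow> 'd set \<Rightarrow> ('d, 'b) enc_map set \<Rightarrow> nat \<Rightarrow> 'd list set \<Rightarrow> bool" where
  "induced_relation B D F s Q' \<longleftrightarrow> s \<ge> 1 \<and> Q' \<subseteq> tuples D s \<and>
     (\<forall>us. distinct us \<and> length us = s \<longrightarrow>
        (\<exists>r Q. base_relation B r Q \<and>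
          (\<exists>\<alpha>s\<in>tuples (applications (set us) F) r.
             Q' = {map g us |g. g \<in> set us \<rightarrow>\<^sub>E D \<and> map (app_map (set us) F g) \<alpha>s \<in> Q})))"

definition induced_template ::
  "'b rel_structure \<Rightarrow> 'd set \<Rightarrow> ('d, 'b) enc_map set \<Rightarrow> 'd rel_structure \<Rightarrow> bool" where
  "induced_template B D F \<D> \<longleftrightarrow> finite_structure \<D> \<and> univ \<D> = D \<and>
     (\<forall>R\<in>sig \<D>. induced_relation B D F (arity \<D> R) (interp \<D> R))"


section \<open>Polynomial-time many-one reductions between languages over the binary alphabet\<close>

text \<open>
  Deterministic Turing machines with finitely many two-way infinite tapes. States and tape symbols
  are numbers below the given bounds; the initial state and the blank symbol are \<open>0\<close>. Given the state
  and the scanned symbols, the transition function returns the next state and, for every tape, the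
  symbol to write and the head move; \<open>None\<close> means that the machine halts.
\<close>

datatype move = Go_Left | Stay | Go_Right

record tm =
  tm_tapes :: nat
  tm_states :: nat
  tm_symbols :: nat
  tm_delta :: "nat \<Rightarrow> nat list \<Rightarrow> (nat \<times> (nat \<times> move) list) option"

definition bit_symbol :: "bool \<Rightarrow> nat" where
  "bit_symbol b = (if b then 2 else 1)"

text \<open>At least three symbols are needed: the blank and the two bits.\<close>

definition turing_machine :: "tm \<Rightarrow> bool" where
  "turing_machine M \<longleftrightarrow> tm_tapes M \<ge> 1 \<and> tm_states M \<ge> 1 \<and> tm_symbols M \<ge> 3 \<and>
     (\<forall>q < tm_states M. \<forall>ss \<in> tuples {..<tm_symbols M} (tm_tapes M).
        case tm_delta M q ss of
          None \<Rightarrow> True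
        | Some (q', as) \<Rightarrow>
            q' < tm_states M \<and> as \<in> tuples ({..<tm_symbols M} \<times> UNIV) (tm_tapes M))"

type_synonym tape = "(int \<Rightarrow> nat) \<times> int"

type_synonym tm_config = "nat \<times> tape list"

definition scanned :: "tape \<Rightarrow> nat" where
  "scanned = (\<lambda>(c, h). c h)"

fun move_head :: "move \<Rightarrow> int \<Rightarrow> int" where
  "move_head Go_Left h = h - 1"
| "move_head Stay h = h"
| "move_head Go_Right h = h + 1"

definition act :: "nat \<times> move \<Rightarrow> tape \<Rightarrow> tape" where
  "act = (\<lambda>(s, m) (c, h). (c(h := s), move_head m h))"

definition tm_step :: "tm \<Rightarrow> tm_config \<Rightarrow> tm_config" where
  "tm_step M = (\<lambda>(q, ts).
     case tm_delta M q (map scanned ts) of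
       None \<Rightarrow> (q, ts)
     | Some (q', as) \<Rightarrow> (q', map2 act as ts))"

definition tm_halted :: "tm \<Rightarrow> tm_config \<Rightarrow> bool" where
  "tm_halted M = (\<lambda>(q, ts). tm_delta M q (map scanned ts) = None)"

text \<open>
  The input is on the first tape with the head on its first bit, and all other cells are blank. The
  output is read on the first tape, from the head rightwards up to the first blank.
\<close>

definition input_tape :: "bool list \<Rightarrow> tape" where
  "input_tape x =
     (\<lambda>i. if 0 \<le> i \<and> i < int (length x) then bit_symbol (x ! nat i) else 0, 0)"

definition tm_init :: "tm \<Rightarrow> bool list \<Rightarrow> tm_config" where
  "tm_init M x = (0, input_tape x # replicate (tm_tapes M - 1) (\<lambda>_. 0, 0))"

definition tape_output :: "tape \<Rightarrow> bool list \<Rightarrow> bool" where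
  "tape_output = (\<lambda>(c, h) y.
     (\<forall>i < length y. c (h + int i) = bit_symbol (y ! i)) \<and> c (h + int (length y)) = 0)"

definition poly_time :: "(bool list \<Rightarrow> bool list) \<Rightarrow> bool" where
  "poly_time f \<longleftrightarrow>
     (\<exists>M (p :: nat poly). turing_machine M \<and>
        (\<forall>x. \<exists>n \<le> poly p (length x).
           let C = (tm_step M ^^ n) (tm_init M x)
           in tm_halted M C \<and> tape_output (hd (snd C)) (f x)))"

definition poly_reduces :: "bool list set \<Rightarrow> bool list set \<Rightarrow> bool" (infix "\<le>\<^sub>p" 50) where
  "L \<le>\<^sub>p L' \<longleftrightarrow> (\<exists>f. poly_time f \<and> (\<forall>x. x \<in> L \<longleftrightarrow> f x \<in> L'))"


section \<open>The problems CSP and SCSP\<close>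

text \<open>
  Each list element is preceded by \<open>True\<close> and the end of the list is marked by \<open>False\<close>, which makes
  the code prefix-free whenever the code of the elements is.
\<close>

definition code_list :: "('a \<Rightarrow> bool list) \<Rightarrow> 'a list \<Rightarrow> bool list" where
  "code_list c xs = concat (map (\<lambda>x. True # c x) xs) @ [False]"

definition code_name :: "name \<Rightarrow> bool list" where
  "code_name = code_list (\<lambda>b. [b])"

fun code_atom :: "name atom \<Rightarrow> bool list" where
  "code_atom (Rel R vs) = True # code_name R @ code_list code_name vs"
| "code_atom (Eq u v) = False # code_name u @ code_name v"

definition code_formula :: "name wedge_formula \<Rightarrow> bool list" where
  "code_formula = code_list code_atom"

definition code_instance :: "name list \<Rightarrow> name wedge_formula \<Rightarrow> bool list" where
  "code_instance us \<phi> = code_list code_name us @ code_formula \<phi>"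

definition CSP :: "'b rel_structure \<Rightarrow> bool list set" where
  "CSP B = {code_formula \<phi> |\<phi>.
     formula_over B \<phi> \<and> (\<exists>h \<in> formula_vars \<phi> \<rightarrow>\<^sub>E univ B. sat B h \<phi>)}"

text \<open>The finite set \<open>U\<close> of variables is given by a list of its elements.\<close>

definition SCSP :: "'b rel_structure \<Rightarrow> bool list set" where
  "SCSP B = {code_instance us \<phi> |us \<phi>.
     formula_over B \<phi> \<and> formula_vars \<phi> \<subseteq> set us \<and>
     (\<exists>h \<in> set us \<rightarrow>\<^sub>E univ B. h ` set us = univ B \<and> sat B h \<phi>)}"

definition prefix_code :: "('a \<Rightarrow> bool list) \<Rightarrow> bool" where
  "prefix_code c \<longleftrightarrow> (\<forall>x y r r'. c x @ r = c y @ r' \<longrightarrow> x = y \<and> r = r')"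

lemma prefix_code_list:
  assumes "prefix_code c"
  shows "prefix_code (code_list c)"
proof -
  have "code_list c xs @ r = code_list c ys @ r' \<Longrightarrow> xs = ys \<and> r = r'" for xs ys r r'
  proof (induction xs arbitrary: ys)
    case Nil
    then show ?case by (cases ys) (auto simp: code_list_def)
  next
    case (Cons x xs)
    then obtain y ys' where ys: "ys = y # ys'"
      by (cases ys) (auto simp: code_list_def)
    with Cons.prems have
      "c x @ (code_list c xs @ r) = c y @ (code_list c ys' @ r')"
      by (simp add: code_list_def)
    then have "x = y \<and> code_list c xs @ r = code_list c ys' @ r'"
      using assms unfolding prefix_code_def by meson
    with Cons.IH ys show ?case by simp
  qed
  then show ?thesis unfolding prefix_code_def by blast
qed

lemma prefix_code_name: "prefix_code code_name"
  unfolding code_name_def by (rule prefix_code_list) (simp add: prefix_code_def)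

lemma prefix_codeD: "prefix_code c \<Longrightarrow> c x @ r = c y @ r' \<Longrightarrow> x = y \<and> r = r'"
  unfolding prefix_code_def by blast

lemma prefix_code_atom: "prefix_code code_atom"
proof -
  have "x = y \<and> r = r'" if "code_atom x @ r = code_atom y @ r'" for x y r r'
    using that
    by (cases x; cases y)
      (auto dest!: prefix_codeD[OF prefix_code_name]
        prefix_codeD[OF prefix_code_list[OF prefix_code_name]])
  then show ?thesis unfolding prefix_code_def by blast
qed

lemma prefix_code_formula: "prefix_code code_formula"
  unfolding code_formula_def by (rule prefix_code_list[OF prefix_code_atom])

lemma code_instance_inject:
  "code_instance us \<phi> = code_instance us' \<phi>' \<longleftrightarrow> us = us' \<and> \<phi> = \<phi>'"
proof
  assume "code_instance us \<phi> = code_instance us' \<phi>'"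
  then have us: "us = us'" and "code_formula \<phi> = code_formula \<phi>'"
    unfolding code_instance_def
    by (auto dest!: prefix_codeD[OF prefix_code_list[OF prefix_code_name]])
  then have "\<phi> = \<phi>'"
    using prefix_codeD[OF prefix_code_formula, of \<phi> "[]" \<phi>' "[]"] by simp
  with us show "us = us' \<and> \<phi> = \<phi>'" ..
qed simp

end

theory Submission
  imports Defs
begin

text \<open>
  An instance \<open>\<phi>\<close> over the variables \<open>V\<close> is sent to an instance over the applications of \<open>V\<close>. Its
  formula consists of all atoms that hold in every map \<open>t[g]\<close>, which define the closure of \<open>T\<^sub>V\<close>, and of
  the translations of the atoms of \<open>\<phi>\<close>. By stability a surjective solution is \<open>\<gamma> \<circ> t[g]\<close> for an
  automorphism \<open>\<gamma>\<close>, so that \<open>t[g]\<close> is a solution too, and \<open>g\<close> satisfies \<open>\<phi>\<close> up to variables that \<open>F\<close>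
  does not distinguish.

  The atoms that hold in every \<open>t[g]\<close> are exactly the instances, with arbitrary and possibly equal
  variables, of a finite list of patterns that is independent of \<open>\<phi>\<close>. The whole formula is therefore
  written by a fixed number of nested loops over the variable occurrences of \<open>\<phi>\<close>, without comparing
  variables; repeated atoms and variables do no harm. Such loops are programs over finitely many
  stacks, and a stack is a tape whose head is on the top element.
\<close>

section \<open>A language of stack programs and its Turing machines\<close>

text \<open>Nothing is known about the formula that defines the closure of T_V, yet it has to be
  written down in polynomial time. Fixed arities make this possible: an atom over the applications
  mentions boundedly many variables of \<phi>. With registers in place of these variables only
  finitely many patterns remain, and whether a pattern is valid for all values of its registers in
  \<open>D\<close> does not involve \<phi>. Substituting variables for registers, even equal ones,
  keeps validity; conversely, giving equal variables the same register turns a valid atom into a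
  valid pattern.

  Two points need separate treatment. Equality on \<open>D\<close> may fail to be induced, so an
  equation between u and v becomes the demand that exchanging them at one position of an application
  keeps its value. And the empty formula has no variables, a case on which stability is silent; it
  is always satisfiable and is answered by a fixed positive instance. Malformed input yields the
  empty word, which codes no instance.\<close>

datatype 'r com =
    Skip
  | Fail
  | Write 'r bool
  | Move 'r move
  | Seq "'r com" "'r com" (infixr ";;" 60)
  | Cond 'r "nat \<Rightarrow> bool" "'r com" "'r com"
  | While 'r "nat \<Rightarrow> bool" "'r com"

section \<open>Small-step semantics of stack programs\<close>

definition keep :: "('r \<Rightarrow> nat) \<Rightarrow> 'r \<Rightarrow> nat \<times> move" where
  "keep \<sigma> = (\<lambda>r. (\<sigma> r, Stay))"

text \<open>A step is decided by the residual program and the scanned symbols alone, which is all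
  that a finite control can see. Dropping a finished \<open>Skip\<close> and unfolding a loop are
  steps of their own. \<open>Fail\<close> swallows the rest of a sequence, so an error found deep
  inside stops the whole run.\<close>

fun cstep :: "'r com \<Rightarrow> ('r \<Rightarrow> nat) \<Rightarrow> ('r com \<times> ('r \<Rightarrow> nat \<times> move)) option" where
  "cstep Skip \<sigma> = None"
| "cstep Fail \<sigma> = None"
| "cstep (Write r b) \<sigma> = Some (Skip, (keep \<sigma>)(r := (bit_symbol b, Stay)))"
| "cstep (Move r m) \<sigma> = Some (Skip, (keep \<sigma>)(r := (\<sigma> r, m)))"
| "cstep (a ;; b) \<sigma> =
     (if a = Skip then Some (b, keep \<sigma>)
      else if a = Fail then Some (Fail, keep \<sigma>)
      else map_option (\<lambda>(a', e). (a' ;; b, e)) (cstep a \<sigma>))"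
| "cstep (Cond r p a b) \<sigma> = Some (if p (\<sigma> r) then a else b, keep \<sigma>)"
| "cstep (While r p a) \<sigma> = Some (if p (\<sigma> r) then a ;; While r p a else Skip, keep \<sigma>)"

definition tstep :: "'r com \<times> ('r \<Rightarrow> tape) \<Rightarrow> 'r com \<times> ('r \<Rightarrow> tape)" where
  "tstep = (\<lambda>(c, ts). case cstep c (\<lambda>r. scanned (ts r)) of
     None \<Rightarrow> (c, ts)
   | Some (c', e) \<Rightarrow> (c', \<lambda>r. act (e r) (ts r)))"

lemma act_keep [simp]: "act (keep (\<lambda>r. scanned (ts r)) r) (ts r) = ts r"
  by (cases "ts r") (simp add: act_def keep_def scanned_def)

lemma act_upd:
  "(\<lambda>x. act (((keep (\<lambda>r. scanned (ts r)))(r := a)) x) (ts x)) = ts(r := act a (ts r))"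
  by auto

lemma tstep_upd:
  assumes "cstep c (\<lambda>r. scanned (ts r)) = Some (c', (keep (\<lambda>r. scanned (ts r)))(r := a))"
  shows "tstep (c, ts) = (c', ts(r := act a (ts r)))"
  using assms act_upd[of ts r a] by (simp add: tstep_def del: fun_upd_apply)

lemma cstep_None_iff: "cstep c \<sigma> = None \<longleftrightarrow> c = Skip \<or> c = Fail"
  by (induction c) auto

section \<open>Finiteness of tapes and control states\<close>

fun regs :: "'r com \<Rightarrow> 'r set" where
  "regs Skip = {}"
| "regs Fail = {}"
| "regs (Write r b) = {r}"
| "regs (Move r m) = {r}"
| "regs (a ;; b) = regs a \<union> regs b"
| "regs (Cond r p a b) = insert r (regs a \<union> regs b)"
| "regs (While r p a) = insert r (regs a)"

lemma finite_regs: "finite (regs c)"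
  by (induction c) auto

text \<open>The control states of the machine of a program are the residual programs of its runs.\<close>

fun residuals :: "'r com \<Rightarrow> 'r com set" where
  "residuals Skip = {Skip}"
| "residuals Fail = {Fail}"
| "residuals (Write r b) = {Write r b, Skip}"
| "residuals (Move r m) = {Move r m, Skip}"
| "residuals (a ;; b) = insert Fail ((\<lambda>a'. a' ;; b) ` residuals a \<union> residuals b)"
| "residuals (Cond r p a b) = insert (Cond r p a b) (residuals a \<union> residuals b)"
| "residuals (While r p a) =
     {While r p a, Skip, Fail} \<union> (\<lambda>a'. a' ;; While r p a) ` residuals a"

lemma finite_residuals: "finite (residuals c)"
  by (induction c) auto

lemma self_in_residuals [simp]: "c \<in> residuals c"
  by (induction c) auto

text \<open>Loops do not enlarge the control: an unfolded loop is its body followed by the same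
  loop, so the residuals of the body, each followed by the loop, account for every round.\<close>

lemma residuals_step:
  assumes "c' \<in> residuals c" "cstep c' \<sigma> = Some (c'', e)"
  shows "c'' \<in> residuals c"
  using assms
proof (induction c arbitrary: c' c'' e)
  case (Seq a b)
  show ?case
  proof (cases "c' \<in> residuals b")
    case True
    with Seq.IH(2) Seq.prems(2) show ?thesis by auto
  next
    case False
    with Seq.prems obtain a' where "a' \<in> residuals a" "c' = a' ;; b" by auto
    with Seq.IH(1)[of a'] Seq.prems(2) show ?thesis by (auto split: if_splits)
  qed
next
  case (Cond r p a b)
  then show ?case by (auto split: if_splits)
next
  case (While r p a)
  show ?case
  proof (cases "c' \<in> {While r p a, Skip, Fail}")
    case True
    with While.prems(2) show ?thesis by (auto split: if_splits)
  next
    case False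
    with While.prems obtain a' where "a' \<in> residuals a" "c' = a' ;; While r p a" by auto
    with While.IH[of a'] While.prems(2) show ?thesis by (auto split: if_splits)
  qed
qed auto

lemma regs_residuals: "c' \<in> residuals c \<Longrightarrow> regs c' \<subseteq> regs c"
  by (induction c arbitrary: c') (auto, blast+)

text \<open>Stores are total functions on registers, whereas the machine has tapes only for the
  registers that occur. A step must therefore be insensitive to all others.\<close>

lemma cstep_cong:
  assumes "regs c \<subseteq> X" "\<And>r. r \<in> X \<Longrightarrow> \<sigma> r = \<sigma>' r" "cstep c \<sigma> = Some (c', e)"
  shows "\<exists>e'. cstep c \<sigma>' = Some (c', e') \<and> (\<forall>r\<in>X. e' r = e r)"
  using assms
proof (induction c arbitrary: c' e)
  case (Seq a b)
  show ?case
  proof (cases "a = Skip \<or> a = Fail")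
    case True
    with Seq.prems show ?thesis by (auto simp: keep_def)
  next
    case False
    with Seq.prems obtain a' where "cstep a \<sigma> = Some (a', e)" "c' = a' ;; b" by auto
    with Seq.IH(1)[of a' e] Seq.prems False show ?thesis by auto
  qed
qed (auto simp: keep_def split: if_splits)

lemma cstep_symbols:
  assumes "cstep c \<sigma> = Some (c', e)" "\<sigma> r < 3"
  shows "fst (e r) < 3"
  using assms
  by (induction c arbitrary: c' e) (auto simp: keep_def bit_symbol_def split: if_splits)

section \<open>Compilation into a multitape Turing machine\<close>

definition position :: "'a list \<Rightarrow> 'a \<Rightarrow> nat" where
  "position xs x = (LEAST i. i < length xs \<and> xs ! i = x)"

lemma position:
  assumes "x \<in> set xs"
  shows "position xs x < length xs" "xs ! position xs x = x"
proof -
  have "\<exists>i. i < length xs \<and> xs ! i = x" using assms by (auto simp: in_set_conv_nth)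
  from LeastI_ex[OF this] show "position xs x < length xs" "xs ! position xs x = x"
    unfolding position_def by auto
qed

text \<open>The start program has to be state 0 although the list of states may contain it again;
  taking the least index guarantees this.\<close>

lemma position_hd: "xs \<noteq> [] \<Longrightarrow> position xs (hd xs) = 0"
  unfolding position_def by (rule Least_eq_0) (simp add: hd_conv_nth)

text \<open>Outside \<open>rs\<close> the symbol function is the unspecified
  \<open>the None\<close>; by \<open>cstep_cong\<close> this has no influence on the actions for the
  registers in \<open>rs\<close>.\<close>

definition com_tm :: "'r list \<Rightarrow> 'r com list \<Rightarrow> tm" where
  "com_tm rs qs = \<lparr>tm_tapes = length rs, tm_states = length qs, tm_symbols = 3,
     tm_delta = \<lambda>q ss.
       map_option (\<lambda>(c, e). (position qs c, map e rs))
         (cstep (qs ! q) (\<lambda>r. the (map_of (zip rs ss) r)))\<rparr>"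

lemma com_tm_simps [simp]:
  "tm_tapes (com_tm rs qs) = length rs" "tm_states (com_tm rs qs) = length qs"
  "tm_symbols (com_tm rs qs) = 3"
  by (simp_all add: com_tm_def)

locale com_machine =
  fixes rs :: "'r list" and qs :: "'r com list"
  assumes rs: "rs \<noteq> []" "distinct rs" and qs: "qs \<noteq> []"
    and regs_qs: "c \<in> set qs \<Longrightarrow> regs c \<subseteq> set rs"
    and step_qs: "c \<in> set qs \<Longrightarrow> cstep c \<sigma> = Some (c', e) \<Longrightarrow> c' \<in> set qs"
begin

lemma turing_machine: "turing_machine (com_tm rs qs)"
proof -
  have "case tm_delta (com_tm rs qs) q ss of None \<Rightarrow> True
     | Some (q', as) \<Rightarrow> q' < length qs \<and> as \<in> tuples ({..<3} \<times> UNIV) (length rs)"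
    if q: "q < length qs" and ss: "ss \<in> tuples {..<3} (length rs)" for q ss
  proof (cases "cstep (qs ! q) (\<lambda>r. the (map_of (zip rs ss) r))")
    case None
    then show ?thesis by (simp add: com_tm_def)
  next
    case (Some ce)
    obtain c e where ce: "ce = (c, e)" by (cases ce)
    have "the (map_of (zip rs ss) r) < 3" if r: "r \<in> set rs" for r
    proof -
      obtain s where s: "map_of (zip rs ss) r = Some s"
        using ss r map_of_zip_is_Some[of rs ss r] by (auto simp: tuples_def)
      then have "s \<in> set ss" by (meson map_of_SomeD set_zip_rightD)
      with s ss show ?thesis by (auto simp: tuples_def)
    qed
    then have "fst (e r) < 3" if "r \<in> set rs" for r
      using cstep_symbols[OF Some[unfolded ce]] that by blast
    moreover have "c \<in> set qs"
      using step_qs q Some ce nth_mem by blast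
    ultimately show ?thesis
      using Some ce by (auto simp: com_tm_def tuples_def position) (metis fst_conv)
  qed
  with rs qs show ?thesis
    unfolding turing_machine_def com_tm_simps by (auto simp: Suc_le_eq)
qed

lemma delta:
  assumes "c \<in> set qs"
  shows "cstep c (\<lambda>r. scanned (ts r)) = None \<Longrightarrow>
      tm_delta (com_tm rs qs) (position qs c) (map scanned (map ts rs)) = None"
    and "cstep c (\<lambda>r. scanned (ts r)) = Some (c', e) \<Longrightarrow>
      tm_delta (com_tm rs qs) (position qs c) (map scanned (map ts rs)) = Some (position qs c', map e rs)"
proof -
  let ?\<sigma> = "\<lambda>r. scanned (ts r)"
  let ?\<sigma>' = "\<lambda>r. the (map_of (zip rs (map scanned (map ts rs))) r)"
  have eq: "?\<sigma> r = ?\<sigma>' r" if "r \<in> set rs" for r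
    using that by (simp add: map_of_zip_map o_def)
  show "tm_delta (com_tm rs qs) (position qs c) (map scanned (map ts rs)) = None"
    if "cstep c ?\<sigma> = None"
    using that by (simp add: com_tm_def cstep_None_iff position[OF assms])
  show "tm_delta (com_tm rs qs) (position qs c) (map scanned (map ts rs)) = Some (position qs c', map e rs)"
    if "cstep c ?\<sigma> = Some (c', e)"
    using cstep_cong[OF regs_qs[OF assms] eq that]
    by (auto simp: com_tm_def position[OF assms])
qed

lemma tm_step:
  assumes "c \<in> set qs"
  shows "fst (tstep (c, ts)) \<in> set qs"
    and "tm_step (com_tm rs qs) (position qs c, map ts rs) =
      (position qs (fst (tstep (c, ts))), map (snd (tstep (c, ts))) rs)"
proof -
  have "fst (tstep (c, ts)) \<in> set qs \<and> tm_step (com_tm rs qs) (position qs c, map ts rs) =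
      (position qs (fst (tstep (c, ts))), map (snd (tstep (c, ts))) rs)"
  proof (cases "cstep c (\<lambda>r. scanned (ts r))")
    case None
    then show ?thesis using assms delta(1)[OF assms None]
      by (simp add: tm_step_def tstep_def)
  next
    case (Some ce)
    obtain c' e where ce: "ce = (c', e)" by (cases ce)
    have "map2 act (map e rs) (map ts rs) = map (\<lambda>r. act (e r) (ts r)) rs"
      by (induction rs) auto
    with Some ce show ?thesis using step_qs[OF assms Some[unfolded ce]] delta(2)[OF assms Some[unfolded ce]]
      by (simp add: tm_step_def tstep_def)
  qed
  then show "fst (tstep (c, ts)) \<in> set qs"
    and "tm_step (com_tm rs qs) (position qs c, map ts rs) =
      (position qs (fst (tstep (c, ts))), map (snd (tstep (c, ts))) rs)"
    by blast+
qed

lemma tm_steps: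
  assumes "c \<in> set qs" "(tstep ^^ n) (c, ts) = (c', ts')"
  shows "c' \<in> set qs \<and>
    (tm_step (com_tm rs qs) ^^ n) (position qs c, map ts rs) = (position qs c', map ts' rs)"
  using assms(2)
proof (induction n arbitrary: c' ts')
  case 0
  then show ?case using assms(1) by simp
next
  case (Suc n)
  obtain c1 ts1 where n: "(tstep ^^ n) (c, ts) = (c1, ts1)" by (cases "(tstep ^^ n) (c, ts)")
  then show ?case using Suc.IH[OF n] tm_step[of c1 ts1] Suc.prems by simp
qed

end

section \<open>Stores and timed runs\<close>

type_synonym 'r store = "'r \<Rightarrow> bool list"

definition represents :: "('r \<Rightarrow> tape) \<Rightarrow> 'r store \<Rightarrow> bool" where
  "represents ts S \<longleftrightarrow> (\<forall>r. tape_output (ts r) (S r))"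

definition exec :: "'r com \<Rightarrow> 'r store \<Rightarrow> nat \<Rightarrow> 'r com \<Rightarrow> 'r store \<Rightarrow> bool" where
  "exec c S t c' S' \<longleftrightarrow> (\<forall>ts. represents ts S \<longrightarrow>
     (\<exists>n\<le>t. \<exists>ts'. (tstep ^^ n) (c, ts) = (c', ts') \<and> represents ts' S'))"

abbreviation runs :: "'r com \<Rightarrow> 'r store \<Rightarrow> nat \<Rightarrow> 'r store \<Rightarrow> bool" where
  "runs c S t S' \<equiv> exec c S t Skip S'"

theorem poly_time_com:
  assumes "\<And>x. \<exists>S'. (runs c ((\<lambda>_. [])(r := x)) (T (length x)) S' \<or>
      exec c ((\<lambda>_. [])(r := x)) (T (length x)) Fail S') \<and> S' r = f x"
    and "\<And>n. T n \<le> poly p n"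
  shows "poly_time f"
proof -
  have "finite (regs c - {r})" by (simp add: finite_regs)
  then obtain rs' where rs': "set rs' = regs c - {r}" "distinct rs'"
    using finite_distinct_list[of "regs c - {r}"] by metis
  obtain qs' where qs': "set qs' = residuals c" using finite_list[OF finite_residuals] by blast
  \<comment> \<open>The first tape carries input and output and state 0 is initial, hence
    \<open>r\<close> and the program itself head their lists.\<close>
  define rs where "rs = r # rs'"
  define qs where "qs = c # qs'"
  have set_qs: "set qs = residuals c" by (simp add: qs_def qs' insert_absorb)
  have set_rs: "set rs = insert r (regs c)" by (simp add: rs_def rs')
  interpret com_machine rs qs
  proof
    show "rs \<noteq> []" "distinct rs" "qs \<noteq> []" using rs' by (auto simp: rs_def qs_def)
    show "regs c' \<subseteq> set rs" if "c' \<in> set qs" for c'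
      using that regs_residuals set_qs set_rs by blast
    show "c'' \<in> set qs" if "c' \<in> set qs" "cstep c' \<sigma> = Some (c'', e)" for c' \<sigma> c'' e
      using that residuals_step set_qs by blast
  qed
  let ?M = "com_tm rs qs"
  have "\<exists>n\<le>poly p (length x).
       let C = (tm_step ?M ^^ n) (tm_init ?M x) in tm_halted ?M C \<and> tape_output (hd (snd C)) (f x)" for x
  proof -
    define ts where "ts = (\<lambda>_. (\<lambda>_. 0, 0))(r := input_tape x)"
    have init: "tm_init ?M x = (position qs c, map ts rs)"
    proof -
      have "map ts rs' = replicate (length rs') (\<lambda>_. 0, 0)"
        using rs' by (intro replicate_eqI) (auto simp: ts_def)
      then show ?thesis using position_hd[of qs]
        by (simp add: tm_init_def com_tm_def rs_def qs_def ts_def)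
    qed
    have "represents ts ((\<lambda>_. [])(r := x))"
      by (auto simp: represents_def ts_def tape_output_def input_tape_def)
    then obtain n ts' c' S' where n: "n \<le> T (length x)" "(tstep ^^ n) (c, ts) = (c', ts')"
      "c' = Skip \<or> c' = Fail" "represents ts' S'" "S' r = f x"
      using assms(1)[of x] unfolding exec_def by blast
    then have *: "c' \<in> set qs" "(tm_step ?M ^^ n) (tm_init ?M x) = (position qs c', map ts' rs)"
      using tm_steps[of c n ts c' ts'] by (auto simp: init set_qs)
    moreover have "tm_halted ?M (position qs c', map ts' rs)"
      using delta(1)[OF *(1), of ts'] n(3) unfolding tm_halted_def by auto
    moreover have "tape_output (hd (map ts' rs)) (f x)"
      using n(4,5) by (simp add: rs_def represents_def) metis
    ultimately show ?thesis
      using n(1) assms(2)[of "length x"] by (intro exI[of _ n]) (auto simp: Let_def)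
  qed
  then show ?thesis unfolding poly_time_def using turing_machine by blast
qed

section \<open>Rules for stack programs\<close>

fun top_symbol :: "bool list \<Rightarrow> nat" where
  "top_symbol [] = 0"
| "top_symbol (b # xs) = bit_symbol b"

lemma scanned_top: "represents ts S \<Longrightarrow> scanned (ts r) = top_symbol (S r)"
  unfolding represents_def
  by (drule spec[of _ r], cases "S r"; cases "ts r") (auto simp: tape_output_def scanned_def)

lemma exec_mono: "exec c S t c' S' \<Longrightarrow> t \<le> t' \<Longrightarrow> exec c S t' c' S'"
  unfolding exec_def by (meson le_trans)

lemma exec_refl: "exec c S t c S"
  unfolding exec_def by (metis funpow_0 le0)

lemma exec_trans:
  assumes "exec c S t c' S'" "exec c' S' t' c'' S''"
  shows "exec c S (t + t') c'' S''"
  unfolding exec_def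
proof (intro allI impI)
  fix ts assume "represents ts S"
  then obtain n ts' where n: "n \<le> t" "(tstep ^^ n) (c, ts) = (c', ts')" "represents ts' S'"
    using assms(1) unfolding exec_def by blast
  then obtain n' ts'' where n': "n' \<le> t'" "(tstep ^^ n') (c', ts') = (c'', ts'')" "represents ts'' S''"
    using assms(2) unfolding exec_def by blast
  have "(tstep ^^ (n' + n)) (c, ts) = (c'', ts'')" using n n' by (simp add: funpow_add)
  then show "\<exists>n\<le>t + t'. \<exists>ts'. (tstep ^^ n) (c, ts) = (c'', ts') \<and> represents ts' S''"
    using n n' by (intro exI[of _ "n' + n"]) auto
qed

lemma exec_step:
  assumes "\<And>ts. represents ts S \<Longrightarrow>
    \<exists>e. cstep c (\<lambda>r. scanned (ts r)) = Some (c', e) \<and> represents (\<lambda>r. act (e r) (ts r)) S'"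
  shows "exec c S (Suc 0) c' S'"
  unfolding exec_def
proof (intro allI impI)
  fix ts assume "represents ts S"
  from assms[OF this] show "\<exists>n\<le>Suc 0. \<exists>ts'. (tstep ^^ n) (c, ts) = (c', ts') \<and> represents ts' S'"
    by (intro exI[of _ "Suc 0"]) (auto simp: tstep_def)
qed

lemma tstep_halted [simp]: "(tstep ^^ n) (Skip, ts) = (Skip, ts)" "(tstep ^^ n) (Fail, ts) = (Fail, ts)"
  by (induction n) (auto simp: tstep_def)

text \<open>A halted \<open>a\<close> idles for the remaining steps, whereas \<open>a ;; b\<close>
  would move on. The idle steps are dropped, which is why only \<open>m \<le> n\<close> can be
  claimed.\<close>

lemma tsteps_Seq:
  assumes "(tstep ^^ n) (a, ts) = (a', ts')"
  shows "\<exists>m\<le>n. (tstep ^^ m) (a ;; b, ts) = (a' ;; b, ts')"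
  using assms
proof (induction n arbitrary: a ts)
  case 0
  then show ?case by auto
next
  case (Suc n)
  show ?case
  proof (cases "cstep a (\<lambda>r. scanned (ts r))")
    case None
    then have "a = Skip \<or> a = Fail" by (simp add: cstep_None_iff)
    with Suc.prems have "a' = a \<and> ts' = ts" using tstep_halted[of "Suc n" ts] by auto
    then show ?thesis by (intro exI[of _ 0]) auto
  next
    case (Some ce)
    obtain a1 e where ce: "ce = (a1, e)" by (cases ce)
    let ?ts = "\<lambda>r. act (e r) (ts r)"
    have a: "a \<noteq> Skip" "a \<noteq> Fail" using Some by auto
    have "(tstep ^^ n) (a1, ?ts) = (a', ts')"
      using Suc.prems Some ce by (simp add: funpow_Suc_right tstep_def del: funpow.simps)
    from Suc.IH[OF this] obtain m where m: "m \<le> n" "(tstep ^^ m) (a1 ;; b, ?ts) = (a' ;; b, ts')" by blast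
    have "tstep (a ;; b, ts) = (a1 ;; b, ?ts)" using Some ce a by (simp add: tstep_def)
    with m have "(tstep ^^ Suc m) (a ;; b, ts) = (a' ;; b, ts')"
      by (simp add: funpow_Suc_right del: funpow.simps)
    with m show ?thesis by (intro exI[of _ "Suc m"]) auto
  qed
qed

lemma exec_Seq_left: "exec a S t a' S' \<Longrightarrow> exec (a ;; b) S t (a' ;; b) S'"
  unfolding exec_def by (meson le_trans tsteps_Seq)

lemma exec_Seq:
  assumes "runs a S t S'" "exec b S' t' c S''"
  shows "exec (a ;; b) S (t + t' + 1) c S''"
proof -
  have "exec (Skip ;; b) S' (Suc 0) b S'" by (rule exec_step) (auto simp: represents_def)
  from exec_trans[OF exec_trans[OF exec_Seq_left[OF assms(1)] this] assms(2)]
  show ?thesis by (rule exec_mono) simp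
qed

lemma exec_Seq_Fail:
  assumes "exec a S t Fail S'"
  shows "exec (a ;; b) S (t + 1) Fail S'"
proof -
  have "exec (Fail ;; b) S' (Suc 0) Fail S'" by (rule exec_step) (auto simp: represents_def)
  from exec_trans[OF exec_Seq_left[OF assms(1)] this] show ?thesis by simp
qed

lemma exec_silent:
  assumes "\<And>ts. represents ts S \<Longrightarrow>
    cstep c (\<lambda>r. scanned (ts r)) = Some (c', keep (\<lambda>r. scanned (ts r)))"
  shows "exec c S (Suc 0) c' S"
  by (rule exec_step) (auto simp: assms)

lemma exec_Cond:
  assumes "exec (if p (top_symbol (S r)) then a else b) S t c S'"
  shows "exec (Cond r p a b) S (t + 1) c S'"
proof -
  have "exec (Cond r p a b) S (Suc 0) (if p (top_symbol (S r)) then a else b) S"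
    by (rule exec_silent) (simp add: scanned_top)
  from exec_trans[OF this assms] show ?thesis by simp
qed

lemma exec_While_step:
  "exec (While r p a) S (Suc 0) (if p (top_symbol (S r)) then a ;; While r p a else Skip) S"
  by (rule exec_silent) (simp add: scanned_top)

lemma exec_While_end: "\<not> p (top_symbol (S r)) \<Longrightarrow> runs (While r p a) S (Suc 0) S"
  using exec_While_step[of r p a S] by simp

lemma exec_While:
  assumes "p (top_symbol (S r))" "runs a S t S'" "exec (While r p a) S' t' c S''"
  shows "exec (While r p a) S (t + t' + 2) c S''"
proof -
  have "exec (While r p a) S (Suc 0) (a ;; While r p a) S"
    using exec_While_step[of r p a S] assms(1) by simp
  from exec_trans[OF this exec_Seq[OF assms(2,3)]] show ?thesis by simp
qed

lemma exec_While_Fail: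
  assumes "p (top_symbol (S r))" "exec a S t Fail S'"
  shows "exec (While r p a) S (t + 2) Fail S'"
proof -
  have "exec (While r p a) S (Suc 0) (a ;; While r p a) S"
    using exec_While_step[of r p a S] assms(1) by simp
  from exec_trans[OF this exec_Seq_Fail[OF assms(2)]] show ?thesis by simp
qed

abbreviation Pop :: "'r \<Rightarrow> 'r com" where
  "Pop r \<equiv> Move r Go_Right"

text \<open>Stacks grow to the left, over whatever earlier pops have left behind; the rest of the
  stack stays where it is.\<close>

definition Push :: "'r \<Rightarrow> bool \<Rightarrow> 'r com" where
  "Push r b = Move r Go_Left ;; Write r b"

lemma represents_upd:
  assumes "represents ts S" "tape_output t xs"
  shows "represents (ts(r := t)) (S(r := xs))"
  using assms by (auto simp: represents_def)

lemma runs_Pop: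
  assumes "S r = b # xs"
  shows "runs (Pop r) S (Suc 0) (S(r := xs))"
proof (rule exec_step)
  fix ts assume ts: "represents ts S"
  let ?e = "(keep (\<lambda>r. scanned (ts r)))(r := (scanned (ts r), Go_Right))"
  have eq: "(\<lambda>r. act (?e r) (ts r)) = ts(r := act (scanned (ts r), Go_Right) (ts r))"
    by auto
  obtain f h where fh: "ts r = (f, h)" by (cases "ts r")
  have out: "tape_output (f, h) (b # xs)" using ts assms fh by (auto simp: represents_def) (metis fh)
  have "tape_output (f, h + 1) xs"
    using out unfolding tape_output_def by (force simp: algebra_simps)
  then have "tape_output (act (scanned (ts r), Go_Right) (ts r)) xs"
    by (simp add: fh act_def scanned_def)
  from represents_upd[OF ts this, of r] show "\<exists>e. cstep (Pop r) (\<lambda>r. scanned (ts r)) = Some (Skip, e) \<and>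
       represents (\<lambda>r. act (e r) (ts r)) (S(r := xs))"
    by (intro exI[of _ ?e]) (simp only: eq cstep.simps)
qed

lemma runs_Push: "runs (Push r b) S 3 (S(r := b # S r))"
  unfolding exec_def
proof (intro allI impI)
  fix ts assume ts: "represents ts S"
  obtain f h where fh: "ts r = (f, h)" by (cases "ts r")
  define ts1 where "ts1 = ts(r := (f, h - 1))"
  define ts2 where "ts2 = ts(r := (f(h - 1 := bit_symbol b), h - 1))"
  have out: "tape_output (f, h) (S r)" using ts fh by (auto simp: represents_def) (metis fh)
  have 1: "tstep (Push r b, ts) = (Skip ;; Write r b, ts1)"
    unfolding ts1_def using tstep_upd[of "Push r b" ts "Skip ;; Write r b" r "(scanned (ts r), Go_Left)"]
    by (simp add: Push_def fh act_def scanned_def)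
  have 2: "tstep (Skip ;; Write r b, ts1) = (Write r b, ts1)"
    by (simp add: tstep_def)
  have 3: "tstep (Write r b, ts1) = (Skip, ts2)"
    using tstep_upd[of "Write r b" ts1 Skip r "(bit_symbol b, Stay)"]
    by (simp add: ts1_def ts2_def act_def)
  have "tape_output (f(h - 1 := bit_symbol b), h - 1) (b # S r)"
    using out unfolding tape_output_def by (auto simp: nth_Cons split: nat.splits)
  then have "represents ts2 (S(r := b # S r))"
    unfolding ts2_def by (rule represents_upd[OF ts])
  then show "\<exists>n\<le>3. \<exists>ts'. (tstep ^^ n) (Push r b, ts) = (Skip, ts') \<and> represents ts' (S(r := b # S r))"
    using 1 2 3 by (intro exI[of _ 3] exI[of _ ts2]) (simp add: numeral_3_eq_3)
qed

lemma exec_Seq_next: "runs a S t S' \<Longrightarrow> exec (a ;; b) S (t + 1) b S'"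
  using exec_Seq[OF _ exec_refl, of a S t S' b 0] by (auto elim: exec_mono)

text \<open>Comparing the final stores register by register reduces each use to case distinctions on
  function updates.\<close>

lemma exec_weaken:
  assumes "exec c S t c' S'" "t \<le> t'" "\<And>r. S' r = S'' r"
  shows "exec c S t' c' S''"
proof -
  have "S' = S''" using assms(3) by (rule ext)
  with exec_mono[OF assms(1,2)] show ?thesis by simp
qed

lemma exec_While_next:
  assumes "p (top_symbol (S r))" "runs a S t S'"
  shows "exec (While r p a) S (t + 2) (While r p a) S'"
proof -
  have "exec (While r p a) S (Suc 0) (a ;; While r p a) S"
    using exec_While_step[of r p a S] assms(1) by simp
  from exec_trans[OF this exec_Seq_next[OF assms(2)]] show ?thesis by simp
qed

text \<open>After one round the loop stands again in front of its continuation. Inductions over the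
  input can thus speak of a whole program of the form \<open>While r p a ;; b\<close>.\<close>

lemma exec_While_Seq:
  assumes "p (top_symbol (S r))" "runs a S t S'" "exec (While r p a ;; b) S' t' c S''"
  shows "exec (While r p a ;; b) S (t + t' + 2) c S''"
  using exec_trans[OF exec_Seq_left[OF exec_While_next[where p = p, OF assms(1,2)]] assms(3)]
  by (simp add: ac_simps)

text \<open>The register \<open>r\<close> will be the output tape, and malformed input has to
  produce the empty word; halting in \<open>Fail\<close> alone would not ensure that.\<close>

definition fails :: "'r \<Rightarrow> 'r com \<Rightarrow> 'r store \<Rightarrow> nat \<Rightarrow> bool" where
  "fails r c S t \<longleftrightarrow> (\<exists>S'. exec c S t Fail S' \<and> S' r = [])"

lemma fails_mono: "fails r c S t \<Longrightarrow> t \<le> t' \<Longrightarrow> fails r c S t'"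
  unfolding fails_def by (meson exec_mono)

lemma fails_exec:
  "exec c S t c' S' \<Longrightarrow> fails r c' S' t' \<Longrightarrow> fails r c S (t + t')"
  unfolding fails_def by (meson exec_trans)

lemma fails_Seq_left: "fails r a S t \<Longrightarrow> fails r (a ;; b) S (t + 1)"
  unfolding fails_def by (meson exec_Seq_Fail)

lemma fails_Seq_right: "runs a S t S' \<Longrightarrow> fails r b S' t' \<Longrightarrow> fails r (a ;; b) S (t + t' + 1)"
  unfolding fails_def by (meson exec_Seq)

lemma fails_Cond:
  "fails q (if p (top_symbol (S r)) then a else b) S t \<Longrightarrow> fails q (Cond r p a b) S (t + 1)"
  unfolding fails_def by (meson exec_Cond)

lemma fails_While: "p (top_symbol (S r)) \<Longrightarrow> fails q a S t \<Longrightarrow> fails q (While r p a) S (t + 2)"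
  unfolding fails_def by (meson exec_While_Fail)

abbreviation is_empty :: "nat \<Rightarrow> bool" where "is_empty s \<equiv> s = 0"
abbreviation is_False :: "nat \<Rightarrow> bool" where "is_False s \<equiv> s = 1"
abbreviation is_True :: "nat \<Rightarrow> bool" where "is_True s \<equiv> s = 2"
abbreviation nonempty :: "nat \<Rightarrow> bool" where "nonempty s \<equiv> s \<noteq> 0"

lemma top_symbol_simps [simp]:
  "top_symbol xs = 0 \<longleftrightarrow> xs = []"
  "0 < top_symbol xs \<longleftrightarrow> xs \<noteq> []"
  "bit_symbol b = 2 \<longleftrightarrow> b" "bit_symbol b = 1 \<longleftrightarrow> \<not> b" "bit_symbol b = Suc 0 \<longleftrightarrow> \<not> b"
  "0 < bit_symbol b" "bit_symbol b \<noteq> 0"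
  by (cases xs; auto simp: bit_symbol_def)+

section \<open>Moving words between stacks\<close>

fun pushes :: "'r \<Rightarrow> bool list \<Rightarrow> 'r com" where
  "pushes r [] = Skip"
| "pushes r (b # bs) = Push r b ;; pushes r bs"

lemma runs_pushes: "runs (pushes r bs) S (4 * length bs) (S(r := rev bs @ S r))"
proof (induction bs arbitrary: S)
  case Nil
  then show ?case using exec_refl[of Skip S 0] by simp
next
  case (Cons b bs)
  show ?case unfolding pushes.simps
    by (rule exec_weaken[OF exec_Seq[OF runs_Push Cons.IH]]) auto
qed

definition clear :: "'r \<Rightarrow> 'r com" where
  "clear r = While r nonempty (Pop r)"

lemma runs_clear: "runs (clear r) S (3 * length (S r) + 1) (S(r := []))"
proof (induction "S r" arbitrary: S)
  case Nil
  show ?case unfolding clear_def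
    by (rule exec_weaken[OF exec_While_end]) (use Nil in auto)
next
  case (Cons b xs)
  from Cons(1)[of "S(r := xs)"]
  have "runs (While r nonempty (Pop r)) (S(r := xs)) (3 * length xs + 1) (S(r := []))"
    by (simp add: clear_def)
  from exec_While[where p = nonempty and S = S, OF _ runs_Pop[of S r b xs, OF Cons(2)[symmetric]] this]
  show ?case unfolding clear_def by (rule exec_weaken) (use Cons(2)[symmetric] in auto)
qed

definition abort :: "'r \<Rightarrow> 'r com" where
  "abort r = clear r ;; Fail"

lemma fails_abort: "fails r (abort r) S (3 * length (S r) + 2)"
  unfolding fails_def abort_def using exec_Seq_next[OF runs_clear[of r S], of Fail] by auto

text \<open>Two targets, with a word pushed onto each for every bit popped, cover moving, copying
  and re-coding of a stack by a single loop. Each target receives its word in reversed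
  order.\<close>

definition transfer ::
  "'r \<Rightarrow> 'r \<Rightarrow> (bool \<Rightarrow> bool list) \<Rightarrow> 'r \<Rightarrow> (bool \<Rightarrow> bool list) \<Rightarrow> 'r com" where
  "transfer r a ha b hb = While r nonempty
     (Cond r is_True (Pop r ;; pushes a (ha True) ;; pushes b (hb True))
        (Pop r ;; pushes a (ha False) ;; pushes b (hb False)))"

text \<open>The limit 5 comes from emitting a name: one bit is saved for restoring the register and
  four bits go to the output. Five pushes at cost 4 together with the control fit into 30 steps per
  bit.\<close>

lemma runs_transfer:
  assumes "r \<noteq> a" "r \<noteq> b" "a \<noteq> b" "\<And>x. length (ha x) + length (hb x) \<le> 5"
  shows "runs (transfer r a ha b hb) S (30 * length (S r) + 1)
    (S(r := [], a := rev (concat (map ha (S r))) @ S a, b := rev (concat (map hb (S r))) @ S b))"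
proof (induction "S r" arbitrary: S)
  case Nil
  show ?case unfolding transfer_def
    by (rule exec_weaken[OF exec_While_end]) (use Nil in auto)
next
  case (Cons x xs)
  let ?q = "Cond r is_True (Pop r ;; pushes a (ha True) ;; pushes b (hb True))
        (Pop r ;; pushes a (ha False) ;; pushes b (hb False))"
  let ?S1 = "S(r := xs)"
  let ?S2 = "?S1(a := rev (ha x) @ S a)"
  let ?S3 = "?S2(b := rev (hb x) @ S b)"
  have Sr: "S r = x # xs" using Cons(2) by simp
  have "runs (pushes a (ha x)) ?S1 (4 * length (ha x)) ?S2"
    using runs_pushes[of a "ha x" ?S1] assms by simp
  moreover have "runs (pushes b (hb x)) ?S2 (4 * length (hb x)) ?S3"
    using runs_pushes[of b "hb x" ?S2] assms by simp
  ultimately have "runs (Pop r ;; pushes a (ha x) ;; pushes b (hb x)) S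
      (Suc 0 + (4 * length (ha x) + 4 * length (hb x) + 1) + 1) ?S3"
    using exec_Seq[OF runs_Pop[of S r x xs] exec_Seq] Sr by blast
  then have "runs (if is_True (top_symbol (S r)) then Pop r ;; pushes a (ha True) ;; pushes b (hb True)
      else Pop r ;; pushes a (ha False) ;; pushes b (hb False)) S
      (Suc 0 + (4 * length (ha x) + 4 * length (hb x) + 1) + 1) ?S3"
    using Sr by (cases x) simp_all
  then have body: "runs ?q S (Suc 0 + (4 * length (ha x) + 4 * length (hb x) + 1) + 1 + 1) ?S3"
    by (rule exec_Cond)
  have IH: "runs (While r nonempty ?q) ?S3 (30 * length xs + 1)
    (?S3(r := [], a := rev (concat (map ha xs)) @ ?S3 a, b := rev (concat (map hb xs)) @ ?S3 b))"
    using Cons(1)[of ?S3] assms unfolding transfer_def by simp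
  have eq: "?S3(r := [], a := rev (concat (map ha xs)) @ ?S3 a, b := rev (concat (map hb xs)) @ ?S3 b)
    = S(r := [], a := rev (concat (map ha (S r))) @ S a, b := rev (concat (map hb (S r))) @ S b)"
    using assms Sr by (auto simp: fun_eq_iff)
  show ?case unfolding transfer_def
    by (rule exec_mono, rule exec_While[OF _ body IH[unfolded eq]])
       (use Sr assms(4)[of x] in auto)
qed

text \<open>The detour over \<open>t\<close> undoes the reversal, and the way back fills both
  stacks.\<close>

definition copy :: "'r \<Rightarrow> 'r \<Rightarrow> 'r \<Rightarrow> 'r com" where
  "copy t a b = transfer a t (\<lambda>x. [x]) b (\<lambda>_. []) ;; transfer t a (\<lambda>x. [x]) b (\<lambda>x. [x])"

lemma concat_map_singleton [simp]: "concat (map (\<lambda>x. [x]) xs) = xs"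
  by (induction xs) auto

lemma concat_map_Nil [simp]: "concat (map (\<lambda>x. []) xs) = []"
  by (induction xs) auto

lemma runs_copy:
  assumes "t \<noteq> a" "t \<noteq> b" "a \<noteq> b" "S t = []" "S b = []"
  shows "runs (copy t a b) S (60 * length (S a) + 3) (S(b := S a))"
proof -
  let ?S1 = "S(a := [], t := rev (S a))"
  have eq1: "S(a := [], t := rev (concat (map (\<lambda>x. [x]) (S a))) @ S t,
      b := rev (concat (map (\<lambda>_. []) (S a))) @ S b) = ?S1"
    using assms by (auto simp: fun_eq_iff)
  have 1: "runs (transfer a t (\<lambda>x. [x]) b (\<lambda>_. [])) S (30 * length (S a) + 1) ?S1"
    using runs_transfer[of a t b "\<lambda>x. [x]" "\<lambda>_. []" S, unfolded eq1] assms by auto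
  have eq2: "?S1(t := [], a := rev (concat (map (\<lambda>x. [x]) (?S1 t))) @ ?S1 a,
      b := rev (concat (map (\<lambda>x. [x]) (?S1 t))) @ ?S1 b) = S(b := S a)"
    using assms by (auto simp: fun_eq_iff)
  have 2: "runs (transfer t a (\<lambda>x. [x]) b (\<lambda>x. [x])) ?S1 (30 * length (S a) + 1) (S(b := S a))"
    using runs_transfer[of t a b "\<lambda>x. [x]" "\<lambda>x. [x]" ?S1, unfolded eq2] assms by auto
  show ?thesis unfolding copy_def
    by (rule exec_mono[OF exec_Seq[OF 1 2]]) simp
qed

text \<open>At most \<open>d\<close> bits are moved into the finite control, one branch for each
  word. This is how a relation symbol, which is part of the input, selects among finitely many
  continuations.\<close>

fun read :: "'r \<Rightarrow> nat \<Rightarrow> (bool list \<Rightarrow> 'r com) \<Rightarrow> bool list \<Rightarrow> 'r com" where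
  "read r 0 P acc = P acc"
| "read r (Suc d) P acc = Cond r is_empty (P acc)
     (Cond r is_True (Pop r ;; read r d P (acc @ [True])) (Pop r ;; read r d P (acc @ [False])))"

lemma exec_read:
  assumes "exec (P (acc @ take d (S r))) (S(r := drop d (S r))) t c S'"
  shows "exec (read r d P acc) S (t + 4 * d) c S'"
  using assms
proof (induction d arbitrary: acc S)
  case 0
  then show ?case by simp
next
  case (Suc d)
  show ?case
  proof (cases "S r")
    case Nil
    with Suc.prems have "exec (P acc) S t c S'" by (simp add: fun_upd_idem)
    then have "exec (read r (Suc d) P acc) S (t + 1) c S'"
      unfolding read.simps by (intro exec_Cond) (simp add: Nil)
    then show ?thesis by (rule exec_mono) simp
  next
    case (Cons b xs)
    have "exec (P (acc @ take (Suc d) (S r))) (S(r := drop (Suc d) (S r))) t c S'"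
      using Suc.prems .
    then have "exec (P ((acc @ [b]) @ take d ((S(r := xs)) r)))
        ((S(r := xs))(r := drop d ((S(r := xs)) r))) t c S'"
      using Cons by simp
    then have "exec (read r d P (acc @ [b])) (S(r := xs)) (t + 4 * d) c S'"
      by (rule Suc.IH)
    from exec_Seq[OF runs_Pop[of S r b xs, OF Cons] this]
    have "exec (Pop r ;; read r d P (acc @ [b])) S (Suc 0 + (t + 4 * d) + 1) c S'" .
    then have "exec (if is_True (top_symbol (S r)) then Pop r ;; read r d P (acc @ [True])
        else Pop r ;; read r d P (acc @ [False])) S (Suc 0 + (t + 4 * d) + 1) c S'"
      using Cons by (cases b) simp_all
    then have "exec (Cond r is_True (Pop r ;; read r d P (acc @ [True])) (Pop r ;; read r d P (acc @ [False])))
        S (Suc 0 + (t + 4 * d) + 1 + 1) c S'"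
      by (rule exec_Cond)
    then have "exec (read r (Suc d) P acc) S (Suc 0 + (t + 4 * d) + 1 + 1 + 1) c S'"
      unfolding read.simps using Cons by (intro exec_Cond) simp
    then show ?thesis by (rule exec_mono) simp
  qed
qed

section \<open>Reading formulas\<close>

text \<open>\<open>Inp\<close> is both input and output; \<open>Sav\<close> keeps the input for a
  second pass. \<open>Arg j\<close> holds the variables of the current atom, \<open>Occ\<close> the
  codes of all variable occurrences, \<open>Iter k\<close> the part of \<open>Occ\<close> that loop
  k has still to visit, and \<open>Loop k\<close> its current value.\<close>

datatype reg = Inp | Sav | Tmp | Sym | Occ | Out_vars | Out_form | Arg nat | Loop nat | Iter nat

definition parse_name :: "reg \<Rightarrow> reg \<Rightarrow> reg com" where
  "parse_name src dst =
     While src is_True (Pop src ;; Cond src is_empty (abort Inp)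
       (Cond src is_True (Pop src ;; Push dst True) (Pop src ;; Push dst False))) ;;
     Cond src is_False (Pop src) (abort Inp)"

lemma code_name_simps [simp]:
  "code_name [] = [False]" "code_name (b # n) = True # b # code_name n"
  by (simp_all add: code_name_def code_list_def)

lemma code_name_not_Nil [simp]: "code_name n \<noteq> []"
  by (cases n) simp_all

lemma length_code_name [simp]: "length (code_name n) = 2 * length n + 1"
  by (induction n) simp_all

lemma code_list_simps [simp]:
  "code_list c [] = [False]" "code_list c (x # xs) = True # c x @ code_list c xs"
  by (simp_all add: code_list_def)

lemma code_name_prefix_cases:
  fixes xs :: "bool list"
  shows "xs = [] \<or> (\<exists>x. xs = False # x) \<or> xs = [True] \<or> (\<exists>b x. xs = True # b # x)"
proof (cases xs)
  case (Cons a y)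
  then show ?thesis by (cases a; cases y) simp_all
qed simp

lemma parse_name_step:
  assumes "S src = True # b # x" "src \<noteq> dst"
  shows "exec (parse_name src dst) S 12 (parse_name src dst) (S(src := x, dst := b # S dst))"
proof -
  let ?S1 = "S(src := b # x)" and ?S2 = "S(src := x)"
  have "runs (Pop src) ?S1 (Suc 0) ?S2"
    using runs_Pop[of ?S1 src b x] by simp
  moreover have "runs (Push dst b) ?S2 3 (S(src := x, dst := b # S dst))"
    using runs_Push[of dst b ?S2] assms by simp
  ultimately have "runs (Pop src ;; Push dst b) ?S1 (Suc 0 + 3 + 1) (S(src := x, dst := b # S dst))"
    by (rule exec_Seq)
  then have "runs (Cond src is_True (Pop src ;; Push dst True) (Pop src ;; Push dst False)) ?S1 6
      (S(src := x, dst := b # S dst))"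
    using exec_Cond[of is_True ?S1 src "Pop src ;; Push dst True" "Pop src ;; Push dst False" 5]
    by (cases b) simp_all
  then have "runs (Cond src is_empty (abort Inp)
       (Cond src is_True (Pop src ;; Push dst True) (Pop src ;; Push dst False))) ?S1 7
      (S(src := x, dst := b # S dst))"
    using exec_Cond[of is_empty ?S1 src "abort Inp" _ 6] by simp
  from exec_Seq[OF runs_Pop this, of True] assms
  have body: "runs (Pop src ;; Cond src is_empty (abort Inp)
       (Cond src is_True (Pop src ;; Push dst True) (Pop src ;; Push dst False))) S 9
      (S(src := x, dst := b # S dst))" by simp
  show ?thesis unfolding parse_name_def
    by (rule exec_mono, rule exec_While_Seq[where p = is_True and r = src, OF _ body exec_refl[of _ _ 0]])
       (simp_all add: assms(1))
qed

lemma runs_parse_name: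
  assumes "S src = code_name n @ x" "src \<noteq> dst"
  shows "runs (parse_name src dst) S (12 * length n + 5) (S(src := x, dst := rev n @ S dst))"
  using assms(1)
proof (induction n arbitrary: S)
  case Nil
  have "runs (While src is_True q) S (Suc 0) S" for q
    by (rule exec_While_end) (simp add: Nil)
  moreover have "runs (Cond src is_False (Pop src) (abort Inp)) S (Suc 0 + 1) (S(src := x))"
    using runs_Pop[of S src False x] Nil by (intro exec_Cond) simp
  ultimately have "runs (parse_name src dst) S (Suc 0 + (Suc 0 + 1) + 1) (S(src := x))"
    unfolding parse_name_def by (rule exec_Seq)
  then show ?case by (rule exec_weaken) (use assms(2) in auto)
next
  case (Cons b n)
  let ?S = "S(src := code_name n @ x, dst := b # S dst)"
  have "runs (parse_name src dst) ?S (12 * length n + 5) (?S(src := x, dst := rev n @ ?S dst))"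
    using assms(2) by (intro Cons.IH) simp
  moreover have "?S(src := x, dst := rev n @ ?S dst) = S(src := x, dst := rev (b # n) @ S dst)"
    using assms(2) by (auto simp: fun_eq_iff)
  ultimately show ?case
    by (intro exec_weaken[OF exec_trans[OF parse_name_step[of S src b "code_name n @ x" dst], OF _ _
         \<open>runs (parse_name src dst) ?S (12 * length n + 5) (?S(src := x, dst := rev n @ ?S dst))\<close>]])
       (use assms(2) Cons.prems in auto)
qed

text \<open>A full round consumes a marker and a bit. If the remainder began with the code of a
  name, so would the whole, so the defect persists until the word breaks off before or after a
  marker.\<close>

lemma fails_parse_name:
  assumes "\<nexists>n x. S src = code_name n @ x" "src \<noteq> dst" "dst \<noteq> Inp"
  shows "fails Inp (parse_name src dst) S (12 * length (S src) + 3 * length (S Inp) + 10)"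
  using assms(1)
proof (induction "length (S src)" arbitrary: S rule: less_induct)
  case less
  consider "S src = []" | x where "S src = False # x" | "S src = [True]"
    | b x where "S src = True # b # x"
    using code_name_prefix_cases[of "S src"] by blast
  then show ?case
  proof cases
    case 1
    have "runs (While src is_True q) S (Suc 0) S" for q
      by (rule exec_While_end) (simp add: 1)
    moreover have "fails Inp (Cond src is_False (Pop src) (abort Inp)) S (3 * length (S Inp) + 2 + 1)"
      using fails_abort[of Inp S] 1 by (intro fails_Cond) simp
    ultimately have "fails Inp (parse_name src dst) S (Suc 0 + (3 * length (S Inp) + 2 + 1) + 1)"
      unfolding parse_name_def by (rule fails_Seq_right)
    then show ?thesis by (rule fails_mono) simp
  next
    case (2 x)
    then have "S src = code_name [] @ x" by simp
    with less.prems show ?thesis by blast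
  next
    case 3
    let ?S1 = "S(src := [])"
    have "fails Inp (Cond src is_empty (abort Inp) q) ?S1 (3 * length (?S1 Inp) + 2 + 1)" for q
      using fails_abort[of Inp ?S1] by (intro fails_Cond) simp
    from fails_Seq_right[OF runs_Pop[of S src True "[]", OF 3] this]
    have *: "fails Inp (Pop src ;; Cond src is_empty (abort Inp) q) S (Suc 0 + (3 * length (?S1 Inp) + 2 + 1) + 1)" for q .
    have "fails Inp (parse_name src dst) S (Suc 0 + (3 * length (?S1 Inp) + 2 + 1) + 1 + 2 + 1)"
      unfolding parse_name_def
      by (rule fails_Seq_left, rule fails_While[OF _ *]) (simp add: 3)
    then show ?thesis by (rule fails_mono) simp
  next
    case (4 b x)
    let ?S = "S(src := x, dst := b # S dst)"
    have "fails Inp (parse_name src dst) ?S (12 * length (?S src) + 3 * length (?S Inp) + 10)"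
    proof (rule less.hyps)
      show "length (?S src) < length (S src)" using 4 assms(2) by simp
      show "\<nexists>n z. ?S src = code_name n @ z"
      proof
        assume "\<exists>n z. ?S src = code_name n @ z"
        then obtain n z where "x = code_name n @ z" using assms(2) by auto
        then have "S src = code_name (b # n) @ z" using 4 by simp
        with less.prems show False by blast
      qed
    qed
    from fails_exec[OF parse_name_step[of S src b x dst, OF 4 assms(2)] this]
    show ?thesis by (rule fails_mono) (use 4 assms in auto)
  qed
qed

text \<open>The arity is known from the symbol, so the loop over the arguments is unrolled, each
  argument gets its own register, and a list of another length is rejected.\<close>

fun parse_args :: "nat \<Rightarrow> nat \<Rightarrow> reg com" where
  "parse_args i 0 = Cond Inp is_False (Pop Inp) (abort Inp)"
| "parse_args i (Suc m) = Cond Inp is_True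
     (Pop Inp ;; parse_name Inp (Arg i) ;; parse_args (Suc i) m) (abort Inp)"

text \<open>Names end up reversed in the registers, since they are pushed bit by bit.\<close>

fun load :: "nat \<Rightarrow> name list \<Rightarrow> reg store \<Rightarrow> reg store" where
  "load i [] S = S"
| "load i (v # vs) S = load (Suc i) vs (S(Arg i := rev v))"

lemma load_other: "(\<And>j. r \<noteq> Arg j) \<Longrightarrow> load i vs S r = S r"
  by (induction vs arbitrary: i S) auto

lemma load_outside: "j < i \<or> i + length vs \<le> j \<Longrightarrow> load i vs S (Arg j) = S (Arg j)"
  by (induction vs arbitrary: i S) auto

lemma load_inside: "j < length vs \<Longrightarrow> load i vs S (Arg (i + j)) = rev (vs ! j)"
proof (induction vs arbitrary: i j S)
  case (Cons v vs)
  then show ?case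
  proof (cases j)
    case 0
    then show ?thesis by (simp add: load_outside)
  next
    case (Suc k)
    then show ?thesis using Cons.IH[of k "Suc i"] Cons.prems by simp
  qed
qed simp

lemma load_upd: "(\<And>j. r \<noteq> Arg j) \<Longrightarrow> load i vs (S(r := x)) = (load i vs S)(r := x)"
proof (induction vs arbitrary: i S)
  case (Cons v vs)
  have "load i (v # vs) (S(r := x)) = load (Suc i) vs ((S(Arg i := rev v))(r := x))"
    using fun_upd_twist[OF Cons.prems, of S x i "rev v"] by simp
  also have "\<dots> = (load i (v # vs) S)(r := x)"
    unfolding load.simps using Cons.prems by (rule Cons.IH)
  finally show ?case .
qed simp

lemma runs_parse_args:
  assumes "S Inp = code_list code_name vs @ x" "\<And>j. i \<le> j \<Longrightarrow> S (Arg j) = []"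
  shows "runs (parse_args i (length vs)) S (20 * length (code_list code_name vs)) (load i vs (S(Inp := x)))"
  using assms
proof (induction vs arbitrary: i S)
  case Nil
  have "runs (Cond Inp is_False (Pop Inp) (abort Inp)) S (Suc 0 + 1) (S(Inp := x))"
    using runs_Pop[of S Inp False x] Nil by (intro exec_Cond) simp
  then show ?case unfolding list.size parse_args.simps load.simps
    by (rule exec_weaken) auto
next
  case (Cons v vs)
  let ?y = "code_list code_name vs @ x"
  let ?S1 = "S(Inp := code_name v @ ?y)" and ?S2 = "S(Inp := ?y, Arg i := rev v)"
  have 1: "runs (Pop Inp) S (Suc 0) ?S1"
    using runs_Pop[of S Inp True] Cons.prems(1) by simp
  have 2: "runs (parse_name Inp (Arg i)) ?S1 (12 * length v + 5) ?S2"
    using runs_parse_name[of ?S1 Inp v ?y "Arg i"] Cons.prems(2)[of i] by simp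
  have "runs (parse_args (Suc i) (length vs)) ?S2 (20 * length (code_list code_name vs)) (load (Suc i) vs (?S2(Inp := x)))"
    using Cons.prems(2) by (intro Cons.IH) auto
  moreover have "load (Suc i) vs (?S2(Inp := x)) = load i (v # vs) (S(Inp := x))"
    by (simp add: fun_upd_twist)
  ultimately have 3: "runs (parse_args (Suc i) (length vs)) ?S2 (20 * length (code_list code_name vs))
    (load i (v # vs) (S(Inp := x)))" by simp
  have "runs (parse_args i (length (v # vs))) S
      (Suc 0 + (12 * length v + 5 + 20 * length (code_list code_name vs) + 1) + 1 + 1)
      (load i (v # vs) (S(Inp := x)))"
    unfolding list.size add_0_right add_Suc_right parse_args.simps
    using exec_Seq[OF 1 exec_Seq[OF 2 3]] Cons.prems(1) by (intro exec_Cond) simp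
  then show ?case by (rule exec_mono) simp
qed

lemma fails_parse_args:
  assumes "\<nexists>vs x. length vs = m \<and> S Inp = code_list code_name vs @ x"
    "\<And>j. i \<le> j \<Longrightarrow> S (Arg j) = []"
  shows "fails Inp (parse_args i m) S (20 * length (S Inp) + 20)"
  using assms
proof (induction m arbitrary: i S)
  case 0
  have "\<not> is_False (top_symbol (S Inp))"
  proof
    assume "is_False (top_symbol (S Inp))"
    then obtain x where "S Inp = False # x" by (cases "S Inp") auto
    then have "\<exists>vs x. length vs = 0 \<and> S Inp = code_list code_name vs @ x"
      by (intro exI[of _ "[]"] exI[of _ x]) simp
    with 0(1) show False by (rule notE)
  qed
  then have "fails Inp (parse_args i 0) S (3 * length (S Inp) + 2 + 1)"
    unfolding parse_args.simps using fails_abort[of Inp S] by (intro fails_Cond) simp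
  then show ?case by (rule fails_mono) simp
next
  case (Suc m)
  show ?case
  proof (cases "is_True (top_symbol (S Inp))")
    case False
    then have "fails Inp (parse_args i (Suc m)) S (3 * length (S Inp) + 2 + 1)"
      unfolding parse_args.simps using fails_abort[of Inp S] by (intro fails_Cond) simp
    then show ?thesis by (rule fails_mono) simp
  next
    case True
    then obtain y where y: "S Inp = True # y" by (cases "S Inp") auto
    let ?S1 = "S(Inp := y)"
    have 1: "runs (Pop Inp) S (Suc 0) ?S1" using y by (rule runs_Pop)
    have "fails Inp (parse_name Inp (Arg i) ;; parse_args (Suc i) m) ?S1 (20 * length y + 30)"
    proof (cases "\<exists>n z. y = code_name n @ z")
      case False
      then have "fails Inp (parse_name Inp (Arg i)) ?S1 (12 * length (?S1 Inp) + 3 * length (?S1 Inp) + 10)"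
        by (intro fails_parse_name) auto
      from fails_Seq_left[OF this] show ?thesis by (rule fails_mono) simp
    next
      case True
      then obtain n z where z: "y = code_name n @ z" by blast
      let ?S2 = "S(Inp := z, Arg i := rev n)"
      have 2: "runs (parse_name Inp (Arg i)) ?S1 (12 * length n + 5) ?S2"
        using runs_parse_name[of ?S1 Inp n z "Arg i"] Suc.prems(2)[of i] z by simp
      have "fails Inp (parse_args (Suc i) m) ?S2 (20 * length (?S2 Inp) + 20)"
      proof (rule Suc.IH)
        show "\<nexists>vs x. length vs = m \<and> ?S2 Inp = code_list code_name vs @ x"
        proof
          assume "\<exists>vs x. length vs = m \<and> ?S2 Inp = code_list code_name vs @ x"
          then obtain vs x where "length vs = m" "z = code_list code_name vs @ x" by auto
          then have "\<exists>vs x. length vs = Suc m \<and> S Inp = code_list code_name vs @ x"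
            using y z by (intro exI[of _ "n # vs"] exI[of _ x]) simp
          with Suc.prems(1) show False by (rule notE)
        qed
      qed (use Suc.prems in auto)
      from fails_Seq_right[OF 2 this] show ?thesis by (rule fails_mono) (use z in auto)
    qed
    from fails_Seq_right[OF 1 this]
    have "fails Inp (parse_args i (Suc m)) S (Suc 0 + (20 * length y + 30) + 1 + 1)"
      unfolding parse_args.simps using True by (intro fails_Cond) simp
    then show ?thesis by (rule fails_mono) (simp add: y)
  qed
qed


section \<open>Reading a formula atom by atom\<close>

fun args :: "'v atom \<Rightarrow> 'v list" where
  "args (Rel R vs) = vs"
| "args (Eq u v) = [u, v]"

fun symbol :: "'v atom \<Rightarrow> name option" where
  "symbol (Rel R vs) = Some R"
| "symbol (Eq u v) = None"

text \<open>Without the end marker the code is additive in the formula, so its length measures the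
  input consumed so far.\<close>

definition code_atoms :: "name wedge_formula \<Rightarrow> bool list" where
  "code_atoms \<phi> = concat (map (\<lambda>a. True # code_atom a) \<phi>)"

lemma code_atoms_simps [simp]:
  "code_atoms [] = []" "code_atoms (a # \<phi>) = True # code_atom a @ code_atoms \<phi>"
  "code_atoms (\<phi> @ \<psi>) = code_atoms \<phi> @ code_atoms \<psi>"
  by (simp_all add: code_atoms_def)

lemma code_formula_atoms: "code_formula \<phi> = code_atoms \<phi> @ [False]"
  by (simp add: code_formula_def code_list_def code_atoms_def)

text \<open>
  The program \<open>Act\<close> is run after each atom has been read. The store after the atoms \<open>\<psi>\<close> is \<open>st \<psi>\<close>, up
  to the unread input.
\<close>

locale formula_reader =
  fixes \<D> :: "'d rel_structure" and Act :: "name option \<Rightarrow> reg com"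
    and st :: "name wedge_formula \<Rightarrow> reg store" and \<tau> N d :: nat
  assumes short: "R \<in> sig \<D> \<Longrightarrow> length R < d"
    and st_Sym: "st \<psi> Sym = []" and st_Arg: "st \<psi> (Arg j) = []"
    and act: "atom_over \<D> a \<Longrightarrow> length (code_atoms (\<psi> @ [a])) \<le> N \<Longrightarrow>
      runs (Act (symbol a)) (load 0 (args a) ((st \<psi>)(Inp := x))) \<tau> ((st (\<psi> @ [a]))(Inp := x))"
begin

definition rel_prog :: "bool list \<Rightarrow> reg com" where
  "rel_prog n = (if rev n \<in> sig \<D> then parse_args 0 (arity \<D> (rev n)) ;; Act (Some (rev n)) else abort Inp)"

definition atom_prog :: "reg com" where
  "atom_prog = Cond Inp is_True
     (Pop Inp ;; parse_name Inp Sym ;; read Sym d rel_prog [])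
     (Cond Inp is_False
       (Pop Inp ;; parse_name Inp (Arg 0) ;; parse_name Inp (Arg 1) ;; Act None)
       (abort Inp))"

lemma runs_atom_prog:
  assumes "atom_over \<D> a" "length (code_atoms (\<psi> @ [a])) \<le> N"
  shows "runs atom_prog ((st \<psi>)(Inp := code_atom a @ x))
    (20 * length (code_atom a) + 4 * d + \<tau> + 20) ((st (\<psi> @ [a]))(Inp := x))"
proof (cases a)
  case (Rel R vs)
  let ?y = "code_list code_name vs @ x"
  let ?S0 = "(st \<psi>)(Inp := code_atom a @ x)"
  let ?S1 = "(st \<psi>)(Inp := code_name R @ ?y)"
  let ?S2 = "(st \<psi>)(Inp := ?y, Sym := rev R)"
  let ?S3 = "(st \<psi>)(Inp := ?y)"
  let ?S4 = "load 0 vs ((st \<psi>)(Inp := x))"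
  have R: "R \<in> sig \<D>" "arity \<D> R = length vs" using assms(1) Rel by auto
  have 1: "runs (Pop Inp) ?S0 (Suc 0) ?S1"
    using runs_Pop[of ?S0 Inp True "code_name R @ ?y"] Rel by simp
  have 2: "runs (parse_name Inp Sym) ?S1 (12 * length R + 5) ?S2"
    using runs_parse_name[of ?S1 Inp R ?y Sym] st_Sym[of \<psi>] by simp
  have 3: "runs (parse_args 0 (arity \<D> R)) ?S3 (20 * length (code_list code_name vs)) ?S4"
    using runs_parse_args[of ?S3 vs x 0] R st_Arg by simp
  have 4: "runs (Act (Some R)) ?S4 \<tau> ((st (\<psi> @ [a]))(Inp := x))"
    using act[OF assms] Rel by simp
  \<comment> \<open>Symbols of the signature are shorter than \<open>d\<close>: the symbol is read
    completely and its stack is empty again.\<close>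
  have "?S2(Sym := drop d (?S2 Sym)) = ?S3"
    using short[OF R(1)] by (auto simp: st_Sym)
  then have "runs (rel_prog ([] @ take d (?S2 Sym))) (?S2(Sym := drop d (?S2 Sym)))
      (20 * length (code_list code_name vs) + \<tau> + 1) ((st (\<psi> @ [a]))(Inp := x))"
    using exec_Seq[OF 3 4] R short[OF R(1)] by (simp add: rel_prog_def)
  from exec_Seq[OF 1 exec_Seq[OF 2 exec_read[where P = rel_prog and r = Sym and acc = "[]" and S = ?S2, OF this]]]
  show ?thesis unfolding atom_prog_def
    by (intro exec_mono[OF exec_Cond]) (use Rel in auto)
next
  case (Eq u v)
  let ?S0 = "(st \<psi>)(Inp := code_atom a @ x)"
  let ?S1 = "(st \<psi>)(Inp := code_name u @ code_name v @ x)"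
  let ?S2 = "(st \<psi>)(Inp := code_name v @ x, Arg 0 := rev u)"
  let ?S3 = "load 0 [u, v] ((st \<psi>)(Inp := x))"
  have 1: "runs (Pop Inp) ?S0 (Suc 0) ?S1"
    using runs_Pop[of ?S0 Inp False "code_name u @ code_name v @ x"] Eq by simp
  have 2: "runs (parse_name Inp (Arg 0)) ?S1 (12 * length u + 5) ?S2"
    using runs_parse_name[of ?S1 Inp u "code_name v @ x" "Arg 0"] st_Arg by simp
  have 3: "runs (parse_name Inp (Arg 1)) ?S2 (12 * length v + 5) ?S3"
    by (rule exec_weaken[OF runs_parse_name[of ?S2 Inp v x "Arg 1"]]) (auto simp: st_Arg)
  have 4: "runs (Act None) ?S3 \<tau> ((st (\<psi> @ [a]))(Inp := x))"
    using act[OF assms] Eq by simp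
  have 5: "exec (Cond Inp is_False
       (Pop Inp ;; parse_name Inp (Arg 0) ;; parse_name Inp (Arg 1) ;; Act None) (abort Inp)) ?S0
     (Suc 0 + (12 * length u + 5 + (12 * length v + 5 + \<tau> + 1) + 1) + 1 + 1) Skip ((st (\<psi> @ [a]))(Inp := x))"
    using exec_Seq[OF 1 exec_Seq[OF 2 exec_Seq[OF 3 4]]] Eq by (intro exec_Cond) simp
  have "runs atom_prog ?S0 (Suc 0 + (12 * length u + 5 + (12 * length v + 5 + \<tau> + 1) + 1) + 1 + 1 + 1)
      ((st (\<psi> @ [a]))(Inp := x))"
    unfolding atom_prog_def using 5 Eq by (intro exec_Cond) simp
  then show ?thesis by (rule exec_mono) (simp add: Eq)
qed

lemma fails_atom_prog:
  assumes "\<nexists>a z. atom_over \<D> a \<and> x = code_atom a @ z"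
  shows "fails Inp atom_prog ((st \<psi>)(Inp := x)) (40 * length x + 4 * d + 60)"
proof -
  let ?S0 = "(st \<psi>)(Inp := x)"
  consider "x = []" | y where "x = True # y" | y where "x = False # y"
    by (metis (full_types) neq_Nil_conv)
  then show ?thesis
  proof cases
    case 1
    have "fails Inp (abort Inp) ?S0 2"
      by (rule fails_mono[OF fails_abort]) (simp add: 1)
    then have "fails Inp (Cond Inp is_False q (abort Inp)) ?S0 3" for q
      using fails_Cond[of Inp is_False ?S0 Inp q "abort Inp" 2] 1 by simp
    then have "fails Inp atom_prog ?S0 4" unfolding atom_prog_def
      using fails_Cond[of Inp is_True ?S0 Inp _ _ 3] 1 by simp
    then show ?thesis by (rule fails_mono) simp
  next
    case (2 y)
    let ?S1 = "(st \<psi>)(Inp := y)"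
    have 1: "runs (Pop Inp) ?S0 (Suc 0) ?S1"
      using runs_Pop[of ?S0 Inp True y] 2 by simp
    have "fails Inp (parse_name Inp Sym ;; read Sym d rel_prog []) ?S1 (40 * length y + 4 * d + 50)"
    proof (cases "\<exists>R z. y = code_name R @ z")
      case False
      then have "fails Inp (parse_name Inp Sym) ?S1 (12 * length (?S1 Inp) + 3 * length (?S1 Inp) + 10)"
        by (intro fails_parse_name) auto
      from fails_Seq_left[OF this] show ?thesis by (rule fails_mono) simp
    next
      case True
      then obtain R z where z: "y = code_name R @ z" by blast
      let ?S2 = "(st \<psi>)(Inp := z, Sym := rev R)"
      let ?S3 = "?S2(Sym := drop d (?S2 Sym))"
      have run2: "runs (parse_name Inp Sym) ?S1 (12 * length R + 5) ?S2"
        using runs_parse_name[of ?S1 Inp R z Sym] st_Sym[of \<psi>] z by simp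
      have "fails Inp (rel_prog ([] @ take d (?S2 Sym))) ?S3 (20 * length z + 30)"
      proof (cases "R \<in> sig \<D>")
        case True
        then have "fails Inp (parse_args 0 (arity \<D> R)) ?S3 (20 * length (?S3 Inp) + 20)"
        proof (intro fails_parse_args)
          show "\<nexists>vs w. length vs = arity \<D> R \<and> ?S3 Inp = code_list code_name vs @ w"
          proof
            assume "\<exists>vs w. length vs = arity \<D> R \<and> ?S3 Inp = code_list code_name vs @ w"
            then obtain vs w where "length vs = arity \<D> R" "z = code_list code_name vs @ w" by auto
            then have "atom_over \<D> (Rel R vs) \<and> x = code_atom (Rel R vs) @ w"
              using True 2 z by simp
            with assms show False by blast
          qed
        qed (auto simp: st_Arg)
        then have "fails Inp (parse_args 0 (arity \<D> R) ;; Act (Some R)) ?S3 (20 * length (?S3 Inp) + 20 + 1)"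
          by (rule fails_Seq_left)
        with True short[OF True] show ?thesis
          by (auto simp: rel_prog_def elim!: fails_mono)
      next
        case False
        \<comment> \<open>At most \<open>d\<close> bits have been inspected. If they spelled a
          symbol of the signature, it would be shorter than \<open>d\<close>, so nothing was cut off
          and it would be \<open>R\<close> itself.\<close>
        have "rev (take d (rev R)) \<notin> sig \<D>"
        proof
          assume *: "rev (take d (rev R)) \<in> sig \<D>"
          from short[OF this] have "take d (rev R) = rev R" by simp
          with * False show False by simp
        qed
        then show ?thesis using fails_abort[of Inp ?S3]
          by (auto simp: rel_prog_def elim!: fails_mono)
      qed
      then have "fails Inp (read Sym d rel_prog []) ?S2 (20 * length z + 30 + 4 * d)"
        unfolding fails_def by (meson exec_read)
      from fails_Seq_right[OF run2 this] show ?thesis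
        by (rule fails_mono) (use z in auto)
    qed
    from fails_Seq_right[OF 1 this]
    have "fails Inp atom_prog ?S0 (Suc 0 + (40 * length y + 4 * d + 50) + 1 + 1)"
      unfolding atom_prog_def using 2 by (intro fails_Cond) simp
    then show ?thesis by (rule fails_mono) (simp add: 2)
  next
    case (3 y)
    let ?S1 = "(st \<psi>)(Inp := y)"
    have 1: "runs (Pop Inp) ?S0 (Suc 0) ?S1"
      using runs_Pop[of ?S0 Inp False y] 3 by simp
    have "fails Inp (parse_name Inp (Arg 0) ;; parse_name Inp (Arg 1) ;; Act None) ?S1 (40 * length y + 50)"
    proof (cases "\<exists>u z. y = code_name u @ z")
      case False
      then have "fails Inp (parse_name Inp (Arg 0)) ?S1 (12 * length (?S1 Inp) + 3 * length (?S1 Inp) + 10)"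
        by (intro fails_parse_name) auto
      from fails_Seq_left[OF this] show ?thesis by (rule fails_mono) simp
    next
      case True
      then obtain u z where z: "y = code_name u @ z" by blast
      let ?S2 = "(st \<psi>)(Inp := z, Arg 0 := rev u)"
      have run2: "runs (parse_name Inp (Arg 0)) ?S1 (12 * length u + 5) ?S2"
        using runs_parse_name[of ?S1 Inp u z "Arg 0"] st_Arg z by simp
      have "\<nexists>v w. ?S2 Inp = code_name v @ w"
      proof
        assume "\<exists>v w. ?S2 Inp = code_name v @ w"
        then obtain v w where "z = code_name v @ w" by auto
        then have "atom_over \<D> (Eq u v) \<and> x = code_atom (Eq u v) @ w"
          using 3 z by simp
        with assms show False by blast
      qed
      then have "fails Inp (parse_name Inp (Arg 1)) ?S2 (12 * length (?S2 Inp) + 3 * length (?S2 Inp) + 10)"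
        by (intro fails_parse_name) auto
      from fails_Seq_right[OF run2 fails_Seq_left[OF this]] show ?thesis
        by (rule fails_mono) (use z in auto)
    qed
    from fails_Seq_right[OF 1 this]
    have "fails Inp (Cond Inp is_False (Pop Inp ;; parse_name Inp (Arg 0) ;; parse_name Inp (Arg 1) ;; Act None) (abort Inp))
        ?S0 (Suc 0 + (40 * length y + 50) + 1 + 1)"
      using 3 by (intro fails_Cond) simp
    then have "fails Inp atom_prog ?S0 (Suc 0 + (40 * length y + 50) + 1 + 1 + 1)"
      unfolding atom_prog_def using 3 by (intro fails_Cond) simp
    then show ?thesis by (rule fails_mono) (simp add: 3)
  qed
qed

text \<open>Bits behind the end marker are an error as well: the code must exhaust the
  input.\<close>

definition formula_prog :: "reg com" where
  "formula_prog = While Inp is_True (Pop Inp ;; atom_prog) ;;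
     Cond Inp is_False (Pop Inp ;; Cond Inp is_empty Skip (abort Inp)) (abort Inp)"

text \<open>One bound that covers a successful round, a failing round and the check at the end, so
  that the total is this bound times a number of rounds of at most
  \<open>length x + 1\<close>.\<close>

definition iteration_time :: nat where
  "iteration_time = 40 * N + 4 * d + \<tau> + 80"

lemma formula_prog_step:
  assumes "atom_over \<D> a" "length (code_atoms (\<psi> @ [a])) \<le> N"
  shows "exec formula_prog ((st \<psi>)(Inp := True # code_atom a @ x)) iteration_time
    formula_prog ((st (\<psi> @ [a]))(Inp := x))"
proof -
  let ?S0 = "(st \<psi>)(Inp := True # code_atom a @ x)"
  have 1: "runs (Pop Inp) ?S0 (Suc 0) ((st \<psi>)(Inp := code_atom a @ x))"
    using runs_Pop[of ?S0 Inp True "code_atom a @ x"] by simp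
  show ?thesis unfolding formula_prog_def
    by (rule exec_mono, rule exec_While_Seq[where p = is_True and r = Inp,
          OF _ exec_Seq[OF 1 runs_atom_prog[OF assms]] exec_refl[of _ _ 0]])
       (use assms(2) in \<open>auto simp: iteration_time_def\<close>)
qed

text \<open>The premise is an invariant: what has been read and what is left together have at most
  \<open>N\<close> bits. Both parts follow by consuming one atom per round, and prefixing an atom to
  a well-formed rest gives a well-formed input, so a defect is inherited by the rest.\<close>

theorem formula_prog:
  assumes "length (code_atoms \<psi>) + length x \<le> N"
  shows "formula_over \<D> \<phi> \<and> x = code_formula \<phi> \<Longrightarrow>
      runs formula_prog ((st \<psi>)(Inp := x)) (iteration_time * (length x + 1)) ((st (\<psi> @ \<phi>))(Inp := []))"
    and "\<nexists>\<phi>. formula_over \<D> \<phi> \<and> x = code_formula \<phi> \<Longrightarrow>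
      fails Inp formula_prog ((st \<psi>)(Inp := x)) (iteration_time * (length x + 1))"
proof -
  show "runs formula_prog ((st \<psi>)(Inp := x)) (iteration_time * (length x + 1)) ((st (\<psi> @ \<phi>))(Inp := []))"
    if "formula_over \<D> \<phi> \<and> x = code_formula \<phi>"
    using assms that
  proof (induction \<phi> arbitrary: \<psi> x)
    case Nil
    let ?S = "(st \<psi>)(Inp := x)"
    have x: "x = [False]" using Nil by (simp add: code_formula_atoms)
    have 1: "runs (While Inp is_True q) ?S (Suc 0) ?S" for q
      by (rule exec_While_end) (simp add: x)
    have 2: "runs (Pop Inp) ?S (Suc 0) ((st \<psi>)(Inp := []))"
      using runs_Pop[of ?S Inp False "[]"] x by simp
    have 3: "runs (Cond Inp is_empty Skip (abort Inp)) ((st \<psi>)(Inp := [])) (0 + 1) ((st \<psi>)(Inp := []))"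
      by (rule exec_Cond) (simp add: exec_refl)
    have "runs (Cond Inp is_False (Pop Inp ;; Cond Inp is_empty Skip (abort Inp)) (abort Inp)) ?S
       (Suc 0 + (0 + 1) + 1 + 1) ((st \<psi>)(Inp := []))"
      using exec_Seq[OF 2 3] x by (intro exec_Cond) simp
    from exec_Seq[OF 1 this]
    show ?case unfolding formula_prog_def append_Nil2
      by (rule exec_mono) (simp add: iteration_time_def)
  next
    case (Cons a \<phi>)
    have over: "atom_over \<D> a" "formula_over \<D> \<phi>" using Cons.prems(2) by (auto simp: formula_over_def)
    have x: "x = True # code_atom a @ code_formula \<phi>"
      using Cons.prems(2) by (simp add: code_formula_atoms)
    have "runs formula_prog ((st (\<psi> @ [a]))(Inp := code_formula \<phi>))
       (iteration_time * (length (code_formula \<phi>) + 1)) ((st ((\<psi> @ [a]) @ \<phi>))(Inp := []))"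
      using Cons.prems(1) over x by (intro Cons.IH) auto
    moreover have "exec formula_prog ((st \<psi>)(Inp := x)) iteration_time
        formula_prog ((st (\<psi> @ [a]))(Inp := code_formula \<phi>))"
      unfolding x using over Cons.prems(1) x by (intro formula_prog_step) auto
    ultimately have "runs formula_prog ((st \<psi>)(Inp := x))
       (iteration_time + iteration_time * (length (code_formula \<phi>) + 1)) ((st ((\<psi> @ [a]) @ \<phi>))(Inp := []))"
      by (rule exec_trans[rotated])
    then show ?case by (rule exec_weaken) (auto simp: x)
  qed
  show "fails Inp formula_prog ((st \<psi>)(Inp := x)) (iteration_time * (length x + 1))"
    if "\<nexists>\<phi>. formula_over \<D> \<phi> \<and> x = code_formula \<phi>"
    using assms that
  proof (induction "length x" arbitrary: \<psi> x rule: less_induct)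
    case less
    let ?S = "(st \<psi>)(Inp := x)"
    show ?case
    proof (cases "is_True (top_symbol x)")
      case False
      have 1: "runs (While Inp is_True q) ?S (Suc 0) ?S" for q
        by (rule exec_While_end) (use False in simp)
      have 2: "fails Inp (Cond Inp is_False (Pop Inp ;; Cond Inp is_empty Skip (abort Inp)) (abort Inp)) ?S (3 * length x + 10)"
      proof (cases "\<exists>y. x = False # y")
        case True
        then obtain y where y: "x = False # y" by blast
        have "y \<noteq> []"
        proof
          assume "y = []"
          then have "formula_over \<D> [] \<and> x = code_formula []"
            using y by (simp add: formula_over_def code_formula_atoms)
          with less.prems(2) show False by blast
        qed
        then have "fails Inp (Cond Inp is_empty Skip (abort Inp)) ((st \<psi>)(Inp := y)) (3 * length y + 2 + 1)"
          using fails_abort[of Inp "(st \<psi>)(Inp := y)"] by (intro fails_Cond) simp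
        moreover have "runs (Pop Inp) ?S (Suc 0) ((st \<psi>)(Inp := y))"
          using runs_Pop[of ?S Inp False y] y by simp
        ultimately have "fails Inp (Pop Inp ;; Cond Inp is_empty Skip (abort Inp)) ?S (Suc 0 + (3 * length y + 2 + 1) + 1)"
          by (rule fails_Seq_right[rotated])
        then have "fails Inp (Cond Inp is_False (Pop Inp ;; Cond Inp is_empty Skip (abort Inp)) (abort Inp)) ?S
            (Suc 0 + (3 * length y + 2 + 1) + 1 + 1)"
          using y by (intro fails_Cond) simp
        then show ?thesis by (rule fails_mono) (simp add: y)
      next
        case nF: False
        have "\<not> is_False (top_symbol x)"
          using nF by (cases x) auto
        then have "fails Inp (Cond Inp is_False (Pop Inp ;; Cond Inp is_empty Skip (abort Inp)) (abort Inp)) ?S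
            (3 * length x + 2 + 1)"
          using fails_abort[of Inp ?S] by (intro fails_Cond) simp
        then show ?thesis by (rule fails_mono) simp
      qed
      from fails_Seq_right[OF 1 2] show ?thesis unfolding formula_prog_def
        by (rule fails_mono) (use less.prems(1) in \<open>simp add: iteration_time_def\<close>)
    next
      case True
      then obtain y where y: "x = True # y" by (cases x) auto
      show ?thesis
      proof (cases "\<exists>a z. atom_over \<D> a \<and> y = code_atom a @ z")
        case False
        have "runs (Pop Inp) ?S (Suc 0) ((st \<psi>)(Inp := y))"
          using runs_Pop[of ?S Inp True y] y by simp
        from fails_Seq_right[OF this fails_atom_prog[OF False]]
        have *: "fails Inp (Pop Inp ;; atom_prog) ?S (Suc 0 + (40 * length y + 4 * d + 60) + 1)" .
        have "fails Inp formula_prog ?S (Suc 0 + (40 * length y + 4 * d + 60) + 1 + 2 + 1)"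
          unfolding formula_prog_def
          by (rule fails_Seq_left, rule fails_While[OF _ *]) (simp add: y)
        then show ?thesis
          by (rule fails_mono) (use less.prems(1) in \<open>simp add: y iteration_time_def\<close>)
      next
        case True
        then obtain a z where a: "atom_over \<D> a" "y = code_atom a @ z" by blast
        have "fails Inp formula_prog ((st (\<psi> @ [a]))(Inp := z)) (iteration_time * (length z + 1))"
        proof (rule less.hyps)
          show "\<nexists>\<phi>. formula_over \<D> \<phi> \<and> z = code_formula \<phi>"
          proof
            assume "\<exists>\<phi>. formula_over \<D> \<phi> \<and> z = code_formula \<phi>"
            then obtain \<phi> where "formula_over \<D> \<phi>" "z = code_formula \<phi>" by blast
            then have "formula_over \<D> (a # \<phi>) \<and> x = code_formula (a # \<phi>)"
              using a y by (simp add: formula_over_def code_formula_atoms)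
            with less.prems(2) show False by blast
          qed
        qed (use less.prems(1) y a in auto)
        moreover have "exec formula_prog ?S iteration_time formula_prog ((st (\<psi> @ [a]))(Inp := z))"
          using formula_prog_step[OF a(1), of \<psi> z] less.prems(1) y a by simp
        ultimately have "fails Inp formula_prog ?S (iteration_time + iteration_time * (length z + 1))"
          by (rule fails_exec[rotated])
        then show ?thesis
          by (rule fails_mono) (simp add: y a)
      qed
    qed
  qed
qed

end

section \<open>Writing the output\<close>

text \<open>Templates for the output: literal bits, and slots for the name held in a
  register.\<close>

datatype item = Bits "bool list" | Name reg

definition value_regs :: "reg set" where
  "value_regs = range Arg \<union> range Loop"

lemma value_regs_simps [simp]:
  "Arg i \<in> value_regs" "Loop i \<in> value_regs" "Inp \<notin> value_regs" "Sav \<notin> value_regs" "Tmp \<notin> value_regs"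
  "Sym \<notin> value_regs" "Occ \<notin> value_regs" "Out_vars \<notin> value_regs" "Out_form \<notin> value_regs"
  "Iter i \<notin> value_regs"
  by (auto simp: value_regs_def)

text \<open>
  A name is written in the doubled form in which \<^const>\<open>code_name\<close> codes a name that itself contains
  the code of the (reversed) name.
\<close>

fun item_string :: "(reg \<Rightarrow> name) \<Rightarrow> item \<Rightarrow> bool list" where
  "item_string \<rho> (Bits bs) = bs"
| "item_string \<rho> (Name r) = concat (map (\<lambda>b. [True, True, True, b]) (rev (\<rho> r))) @ [True, False]"

fun item_ok :: "item \<Rightarrow> bool" where
  "item_ok (Bits bs) \<longleftrightarrow> True"
| "item_ok (Name r) \<longleftrightarrow> r \<in> value_regs"

text \<open>The cost includes the silent step that leads to the next item; the item alone takes
  \<open>item_cost N i - 1\<close>.\<close>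

fun item_cost :: "nat \<Rightarrow> item \<Rightarrow> nat" where
  "item_cost N (Bits bs) = 4 * length bs + 1"
| "item_cost N (Name r) = 60 * N + 20"

definition items_string :: "item list \<Rightarrow> (reg \<Rightarrow> name) \<Rightarrow> bool list" where
  "items_string is \<rho> = concat (map (item_string \<rho>) is)"

definition items_cost :: "nat \<Rightarrow> item list \<Rightarrow> nat" where
  "items_cost N is = sum_list (map (item_cost N) is)"

text \<open>The first transfer emits the register in stack order, that is, the reversed name; the
  second one restores the register for later slots.\<close>

fun emit_item :: "reg \<Rightarrow> item \<Rightarrow> reg com" where
  "emit_item out (Bits bs) = pushes out bs"
| "emit_item out (Name r) =
     transfer r Tmp (\<lambda>b. [b]) out (\<lambda>b. [True, True, True, b]) ;;
     transfer Tmp r (\<lambda>b. [b]) out (\<lambda>b. []) ;;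
     pushes out [True, False]"

fun emit_items :: "reg \<Rightarrow> item list \<Rightarrow> reg com" where
  "emit_items out [] = Skip"
| "emit_items out (i # is) = emit_item out i ;; emit_items out is"

lemma items_string_simps [simp]:
  "items_string [] \<rho> = []" "items_string (i # is) \<rho> = item_string \<rho> i @ items_string is \<rho>"
  "items_string (is @ js) \<rho> = items_string is \<rho> @ items_string js \<rho>"
  by (simp_all add: items_string_def)

lemma items_cost_simps [simp]:
  "items_cost N [] = 0" "items_cost N (i # is) = item_cost N i + items_cost N is"
  by (simp_all add: items_cost_def)

lemma items_string_cong:
  "\<forall>i\<in>set is. item_ok i \<Longrightarrow> (\<And>r. r \<in> value_regs \<Longrightarrow> \<rho> r = \<rho>' r) \<Longrightarrow>
    items_string is \<rho> = items_string is \<rho>'"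
proof (induction "is")
  case (Cons i "is")
  then show ?case by (cases i) auto
qed simp

lemma length_concat_map_4:
  "length (concat (map (\<lambda>b. [x, y, z, b]) bs)) = 4 * length bs"
  by (induction bs) auto

lemma length_items_string:
  "\<forall>i\<in>set is. item_ok i \<Longrightarrow> (\<And>r. r \<in> value_regs \<Longrightarrow> length (\<rho> r) \<le> N) \<Longrightarrow>
    length (items_string is \<rho>) \<le> items_cost N is"
proof (induction "is")
  case (Cons i "is")
  have "length (item_string \<rho> i) \<le> item_cost N i"
  proof (cases i)
    case (Name r)
    then have "length (\<rho> r) \<le> N" using Cons.prems by auto
    with Name show ?thesis by (simp add: length_concat_map_4 flip: rev_map)
  qed simp
  with Cons show ?case by fastforce
qed simp

lemma runs_emit_item:
  assumes "item_ok i" "out = Out_vars \<or> out = Out_form" "S Tmp = []"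
    "\<And>r. r \<in> value_regs \<Longrightarrow> length (S r) \<le> N"
  shows "runs (emit_item out i) S (item_cost N i - 1) (S(out := rev (item_string (rev \<circ> S) i) @ S out))"
proof (cases i)
  case (Bits bs)
  then show ?thesis using runs_pushes[of out bs S] by simp
next
  case (Name r)
  let ?s = "concat (map (\<lambda>b. [True, True, True, b]) (S r))"
  let ?S1 = "S(r := [], Tmp := rev (S r), out := rev ?s @ S out)"
  let ?S2 = "S(out := rev ?s @ S out)"
  have r: "r \<noteq> Tmp" "r \<noteq> out" "out \<noteq> Tmp" "length (S r) \<le> N"
    using assms Name by auto
  have 1: "runs (transfer r Tmp (\<lambda>b. [b]) out (\<lambda>b. [True, True, True, b])) S (30 * length (S r) + 1) ?S1"
    by (rule exec_weaken[OF runs_transfer]) (use r assms(3) in auto)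
  have 2: "runs (transfer Tmp r (\<lambda>b. [b]) out (\<lambda>b. [])) ?S1 (30 * length (S r) + 1) ?S2"
    by (rule exec_weaken[OF runs_transfer]) (use r assms(3) in auto)
  have 3: "runs (pushes out [True, False]) ?S2 8 (S(out := rev (?s @ [True, False]) @ S out))"
    by (rule exec_weaken[OF runs_pushes]) auto
  show ?thesis unfolding Name emit_item.simps
    by (rule exec_weaken[OF exec_Seq[OF 1 exec_Seq[OF 2 3]]]) (use r in auto)
qed

lemma runs_emit_items:
  assumes "\<forall>i\<in>set is. item_ok i" "out = Out_vars \<or> out = Out_form" "S Tmp = []"
    "\<And>r. r \<in> value_regs \<Longrightarrow> length (S r) \<le> N"
  shows "runs (emit_items out is) S (items_cost N is) (S(out := rev (items_string is (rev \<circ> S)) @ S out))"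
  using assms
proof (induction "is" arbitrary: S)
  case Nil
  show ?case unfolding emit_items.simps by (rule exec_weaken[OF exec_refl]) auto
next
  case (Cons i "is")
  let ?S1 = "S(out := rev (item_string (rev \<circ> S) i) @ S out)"
  have 1: "runs (emit_item out i) S (item_cost N i - 1) ?S1"
    using Cons.prems by (intro runs_emit_item) auto
  have 2: "runs (emit_items out is) ?S1 (items_cost N is) (?S1(out := rev (items_string is (rev \<circ> ?S1)) @ ?S1 out))"
    using Cons.prems by (intro Cons.IH) auto
  have "items_string is (rev \<circ> ?S1) = items_string is (rev \<circ> S)"
    using Cons.prems by (intro items_string_cong) auto
  moreover have "0 < item_cost N i" by (cases i) auto
  ultimately show ?case unfolding emit_items.simps
    by (intro exec_weaken[OF exec_Seq[OF 1 2]]) (auto simp: comp_def)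
qed

definition emitted :: "bool list \<Rightarrow> bool list \<Rightarrow> reg store \<Rightarrow> reg store" where
  "emitted u p S = S(Out_vars := rev u @ S Out_vars, Out_form := rev p @ S Out_form)"

lemma emitted_simps [simp]:
  "emitted u p S Out_vars = rev u @ S Out_vars" "emitted u p S Out_form = rev p @ S Out_form"
  "r \<noteq> Out_vars \<Longrightarrow> r \<noteq> Out_form \<Longrightarrow> emitted u p S r = S r"
  by (auto simp: emitted_def)

lemma runs_body:
  assumes "\<forall>i\<in>set us. item_ok i" "\<forall>i\<in>set ps. item_ok i" "S Tmp = []"
    "\<And>r. r \<in> value_regs \<Longrightarrow> length (S r) \<le> N"
  shows "runs (emit_items Out_vars us ;; emit_items Out_form ps) S (items_cost N us + items_cost N ps + 1)
    (emitted (items_string us (rev \<circ> S)) (items_string ps (rev \<circ> S)) S)"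
proof -
  let ?S1 = "S(Out_vars := rev (items_string us (rev \<circ> S)) @ S Out_vars)"
  have 1: "runs (emit_items Out_vars us) S (items_cost N us) ?S1"
    using assms by (intro runs_emit_items) auto
  have 2: "runs (emit_items Out_form ps) ?S1 (items_cost N ps)
     (?S1(Out_form := rev (items_string ps (rev \<circ> ?S1)) @ ?S1 Out_form))"
    using assms by (intro runs_emit_items) auto
  have "items_string ps (rev \<circ> ?S1) = items_string ps (rev \<circ> S)"
    using assms by (intro items_string_cong) auto
  then show ?thesis
    by (intro exec_weaken[OF exec_Seq[OF 1 2]]) (auto simp: emitted_def)
qed

section \<open>Nested loops over the variable occurrences\<close>

text \<open>The meaning of the nested loops, polymorphic in what they list: it is used for the bits
  that are written as well as for the names and atoms that these bits code.\<close>

fun gen :: "name list \<Rightarrow> ((reg \<Rightarrow> name) \<Rightarrow> 'x list) \<Rightarrow> nat \<Rightarrow> (reg \<Rightarrow> name) \<Rightarrow> 'x list" where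
  "gen ws h 0 \<rho> = h \<rho>"
| "gen ws h (Suc k) \<rho> = concat (map (\<lambda>v. gen ws h k (\<rho>(Loop k := v))) ws)"

text \<open>Between two rounds the iteration stacks and the output stacks change. What a round
  writes must be unaffected by them.\<close>

definition depends_on_values :: "((reg \<Rightarrow> name) \<Rightarrow> 'x) \<Rightarrow> bool" where
  "depends_on_values h \<longleftrightarrow> (\<forall>\<rho> \<rho>'. (\<forall>r\<in>value_regs. \<rho> r = \<rho>' r) \<longrightarrow> h \<rho> = h \<rho>')"

lemma gen_cong:
  assumes "depends_on_values h" "\<And>r. r \<in> value_regs \<Longrightarrow> \<rho> r = \<rho>' r"
  shows "gen ws h k \<rho> = gen ws h k \<rho>'"
  using assms(2)
proof (induction k arbitrary: \<rho> \<rho>')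
  case 0
  then show ?case using assms(1) by (auto simp: depends_on_values_def)
next
  case (Suc k)
  have "gen ws h k (\<rho>(Loop k := v)) = gen ws h k (\<rho>'(Loop k := v))" for v
    using Suc.prems by (intro Suc.IH) auto
  then show ?case by simp
qed

text \<open>Every loop consumes its own copy of the occurrences, made on entry, so an inner loop
  starts afresh in each round of the outer one.\<close>

fun nest :: "reg com \<Rightarrow> nat \<Rightarrow> reg com" where
  "nest b 0 = b"
| "nest b (Suc k) = copy Tmp Occ (Iter k) ;;
     While (Iter k) nonempty (parse_name (Iter k) (Loop k) ;; nest b k ;; clear (Loop k))"

fun nest_time :: "nat \<Rightarrow> nat \<Rightarrow> nat \<Rightarrow> nat" where
  "nest_time \<tau> N 0 = \<tau>"
| "nest_time \<tau> N (Suc k) = 60 * N + 5 + N * (15 * N + 20 + nest_time \<tau> N k)"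

text \<open>The recursion for the running time dominates the length of the output too; this later
  bounds the cost of unloading the output stacks.\<close>

lemma length_gen:
  assumes "\<And>\<rho>. (\<And>r. r \<in> value_regs \<Longrightarrow> length (\<rho> r) \<le> N) \<Longrightarrow> length (h \<rho>) \<le> \<tau>"
    "length ws \<le> N" "\<And>v. v \<in> set ws \<Longrightarrow> length v \<le> N" "\<And>r. r \<in> value_regs \<Longrightarrow> length (\<rho> r) \<le> N"
  shows "length (gen ws h k \<rho>) \<le> nest_time \<tau> N k"
  using assms(4)
proof (induction k arbitrary: \<rho>)
  case 0
  then show ?case using assms(1) by simp
next
  case (Suc k)
  have "length (gen ws h (Suc k) \<rho>) = (\<Sum>v\<leftarrow>ws. length (gen ws h k (\<rho>(Loop k := v))))"
    by (simp add: length_concat o_def)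
  also have "\<dots> \<le> (\<Sum>v\<leftarrow>ws. nest_time \<tau> N k)"
    using Suc assms(3) by (intro sum_list_mono Suc.IH) auto
  also have "\<dots> = length ws * nest_time \<tau> N k" by (simp add: sum_list_triv)
  also have "\<dots> \<le> N * (15 * N + 20 + nest_time \<tau> N k)" using assms(2) by (intro mult_mono) auto
  finally show ?case by simp
qed

lemma runs_nest:
  assumes body: "\<And>S. S Tmp = [] \<Longrightarrow> (\<And>r. r \<in> value_regs \<Longrightarrow> length (S r) \<le> N) \<Longrightarrow>
      runs b S \<tau> (emitted (hu (rev \<circ> S)) (hp (rev \<circ> S)) S)"
    and dep: "depends_on_values hu" "depends_on_values hp"
    and "S Tmp = []" "S Occ = concat (map code_name ws)" "length (S Occ) \<le> N"
    "\<And>i. i < k \<Longrightarrow> S (Loop i) = [] \<and> S (Iter i) = []"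
    "\<And>r. r \<in> value_regs \<Longrightarrow> length (S r) \<le> N"
  shows "runs (nest b k) S (nest_time \<tau> N k)
    (emitted (gen ws hu k (rev \<circ> S)) (gen ws hp k (rev \<circ> S)) S)"
  using assms(4-)
proof (induction k arbitrary: S)
  case 0
  then show ?case using body[of S] by (simp add: comp_def)
next
  case (Suc k)
  let ?c = "15 * N + 20 + nest_time \<tau> N k"
  let ?q = "parse_name (Iter k) (Loop k) ;; nest b k ;; clear (Loop k)"
  let ?gu = "\<lambda>S v. gen ws hu k ((rev \<circ> S)(Loop k := v))"
  let ?gp = "\<lambda>S v. gen ws hp k ((rev \<circ> S)(Loop k := v))"
  \<comment> \<open>The inner induction is on the occurrences still on \<open>Iter k\<close>. The
    store is generalised because the output stacks have grown in the meantime.\<close>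
  have loop: "runs (While (Iter k) nonempty ?q) S' (length vs * ?c + 1)
      (emitted (concat (map (?gu S') vs)) (concat (map (?gp S') vs)) (S'(Iter k := [])))"
    if "S' (Iter k) = concat (map code_name vs)" "S' (Loop k) = []" "S' Tmp = []"
      "S' Occ = concat (map code_name ws)" "length (S' Occ) \<le> N"
      "\<And>i. i < k \<Longrightarrow> S' (Loop i) = [] \<and> S' (Iter i) = []"
      "\<And>r. r \<in> value_regs \<Longrightarrow> length (S' r) \<le> N" "length (S' (Iter k)) \<le> N" for S' vs
    using that
  proof (induction vs arbitrary: S')
    case Nil
    show ?case
      by (rule exec_weaken[OF exec_While_end]) (use Nil in \<open>auto simp: emitted_def\<close>)
  next
    case (Cons v vs)
    let ?S1 = "S'(Iter k := concat (map code_name vs), Loop k := rev v)"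
    let ?S2 = "emitted (?gu S' v) (?gp S' v) ?S1"
    let ?S3 = "emitted (?gu S' v) (?gp S' v) (S'(Iter k := concat (map code_name vs)))"
    have v: "2 * length v + 1 + length (concat (map code_name vs)) \<le> N"
      using Cons.prems(1,8) by simp
    have 1: "runs (parse_name (Iter k) (Loop k)) S' (12 * length v + 5) ?S1"
      by (rule exec_weaken[OF runs_parse_name[of S' "Iter k" v "concat (map code_name vs)"]])
         (use Cons.prems in auto)
    have bound1: "length (?S1 r) \<le> N" if "r \<in> value_regs" for r
      using v Cons.prems(7)[OF that] that by auto
    have "runs (nest b k) ?S1 (nest_time \<tau> N k)
        (emitted (gen ws hu k (rev \<circ> ?S1)) (gen ws hp k (rev \<circ> ?S1)) ?S1)"
      using Cons.prems bound1 by (intro Suc.IH) auto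
    moreover have "gen ws hu k (rev \<circ> ?S1) = ?gu S' v" "gen ws hp k (rev \<circ> ?S1) = ?gp S' v"
      by (intro gen_cong dep; auto)+
    ultimately have 2: "runs (nest b k) ?S1 (nest_time \<tau> N k) ?S2" by simp
    have 3: "runs (clear (Loop k)) ?S2 (3 * length v + 1) ?S3"
      by (rule exec_weaken[OF runs_clear]) (use Cons.prems(2) in \<open>auto simp: emitted_def\<close>)
    have "runs (While (Iter k) nonempty ?q) ?S3 (length vs * ?c + 1)
      (emitted (concat (map (?gu ?S3) vs)) (concat (map (?gp ?S3) vs)) (?S3(Iter k := [])))"
    proof (rule Cons.IH)
      fix r assume r: "r \<in> value_regs"
      then have "?S3 r = S' r" by (subst emitted_simps(3)) auto
      with Cons.prems(7)[OF r] show "length (?S3 r) \<le> N" by simp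
    qed (use Cons.prems v in auto)
    moreover have "?gu ?S3 w = ?gu S' w" "?gp ?S3 w = ?gp S' w" for w
      by (intro gen_cong dep; auto simp: emitted_def)+
    ultimately have 4: "runs (While (Iter k) nonempty ?q) ?S3 (length vs * ?c + 1)
      (emitted (concat (map (?gu S') vs)) (concat (map (?gp S') vs)) (?S3(Iter k := [])))"
      by simp
    have "runs (While (Iter k) nonempty ?q) S' (length (v # vs) * ?c + 1)
      (emitted (concat (map (?gu S') (v # vs))) (concat (map (?gp S') (v # vs))) (S'(Iter k := [])))"
      by (rule exec_weaken[OF exec_While[where p = nonempty and r = "Iter k",
            OF _ exec_Seq[OF 1 exec_Seq[OF 2 3]] 4]])
         (use Cons.prems(1) v in \<open>auto simp: emitted_def algebra_simps\<close>)
    then show ?case .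
  qed
  \<comment> \<open>Every code has at least one bit, so the bound on the stack also bounds the
    number of rounds.\<close>
  have Occ: "length ws \<le> N"
  proof -
    have "length ws \<le> length (concat (map code_name ws))" by (induction ws) auto
    with Suc.prems show ?thesis by simp
  qed
  have cp: "runs (copy Tmp Occ (Iter k)) S (60 * length (S Occ) + 3) (S(Iter k := S Occ))"
    using Suc.prems by (intro runs_copy) auto
  let ?S' = "S(Iter k := S Occ)"
  have "runs (While (Iter k) nonempty ?q) ?S' (length ws * ?c + 1)
      (emitted (concat (map (?gu ?S') ws)) (concat (map (?gp ?S') ws)) (?S'(Iter k := [])))"
    using Suc.prems by (intro loop) auto
  moreover have "?gu ?S' v = ?gu S v" "?gp ?S' v = ?gp S v" for v
    by (intro gen_cong dep; auto)+
  ultimately have lp: "runs (While (Iter k) nonempty ?q) ?S' (length ws * ?c + 1)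
      (emitted (gen ws hu (Suc k) (rev \<circ> S)) (gen ws hp (Suc k) (rev \<circ> S)) (?S'(Iter k := [])))"
    by simp
  have "length ws * ?c \<le> N * ?c" using Occ by (intro mult_mono) auto
  then have "60 * length (S Occ) + 3 + (length ws * ?c + 1) + 1 \<le> nest_time \<tau> N (Suc k)"
    unfolding nest_time.simps using Suc.prems(3) by linarith
  moreover have "runs (nest b (Suc k)) S (60 * length (S Occ) + 3 + (length ws * ?c + 1) + 1)
     (emitted (gen ws hu (Suc k) (rev \<circ> S)) (gen ws hp (Suc k) (rev \<circ> S)) S)"
    unfolding nest.simps
    by (intro exec_weaken[OF exec_Seq[OF cp lp]])
       (use Suc.prems(4)[of k] in \<open>auto simp: emitted_def\<close>)
  ultimately have "runs (nest b (Suc k)) S (nest_time \<tau> N (Suc k))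
     (emitted (gen ws hu (Suc k) (rev \<circ> S)) (gen ws hp (Suc k) (rev \<circ> S)) S)"
    by (rule exec_mono[rotated])
  then show ?case .
qed

section \<open>Emptying the argument registers\<close>

fun collect :: "nat \<Rightarrow> reg com" where
  "collect 0 = Skip"
| "collect (Suc m) = Push Occ False ;; transfer (Arg m) Occ (\<lambda>b. [b, True]) Tmp (\<lambda>b. []) ;; collect m"

lemma load_snoc: "load i (vs @ [v]) S = (load i vs S)(Arg (i + length vs) := rev v)"
  by (induction vs arbitrary: i S) auto

lemma rev_code_name: "rev (concat (map (\<lambda>b. [b, True]) (rev v))) @ False # x = code_name v @ x"
  by (induction v) auto

text \<open>A register yields the last bit of its name first. Pushing the end marker and then every
  bit below its own marker therefore puts \<open>code_name\<close> on \<open>Occ\<close> in reading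
  order. Arguments are taken from the last to the first for the same reason, hence the induction
  from the right.\<close>

lemma runs_collect:
  assumes "S Tmp = []" "\<And>j. S (Arg j) = []"
  shows "runs (collect (length vs)) (load 0 vs S) (40 * length (concat (map code_name vs)))
    (S(Occ := concat (map code_name vs) @ S Occ))"
  using assms
proof (induction vs arbitrary: S rule: rev_induct)
  case Nil
  show ?case unfolding list.size collect.simps load.simps
    by (rule exec_weaken[OF exec_refl[of _ _ 0]]) auto
next
  case (snoc v vs)
  let ?m = "length vs"
  let ?L = "load 0 (vs @ [v]) S"
  let ?S1 = "S(Occ := code_name v @ S Occ)"
  have L: "?L = (load 0 vs S)(Arg ?m := rev v)" by (simp add: load_snoc)
  have other: "load 0 vs S Occ = S Occ" "load 0 vs S Tmp = S Tmp" by (auto intro: load_other)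
  have outside: "load 0 vs S (Arg ?m) = []" using snoc.prems by (simp add: load_outside)
  have 1: "runs (Push Occ False) ?L 3 (?L(Occ := False # S Occ))"
    by (rule exec_weaken[OF runs_Push]) (auto simp: L other)
  have 2: "runs (transfer (Arg ?m) Occ (\<lambda>b. [b, True]) Tmp (\<lambda>b. [])) (?L(Occ := False # S Occ))
      (30 * length v + 1) (load 0 vs ?S1)"
  proof (rule exec_weaken[OF runs_transfer])
    fix r
    show "(?L(Occ := False # S Occ, Arg ?m := [],
         Occ := rev (concat (map (\<lambda>b. [b, True]) ((?L(Occ := False # S Occ)) (Arg ?m)))) @ (?L(Occ := False # S Occ)) Occ,
         Tmp := rev (concat (map (\<lambda>b. []) ((?L(Occ := False # S Occ)) (Arg ?m)))) @ (?L(Occ := False # S Occ)) Tmp)) r =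
       load 0 vs ?S1 r"
      using snoc.prems by (auto simp: L load_upd other outside rev_code_name)
  qed (auto simp: L)
  have 3: "runs (collect ?m) (load 0 vs ?S1) (40 * length (concat (map code_name vs)))
     (?S1(Occ := concat (map code_name vs) @ ?S1 Occ))"
    using snoc.prems by (intro snoc.IH) auto
  show ?case unfolding length_append_singleton collect.simps
    by (rule exec_weaken[OF exec_Seq[OF 1 exec_Seq[OF 2 3]]]) auto
qed

fun clear_args :: "nat \<Rightarrow> reg com" where
  "clear_args 0 = Skip"
| "clear_args (Suc m) = clear (Arg m) ;; clear_args m"

lemma runs_clear_args:
  assumes "\<And>j. j < m \<Longrightarrow> length (S (Arg j)) \<le> N"
  shows "\<exists>S'. runs (clear_args m) S (m * (3 * N + 2)) S' \<and> (\<forall>j. S' (Arg j) = (if j < m then [] else S (Arg j))) \<and>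
    (\<forall>r. (\<forall>j. r \<noteq> Arg j) \<longrightarrow> S' r = S r)"
  using assms
proof (induction m arbitrary: S)
  case 0
  show ?case unfolding clear_args.simps
    by (rule exI[of _ S]) (auto intro: exec_refl)
next
  case (Suc m)
  have 1: "runs (clear (Arg m)) S (3 * N + 1) (S(Arg m := []))"
    by (rule exec_mono[OF runs_clear]) (use Suc.prems[of m] in simp)
  have "length ((S(Arg m := [])) (Arg j)) \<le> N" if "j < m" for j
    using Suc.prems[of j] that by simp
  from Suc.IH[of "S(Arg m := [])", OF this] obtain S' where S': "runs (clear_args m) (S(Arg m := [])) (m * (3 * N + 2)) S'"
    "\<And>j. S' (Arg j) = (if j < m then [] else (S(Arg m := [])) (Arg j))"
    "\<And>r. (\<forall>j. r \<noteq> Arg j) \<Longrightarrow> S' r = (S(Arg m := [])) r"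
    by blast
  show ?case unfolding clear_args.simps
    by (intro exI[of _ S'] conjI exec_mono[OF exec_Seq[OF 1 S'(1)]])
       (use S'(2,3) in \<open>auto simp: less_Suc_eq\<close>)
qed

section \<open>The transducer computes its output in polynomial time\<close>

text \<open>Reversed because the occurrences of later atoms lie on top of the stack
  \<open>Occ\<close>.\<close>

definition occs :: "name wedge_formula \<Rightarrow> name list" where
  "occs \<phi> = concat (map args (rev \<phi>))"

definition env :: "name atom \<Rightarrow> reg \<Rightarrow> name" where
  "env a = (\<lambda>r. case r of Arg j \<Rightarrow> if j < length (args a) then args a ! j else [] | _ \<Rightarrow> [])"

lemma length_code_args: "length (concat (map code_name (args a))) \<le> length (code_atom a)"
proof (cases a)
  case (Rel R vs)
  have "length (concat (map code_name vs)) \<le> length (code_list code_name vs)"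
    by (induction vs) auto
  with Rel show ?thesis by simp
qed simp

lemma length_code_occs: "length (concat (map code_name (occs \<phi>))) \<le> length (code_atoms \<phi>)"
proof (induction \<phi>)
  case (Cons a \<phi>)
  then show ?case using length_code_args[of a] by (simp add: occs_def)
qed (simp add: occs_def)

lemma length_arg: "v \<in> set (args a) \<Longrightarrow> length v \<le> length (code_atom a)"
proof -
  assume "v \<in> set (args a)"
  then have "length (code_name v) \<le> length (concat (map code_name (args a)))"
    by (induction "args a" arbitrary: a) (auto simp: length_concat intro: member_le_sum_list)
  with length_code_args[of a] show ?thesis by simp
qed

section \<open>Polynomially bounded cost functions\<close>

definition poly_bounded :: "(nat \<Rightarrow> nat) \<Rightarrow> bool" where
  "poly_bounded T \<longleftrightarrow> (\<exists>p :: nat poly. \<forall>n. T n \<le> poly p n)"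

lemma poly_bounded_intros:
  "poly_bounded (\<lambda>n. c)" "poly_bounded (\<lambda>n. n)"
  "poly_bounded f \<Longrightarrow> poly_bounded g \<Longrightarrow> poly_bounded (\<lambda>n. f n + g n)"
  "poly_bounded f \<Longrightarrow> poly_bounded g \<Longrightarrow> poly_bounded (\<lambda>n. f n * g n)"
proof -
  show "poly_bounded (\<lambda>n. c)" unfolding poly_bounded_def by (rule exI[of _ "[:c:]"]) simp
  show "poly_bounded (\<lambda>n. n)" unfolding poly_bounded_def by (rule exI[of _ "[:0, 1:]"]) simp
  show "poly_bounded (\<lambda>n. f n + g n)" if "poly_bounded f" "poly_bounded g"
    using that unfolding poly_bounded_def by (metis add_mono poly_add)
  show "poly_bounded (\<lambda>n. f n * g n)" if "poly_bounded f" "poly_bounded g"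
    using that unfolding poly_bounded_def by (metis le0 mult_mono poly_mult)
qed

lemma poly_bounded_sum:
  "finite A \<Longrightarrow> (\<And>i. i \<in> A \<Longrightarrow> poly_bounded (T i)) \<Longrightarrow> poly_bounded (\<lambda>n. \<Sum>i\<in>A. T i n)"
  by (induction A rule: finite_induct) (auto intro: poly_bounded_intros)

lemma poly_bounded_items_cost: "poly_bounded (\<lambda>n. items_cost n is)"
proof (induction "is")
  case (Cons i "is")
  have "poly_bounded (\<lambda>n. item_cost n i)" by (cases i) (auto intro!: poly_bounded_intros)
  with Cons show ?case by (auto intro: poly_bounded_intros)
qed (auto intro: poly_bounded_intros)

lemma poly_bounded_nest_time: "poly_bounded \<tau> \<Longrightarrow> poly_bounded (\<lambda>n. nest_time (\<tau> n) n k)"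
  by (induction k) (auto intro!: poly_bounded_intros)

text \<open>\<open>us\<close> is the template for the list of variables, \<open>fs t\<close> the one
  for the atoms caused by an input atom with symbol t, \<open>L\<close> the number of loops around
  both, and \<open>y0\<close> the answer to the empty formula.\<close>

locale transducer =
  fixes \<D> :: "'d rel_structure" and us :: "item list" and fs :: "name option \<Rightarrow> item list"
    and L :: nat and y0 :: "bool list"
  assumes finite_sig: "finite (sig \<D>)" and arity_pos: "R \<in> sig \<D> \<Longrightarrow> 1 \<le> arity \<D> R"
    and us_ok: "\<forall>i\<in>set us. item_ok i" and fs_ok: "\<forall>i\<in>set (fs t). item_ok i"
begin

text \<open>Both parts are written in the same pass, so the list of variables is repeated for every
  atom of the input; only the set of its elements will matter.\<close>

definition vars_part :: "name wedge_formula \<Rightarrow> name wedge_formula \<Rightarrow> bool list" where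
  "vars_part \<phi> \<psi> = concat (map (\<lambda>a. gen (occs \<phi>) (items_string us) L (env a)) \<psi>)"

definition form_part :: "name wedge_formula \<Rightarrow> name wedge_formula \<Rightarrow> bool list" where
  "form_part \<phi> \<psi> = concat (map (\<lambda>a. gen (occs \<phi>) (items_string (fs (symbol a))) L (env a)) \<psi>)"

definition result :: "name wedge_formula \<Rightarrow> bool list" where
  "result \<phi> = (if \<phi> = [] then y0 else vars_part \<phi> \<phi> @ False # form_part \<phi> \<phi> @ [False])"

definition depth :: nat where
  "depth = Suc (\<Sum>R\<in>sig \<D>. length R)"

definition max_args :: nat where
  "max_args = 2 + (\<Sum>R\<in>sig \<D>. arity \<D> R)"

lemma short: "R \<in> sig \<D> \<Longrightarrow> length R < depth"
  unfolding depth_def less_Suc_eq_le by (rule member_le_sum) (auto simp: finite_sig)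

lemma args_le: "atom_over \<D> a \<Longrightarrow> length (args a) \<le> max_args"
proof (cases a)
  case (Rel R vs)
  assume "atom_over \<D> a"
  with Rel have "R \<in> sig \<D>" "length vs = arity \<D> R" by auto
  moreover from this(1) have "arity \<D> R \<le> (\<Sum>R\<in>sig \<D>. arity \<D> R)"
    by (intro member_le_sum) (auto simp: finite_sig)
  ultimately show ?thesis using Rel by (simp add: max_args_def)
qed (simp add: max_args_def)

section \<open>First pass: collecting the variable occurrences\<close>

definition store1 :: "bool list \<Rightarrow> name wedge_formula \<Rightarrow> reg store" where
  "store1 x \<psi> = (\<lambda>_. [])(Sav := x, Occ := concat (map code_name (occs \<psi>)))"

definition act1 :: "name option \<Rightarrow> reg com" where
  "act1 t = (case t of Some R \<Rightarrow> collect (arity \<D> R) | None \<Rightarrow> collect 2)"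

lemma act1_eq: "atom_over \<D> a \<Longrightarrow> act1 (symbol a) = collect (length (args a))"
  by (cases a) (auto simp: act1_def numeral_2_eq_2)

lemma reader1: "formula_reader \<D> act1 (store1 x) (40 * N) N depth"
proof
  fix a \<psi> y assume a: "atom_over \<D> a" "length (code_atoms (\<psi> @ [a])) \<le> N"
  let ?S = "(store1 x \<psi>)(Inp := y)"
  have "runs (collect (length (args a))) (load 0 (args a) ?S) (40 * length (concat (map code_name (args a))))
    (?S(Occ := concat (map code_name (args a)) @ ?S Occ))"
    by (rule runs_collect) (auto simp: store1_def)
  moreover have "?S(Occ := concat (map code_name (args a)) @ ?S Occ) = (store1 x (\<psi> @ [a]))(Inp := y)"
    by (auto simp: store1_def occs_def fun_eq_iff)
  moreover have "length (concat (map code_name (args a))) \<le> N"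
    using length_code_args[of a] a(2) by simp
  ultimately show "runs (act1 (symbol a)) (load 0 (args a) ?S) (40 * N) ((store1 x (\<psi> @ [a]))(Inp := y))"
    unfolding act1_eq[OF a(1)] by (auto elim: exec_mono)
qed (auto simp: short store1_def)

section \<open>Second pass: expanding every atom\<close>

definition body_cost :: "nat \<Rightarrow> nat" where
  "body_cost N = items_cost N us + (\<Sum>t\<in>insert None (Some ` sig \<D>). items_cost N (fs t)) + 1"

definition act2 :: "name option \<Rightarrow> reg com" where
  "act2 t = nest (emit_items Out_vars us ;; emit_items Out_form (fs t)) L ;; clear_args max_args"

definition act2_time :: "nat \<Rightarrow> nat" where
  "act2_time N = nest_time (body_cost N) N L + max_args * (3 * N + 2) + 1"

definition store2 :: "bool list \<Rightarrow> name wedge_formula \<Rightarrow> name wedge_formula \<Rightarrow> reg store" where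
  "store2 x \<phi> \<psi> = emitted (vars_part \<phi> \<psi>) (form_part \<phi> \<psi>) (store1 x \<phi>)"

lemma fs_cost:
  assumes "atom_over \<D> a"
  shows "items_cost N us + items_cost N (fs (symbol a)) + 1 \<le> body_cost N"
proof -
  have "symbol a \<in> insert None (Some ` sig \<D>)" using assms by (cases a) auto
  then have "items_cost N (fs (symbol a)) \<le> (\<Sum>t\<in>insert None (Some ` sig \<D>). items_cost N (fs t))"
    by (intro member_le_sum) (auto simp: finite_sig)
  then show ?thesis by (simp add: body_cost_def)
qed

lemma depends_items: "\<forall>i\<in>set is. item_ok i \<Longrightarrow> depends_on_values (items_string is)"
  unfolding depends_on_values_def by (auto intro: items_string_cong)

text \<open>The loops around the first atom already range over the occurrences in all of \<phi>.
  Hence \<phi> is fixed here with \<open>Occ\<close> complete, and only the prefix \<psi>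
  grows.\<close>

lemma reader2:
  assumes "length (code_atoms \<phi>) \<le> N"
  shows "formula_reader \<D> act2 (store2 x \<phi>) (act2_time N) N depth"
proof
  fix a \<psi> y assume a: "atom_over \<D> a" "length (code_atoms (\<psi> @ [a])) \<le> N"
  let ?S = "load 0 (args a) ((store2 x \<phi> \<psi>)(Inp := y))"
  let ?b = "emit_items Out_vars us ;; emit_items Out_form (fs (symbol a))"
  let ?u = "gen (occs \<phi>) (items_string us) L (env a)"
  let ?p = "gen (occs \<phi>) (items_string (fs (symbol a))) L (env a)"
  have other: "?S r = ((store2 x \<phi> \<psi>)(Inp := y)) r" if "\<And>j. r \<noteq> Arg j" for r
    using that by (rule load_other)
  have Arg: "?S (Arg j) = rev (env a (Arg j))" for j
    using load_inside[of j "args a" 0 "(store2 x \<phi> \<psi>)(Inp := y)"]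
      load_outside[of j 0 "args a" "(store2 x \<phi> \<psi>)(Inp := y)"]
    by (cases "j < length (args a)") (auto simp: env_def store2_def store1_def)
  have Loop: "?S (Loop j) = []" "?S (Iter j) = []" for j
    using other[of "Loop j"] other[of "Iter j"] by (simp_all add: store2_def store1_def)
  have env_le: "length (env a (Arg j)) \<le> N" for j
  proof (cases "j < length (args a)")
    case True
    then have "length (args a ! j) \<le> length (code_atom a)" by (intro length_arg) auto
    with True a(2) show ?thesis by (simp add: env_def)
  qed (simp add: env_def)
  have le: "length (?S r) \<le> N" if "r \<in> value_regs" for r
    using that env_le by (auto simp: value_regs_def Arg Loop)
  have "runs (nest ?b L) ?S (nest_time (body_cost N) N L)
      (emitted (gen (occs \<phi>) (items_string us) L (rev \<circ> ?S)) (gen (occs \<phi>) (items_string (fs (symbol a))) L (rev \<circ> ?S)) ?S)"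
  proof (rule runs_nest)
    show "runs ?b S (body_cost N) (emitted (items_string us (rev \<circ> S)) (items_string (fs (symbol a)) (rev \<circ> S)) S)"
      if "S Tmp = []" "\<And>r. r \<in> value_regs \<Longrightarrow> length (S r) \<le> N" for S
      using us_ok fs_ok that by (intro exec_mono[OF runs_body fs_cost[OF a(1)]]) auto
    show "?S Tmp = []" "?S Occ = concat (map code_name (occs \<phi>))"
      using other[of Tmp] other[of Occ] by (simp_all add: store2_def store1_def)
    then show "length (?S Occ) \<le> N"
      using length_code_occs[of \<phi>] assms by simp
  qed (auto simp: depends_items us_ok fs_ok Loop le)
  moreover have "gen (occs \<phi>) (items_string us) L (rev \<circ> ?S) = ?u"
    "gen (occs \<phi>) (items_string (fs (symbol a))) L (rev \<circ> ?S) = ?p"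
    by (intro gen_cong depends_items us_ok fs_ok; auto simp: value_regs_def Arg Loop env_def)+
  ultimately have 1: "runs (nest ?b L) ?S (nest_time (body_cost N) N L) (emitted ?u ?p ?S)" by simp
  have "length ((emitted ?u ?p ?S) (Arg j)) \<le> N" for j using env_le by (simp add: Arg)
  then obtain S' where S': "runs (clear_args max_args) (emitted ?u ?p ?S) (max_args * (3 * N + 2)) S'"
    "\<And>j. S' (Arg j) = (if j < max_args then [] else (emitted ?u ?p ?S) (Arg j))"
    "\<And>r. (\<forall>j. r \<noteq> Arg j) \<Longrightarrow> S' r = (emitted ?u ?p ?S) r"
    using runs_clear_args[of max_args "emitted ?u ?p ?S" N] by blast
  have final: "S' r = ((store2 x \<phi> (\<psi> @ [a]))(Inp := y)) r" for r
  proof (cases "\<exists>j. r = Arg j")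
    case True
    then obtain j where r: "r = Arg j" by blast
    have "S' r = []" using args_le[OF a(1)] by (simp add: r S'(2) Arg) (simp add: env_def)
    then show ?thesis by (simp add: r store2_def store1_def)
  next
    case False
    then have "S' r = (emitted ?u ?p ?S) r" using S'(3) by blast
    also have "\<dots> = (emitted ?u ?p ((store2 x \<phi> \<psi>)(Inp := y))) r"
      using False by (auto simp: emitted_def other)
    also have "\<dots> = ((store2 x \<phi> (\<psi> @ [a]))(Inp := y)) r"
      by (auto simp: emitted_def store2_def vars_part_def form_part_def)
    finally show ?thesis .
  qed
  show "runs (act2 (symbol a)) ?S (act2_time N) ((store2 x \<phi> (\<psi> @ [a]))(Inp := y))"
    unfolding act2_def by (rule exec_weaken[OF exec_Seq[OF 1 S'(1)]]) (auto simp: act2_time_def final)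
qed (auto simp: short store2_def store1_def)

section \<open>The complete program and its running time\<close>

definition finish :: "reg com" where
  "finish = pushes Out_form [False] ;; pushes Out_vars [False] ;;
     transfer Out_form Inp (\<lambda>b. [b]) Tmp (\<lambda>b. []) ;; transfer Out_vars Inp (\<lambda>b. [b]) Tmp (\<lambda>b. [])"

text \<open>The first pass also validates the input, so the second one meets only codes of formulas
  and cannot fail.\<close>

definition main :: "reg com" where
  "main = copy Tmp Inp Sav ;; formula_reader.formula_prog \<D> act1 depth ;;
     Cond Occ is_empty (pushes Inp (rev y0))
       (copy Tmp Sav Inp ;; formula_reader.formula_prog \<D> act2 depth ;; finish)"

text \<open>Unloading turns the reversed output into reading order. \<open>Inp\<close> is itself a
  stack, so the formula is unloaded first and the list of variables ends up in front.\<close>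

lemma runs_finish:
  assumes "S Tmp = []" "S Inp = []"
  shows "\<exists>S'. runs finish S (30 * (length (S Out_form) + length (S Out_vars)) + 100) S' \<and>
    S' Inp = rev (S Out_vars) @ False # rev (S Out_form) @ [False]"
proof -
  let ?S1 = "S(Out_form := False # S Out_form)"
  let ?S2 = "?S1(Out_vars := False # S Out_vars)"
  let ?S3 = "?S2(Out_form := [], Inp := rev (False # S Out_form))"
  let ?S4 = "?S3(Out_vars := [], Inp := rev (False # S Out_vars) @ ?S3 Inp)"
  have 1: "runs (pushes Out_form [False]) S 4 ?S1"
    by (rule exec_weaken[OF runs_pushes]) auto
  have 2: "runs (pushes Out_vars [False]) ?S1 4 ?S2"
    by (rule exec_weaken[OF runs_pushes]) auto
  have 3: "runs (transfer Out_form Inp (\<lambda>b. [b]) Tmp (\<lambda>b. [])) ?S2 (30 * length (S Out_form) + 31) ?S3"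
    by (rule exec_weaken[OF runs_transfer]) (use assms in auto)
  have 4: "runs (transfer Out_vars Inp (\<lambda>b. [b]) Tmp (\<lambda>b. [])) ?S3 (30 * length (S Out_vars) + 31) ?S4"
    by (rule exec_weaken[OF runs_transfer]) (use assms in auto)
  from exec_Seq[OF 1 exec_Seq[OF 2 exec_Seq[OF 3 4]]]
  have "runs finish S (30 * (length (S Out_form) + length (S Out_vars)) + 100) ?S4"
    unfolding finish_def by (rule exec_mono) simp
  then show ?thesis by (intro exI[of _ ?S4]) simp
qed

definition time1 :: "nat \<Rightarrow> nat" where
  "time1 n = (40 * n + 4 * depth + 40 * n + 80) * (n + 1)"

definition time2 :: "nat \<Rightarrow> nat" where
  "time2 n = (40 * n + 4 * depth + act2_time n + 80) * (n + 1)"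

text \<open>The last summand pays for \<open>finish\<close>: 30 steps per bit of two words, each of
  length at most \<open>n * nest_time (body_cost n) n L\<close>.\<close>

definition main_time :: "nat \<Rightarrow> nat" where
  "main_time n = 120 * n + 200 + time1 n + 4 * length y0 + time2 n + 60 * (n * nest_time (body_cost n) n L)"

text \<open>Arities are positive, so every atom contributes an occurrence and the machine recognises
  the empty formula by an empty \<open>Occ\<close>.\<close>

lemma occs_empty: "formula_over \<D> \<phi> \<Longrightarrow> occs \<phi> = [] \<longleftrightarrow> \<phi> = []"
proof (cases \<phi>)
  case (Cons a \<psi>)
  assume "formula_over \<D> \<phi>"
  then have "atom_over \<D> a" using Cons by (simp add: formula_over_def)
  then have "args a \<noteq> []" using arity_pos by (cases a) force+
  with Cons show ?thesis by (simp add: occs_def)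
qed (simp add: occs_def)

lemma length_code_formula: "length \<phi> \<le> length (code_atoms \<phi>)"
  by (induction \<phi>) auto

text \<open>Controls the length of the two output words, and thereby the time that unloading them
  takes.\<close>

lemma length_part:
  assumes "formula_over \<D> \<phi>" "length (code_atoms \<phi>) \<le> N"
    "\<And>a. atom_over \<D> a \<Longrightarrow> (\<forall>i\<in>set (is a). item_ok i) \<and> items_cost N (is a) \<le> body_cost N"
  shows "length (concat (map (\<lambda>a. gen (occs \<phi>) (items_string (is a)) L (env a)) \<phi>))
    \<le> N * nest_time (body_cost N) N L"
proof -
  have arg_le: "length v \<le> N" if "a \<in> set \<phi>" "v \<in> set (args a)" for a v
  proof -
    have "length (code_atom a) \<le> length (code_atoms \<phi>)"
      using that(1) by (induction \<phi>) auto
    with length_arg[OF that(2)] assms(2) show ?thesis by simp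
  qed
  have occs_le: "length (occs \<phi>) \<le> N"
  proof -
    have "length ws \<le> length (concat (map code_name ws))" for ws
    proof (induction ws)
      case (Cons w ws)
      then show ?case by simp
    qed simp
    from this[of "occs \<phi>"] length_code_occs[of \<phi>] assms(2) show ?thesis by simp
  qed
  have "length (gen (occs \<phi>) (items_string (is a)) L (env a)) \<le> nest_time (body_cost N) N L" if "a \<in> set \<phi>" for a
  proof (rule length_gen)
    have over: "atom_over \<D> a" using that assms(1) by (simp add: formula_over_def)
    show "length (items_string (is a) \<rho>) \<le> body_cost N"
      if "\<And>r. r \<in> value_regs \<Longrightarrow> length (\<rho> r) \<le> N" for \<rho>
      using length_items_string[of "is a" \<rho> N] assms(3)[OF over] that by fastforce
    show "length (occs \<phi>) \<le> N" by (rule occs_le)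
    show "length v \<le> N" if "v \<in> set (occs \<phi>)" for v
      using that arg_le by (auto simp: occs_def)
    show "length (env a r) \<le> N" for r
      using arg_le[OF that] by (auto simp: env_def split: reg.split)
  qed
  then have "(\<Sum>a\<leftarrow>\<phi>. length (gen (occs \<phi>) (items_string (is a)) L (env a))) \<le> (\<Sum>a\<leftarrow>\<phi>. nest_time (body_cost N) N L)"
    by (rule sum_list_mono)
  also have "\<dots> = length \<phi> * nest_time (body_cost N) N L" by (simp add: sum_list_triv)
  also have "\<dots> \<le> N * nest_time (body_cost N) N L"
    using length_code_formula[of \<phi>] assms(2) by (intro mult_mono) auto
  finally show ?thesis by (simp add: length_concat o_def)
qed

lemma runs_main:
  assumes "formula_over \<D> \<phi>" "x = code_formula \<phi>"
  shows "\<exists>S'. runs main ((\<lambda>_. [])(Inp := x)) (main_time (length x)) S' \<and> S' Inp = result \<phi>"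
proof -
  let ?n = "length x"
  have n: "length (code_atoms \<phi>) \<le> ?n" using assms(2) by (simp add: code_formula_atoms)
  interpret r1: formula_reader \<D> act1 "store1 x" "40 * ?n" ?n depth by (rule reader1)
  interpret r2: formula_reader \<D> act2 "store2 x \<phi>" "act2_time ?n" ?n depth by (rule reader2[OF n])
  have 1: "runs (copy Tmp Inp Sav) ((\<lambda>_. [])(Inp := x)) (60 * ?n + 3) ((store1 x [])(Inp := x))"
    by (rule exec_weaken[OF runs_copy]) (auto simp: store1_def occs_def)
  have 2: "runs r1.formula_prog ((store1 x [])(Inp := x)) (time1 ?n) ((store1 x \<phi>)(Inp := []))"
    using r1.formula_prog(1)[of "[]" x \<phi>] assms unfolding r1.iteration_time_def time1_def by simp
  let ?c = "Cond Occ is_empty (pushes Inp (rev y0)) (copy Tmp Sav Inp ;; r2.formula_prog ;; finish)"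
  let ?S = "(store1 x \<phi>)(Inp := [])"
  have Occ: "is_empty (top_symbol (?S Occ)) \<longleftrightarrow> \<phi> = []"
    using occs_empty[OF assms(1)] by (cases "occs \<phi>") (auto simp: store1_def)
  have "\<exists>S'. runs ?c ?S (4 * length y0 + 150 + 60 * ?n + time2 ?n + 60 * (?n * nest_time (body_cost ?n) ?n L)) S' \<and> S' Inp = result \<phi>"
  proof (cases "\<phi> = []")
    case True
    have "runs (pushes Inp (rev y0)) ?S (4 * length (rev y0)) (?S(Inp := rev (rev y0) @ ?S Inp))"
      by (rule runs_pushes)
    then have "runs ?c ?S (4 * length (rev y0) + 1) (?S(Inp := rev (rev y0) @ ?S Inp))"
      using True Occ by (intro exec_Cond) simp
    then show ?thesis using True
      by (intro exI[of _ "?S(Inp := rev (rev y0) @ ?S Inp)"]) (auto simp: result_def elim: exec_mono)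
  next
    case False
    let ?S2 = "(store2 x \<phi> \<phi>)(Inp := [])"
    have 3: "runs (copy Tmp Sav Inp) ?S (60 * ?n + 3) ((store2 x \<phi> [])(Inp := x))"
      by (rule exec_weaken[OF runs_copy])
         (auto simp: store1_def store2_def emitted_def vars_part_def form_part_def)
    have 4: "runs r2.formula_prog ((store2 x \<phi> [])(Inp := x)) (time2 ?n) ?S2"
      using r2.formula_prog(1)[of "[]" x \<phi>] assms unfolding r2.iteration_time_def time2_def by simp
    obtain S' where S': "runs finish ?S2 (30 * (length (?S2 Out_form) + length (?S2 Out_vars)) + 100) S'"
      "S' Inp = rev (?S2 Out_vars) @ False # rev (?S2 Out_form) @ [False]"
      using runs_finish[of ?S2] by (auto simp: store2_def store1_def)
    have vp: "length (vars_part \<phi> \<phi>) \<le> ?n * nest_time (body_cost ?n) ?n L" unfolding vars_part_def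
      using us_ok by (intro length_part[OF assms(1) n]) (auto simp: body_cost_def)
    have fp: "length (form_part \<phi> \<phi>) \<le> ?n * nest_time (body_cost ?n) ?n L" unfolding form_part_def
      using fs_ok fs_cost[of _ ?n] by (intro length_part[OF assms(1) n]) (auto dest: fs_cost[of _ ?n])
    have len: "30 * (length (?S2 Out_form) + length (?S2 Out_vars)) \<le> 60 * (?n * nest_time (body_cost ?n) ?n L)"
      using vp fp by (simp add: store2_def store1_def)
    have "runs ?c ?S (60 * ?n + 3 + (time2 ?n + (30 * (length (?S2 Out_form) + length (?S2 Out_vars)) + 100) + 1) + 1 + 1) S'"
      using exec_Seq[OF 3 exec_Seq[OF 4 S'(1)]] False Occ by (intro exec_Cond) simp
    then have "runs ?c ?S (4 * length y0 + 150 + 60 * ?n + time2 ?n + 60 * (?n * nest_time (body_cost ?n) ?n L)) S'"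
      by (rule exec_mono) (use len in linarith)
    moreover have "S' Inp = result \<phi>"
      using S'(2) False by (simp add: result_def store2_def store1_def)
    ultimately show ?thesis by blast
  qed
  then obtain S' where S': "runs ?c ?S (4 * length y0 + 150 + 60 * ?n + time2 ?n + 60 * (?n * nest_time (body_cost ?n) ?n L)) S'"
    "S' Inp = result \<phi>" by blast
  have "runs main ((\<lambda>_. [])(Inp := x)) (main_time ?n) S'"
    unfolding main_def by (rule exec_mono[OF exec_Seq[OF 1 exec_Seq[OF 2 S'(1)]]]) (simp add: main_time_def)
  with S'(2) show ?thesis by blast
qed

lemma fails_main:
  assumes "\<nexists>\<phi>. formula_over \<D> \<phi> \<and> x = code_formula \<phi>"
  shows "fails Inp main ((\<lambda>_. [])(Inp := x)) (main_time (length x))"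
proof -
  let ?n = "length x"
  interpret r1: formula_reader \<D> act1 "store1 x" "40 * ?n" ?n depth by (rule reader1)
  have 1: "runs (copy Tmp Inp Sav) ((\<lambda>_. [])(Inp := x)) (60 * ?n + 3) ((store1 x [])(Inp := x))"
    by (rule exec_weaken[OF runs_copy]) (auto simp: store1_def occs_def)
  have 2: "fails Inp r1.formula_prog ((store1 x [])(Inp := x)) (time1 ?n)"
    using r1.formula_prog(2)[of "[]" x] assms unfolding r1.iteration_time_def time1_def by simp
  show ?thesis unfolding main_def
    by (rule fails_mono[OF fails_Seq_right[OF 1 fails_Seq_left[OF 2]]]) (simp add: main_time_def)
qed

lemma poly_bounded_main_time: "poly_bounded main_time"
proof -
  have body: "poly_bounded body_cost"
    unfolding body_cost_def[abs_def] using finite_sig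
    by (intro poly_bounded_intros poly_bounded_sum poly_bounded_items_cost) auto
  show ?thesis
    unfolding main_time_def[abs_def] time1_def time2_def act2_time_def
    by (intro poly_bounded_intros poly_bounded_nest_time body)
qed

theorem poly_time_result:
  assumes "\<And>\<phi>. formula_over \<D> \<phi> \<Longrightarrow> f (code_formula \<phi>) = result \<phi>"
    and "\<And>x. \<nexists>\<phi>. formula_over \<D> \<phi> \<and> x = code_formula \<phi> \<Longrightarrow> f x = []"
  shows "poly_time f"
proof -
  obtain p where "\<And>n. main_time n \<le> poly p n"
    using poly_bounded_main_time unfolding poly_bounded_def by blast
  moreover have "\<exists>S'. (runs main ((\<lambda>_. [])(Inp := x)) (main_time (length x)) S' \<or>
      exec main ((\<lambda>_. [])(Inp := x)) (main_time (length x)) Fail S') \<and> S' Inp = f x" for x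
    using runs_main[of _ x] fails_main[of x] assms unfolding fails_def by metis
  ultimately show ?thesis by (rule poly_time_com[rotated])
qed

end

section \<open>Patterns of applications\<close>

lemma finite_tuples: "finite A \<Longrightarrow> finite (tuples A k)"
  unfolding tuples_def by (rule finite_lists_length_eq)

lemma atom_vars_map [simp]: "atom_vars (map_atom k a) = k ` atom_vars a"
  by (cases a) auto

lemma args_vars: "set (args a) = atom_vars a"
  by (cases a) auto

lemma atom_over_map [simp]: "atom_over B (map_atom k a) = atom_over B a"
  by (cases a) auto

lemma sat_atom_map: "sat_atom B h (map_atom k a) = sat_atom B (h \<circ> k) a"
  by (cases a) auto

lemma sat_atom_cong: "(\<And>v. v \<in> atom_vars a \<Longrightarrow> h v = h' v) \<Longrightarrow> sat_atom B h a = sat_atom B h' a"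
  by (cases a) (auto cong: map_cong)

lemma map_atom_id: "(\<And>v. v \<in> atom_vars a \<Longrightarrow> k v = v) \<Longrightarrow> map_atom k a = a"
  by (cases a) (auto intro: map_idI)

lemma finite_atoms:
  assumes "finite (sig B)" "finite X"
  shows "finite {a. atom_over B a \<and> atom_vars a \<subseteq> X}"
proof (rule finite_subset)
  show "{a. atom_over B a \<and> atom_vars a \<subseteq> X} \<subseteq>
    (\<Union>R\<in>sig B. Rel R ` tuples X (arity B R)) \<union> (\<lambda>(u, v). Eq u v) ` (X \<times> X)"
  proof
    fix a assume "a \<in> {a. atom_over B a \<and> atom_vars a \<subseteq> X}"
    then show "a \<in> (\<Union>R\<in>sig B. Rel R ` tuples X (arity B R)) \<union> (\<lambda>(u, v). Eq u v) ` (X \<times> X)"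
      by (cases a) (auto simp: tuples_def)
  qed
  show "finite ((\<Union>R\<in>sig B. Rel R ` tuples X (arity B R)) \<union> (\<lambda>(u, v). Eq u v) ` (X \<times> X))"
    using assms by (auto intro: finite_tuples)
qed

text \<open>An application with registers as formal variables; the loops supply the actual
  ones.\<close>

type_synonym ('d, 'b) pattern = "('d, 'b) enc_map \<times> reg list"

definition instantiate :: "(reg \<Rightarrow> name) \<Rightarrow> ('d, 'b) pattern \<Rightarrow> ('d, 'b) application" where
  "instantiate \<rho> = (\<lambda>(f, rs). (map \<rho> rs, f))"

definition pattern_value :: "(reg \<Rightarrow> 'd) \<Rightarrow> ('d, 'b) pattern \<Rightarrow> 'b" where
  "pattern_value g = (\<lambda>(f, rs). snd f (map g rs))"

definition patterns_over :: "('d, 'b) enc_map set \<Rightarrow> reg set \<Rightarrow> ('d, 'b) pattern set" where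
  "patterns_over F X = {(f, rs). f \<in> F \<and> rs \<in> tuples X (fst f)}"

text \<open>Moves the substitution from the application to the assignment. It is the reason why a
  pattern valid for all register values stays valid under every choice of variables, repeated ones
  included.\<close>

lemma apply_at_instantiate: "apply_at (instantiate \<rho> p) g = pattern_value (g \<circ> \<rho>) p"
  by (cases p) (auto simp: apply_at_def instantiate_def pattern_value_def split: prod.split)

lemma instantiate_in:
  "p \<in> patterns_over F X \<Longrightarrow> (\<And>r. r \<in> X \<Longrightarrow> \<rho> r \<in> V) \<Longrightarrow> instantiate \<rho> p \<in> applications V F"
  by (cases p) (auto simp: patterns_over_def instantiate_def applications_def tuples_def)

lemma finite_patterns_over: "finite F \<Longrightarrow> finite X \<Longrightarrow> finite (patterns_over F X)"
  by (rule finite_subset[of _ "Sigma F (\<lambda>f. tuples X (fst f))"])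
     (auto simp: patterns_over_def intro: finite_tuples)

lemma finite_applications: "finite V \<Longrightarrow> finite F \<Longrightarrow> finite (applications V F)"
  by (rule finite_subset[of _ "(\<lambda>(f, vs). (vs, f)) ` Sigma F (\<lambda>f. tuples V (fst f))"])
     (force simp: applications_def intro: finite_tuples)+

lemma app_map_eq: "\<alpha> \<in> applications V F \<Longrightarrow> app_map V F g \<alpha> = apply_at \<alpha> g"
  by (simp add: app_map_def)

section \<open>What the nested loops enumerate\<close>

definition with_loops :: "nat \<Rightarrow> (nat \<Rightarrow> 'x) \<Rightarrow> (reg \<Rightarrow> 'x) \<Rightarrow> reg \<Rightarrow> 'x" where
  "with_loops k w \<rho> = (\<lambda>r. case r of Loop i \<Rightarrow> if i < k then w i else \<rho> r | _ \<Rightarrow> \<rho> r)"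

lemma with_loops_simps [simp]:
  "i < k \<Longrightarrow> with_loops k w \<rho> (Loop i) = w i" "with_loops k w \<rho> (Arg j) = \<rho> (Arg j)"
  by (auto simp: with_loops_def)

lemma with_loops_Suc: "with_loops k w (\<rho>(Loop k := v)) = with_loops (Suc k) (w(k := v)) \<rho>"
  by (auto simp: with_loops_def fun_eq_iff split: reg.split)

text \<open>Forgets the order and repetition of the output: from here on the loops are an
  existential quantifier over choices of variables.\<close>

lemma set_gen: "x \<in> set (gen ws h k \<rho>) \<longleftrightarrow> (\<exists>w. (\<forall>i<k. w i \<in> set ws) \<and> x \<in> set (h (with_loops k w \<rho>)))"
proof (induction k arbitrary: \<rho>)
  case 0
  have "with_loops 0 w \<rho> = \<rho>" for w :: "nat \<Rightarrow> name"
    by (auto simp: with_loops_def fun_eq_iff split: reg.split)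
  then show ?case by simp
next
  case (Suc k)
  show ?case
  proof
    assume "x \<in> set (gen ws h (Suc k) \<rho>)"
    then obtain v where "v \<in> set ws" "x \<in> set (gen ws h k (\<rho>(Loop k := v)))" by auto
    moreover from this(2) obtain w where "\<forall>i<k. w i \<in> set ws" "x \<in> set (h (with_loops k w (\<rho>(Loop k := v))))"
      using Suc.IH by blast
    ultimately show "\<exists>w. (\<forall>i<Suc k. w i \<in> set ws) \<and> x \<in> set (h (with_loops (Suc k) w \<rho>))"
      by (intro exI[of _ "w(k := v)"]) (auto simp: with_loops_Suc less_Suc_eq)
  next
    assume "\<exists>w. (\<forall>i<Suc k. w i \<in> set ws) \<and> x \<in> set (h (with_loops (Suc k) w \<rho>))"
    then obtain w where w: "\<forall>i<Suc k. w i \<in> set ws" "x \<in> set (h (with_loops (Suc k) w \<rho>))" by blast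
    then have "x \<in> set (h (with_loops k w (\<rho>(Loop k := w k))))" by (simp add: with_loops_Suc)
    moreover have "\<forall>i<k. w i \<in> set ws" using w(1) by simp
    ultimately have "x \<in> set (gen ws h k (\<rho>(Loop k := w k)))" unfolding Suc.IH by blast
    with w(1) show "x \<in> set (gen ws h (Suc k) \<rho>)" by auto
  qed
qed

lemma concat_map_concat_map:
  "concat (map c (concat (map f xs))) = concat (map (\<lambda>x. concat (map c (f x))) xs)"
  by (induction xs) auto

text \<open>Coding commutes with the loops, so the bits written can be read as the code of a list of
  objects generated by the same loops.\<close>

lemma gen_concat_map: "gen ws (\<lambda>\<rho>. concat (map c (h \<rho>))) k \<rho> = concat (map c (gen ws h k \<rho>))"
  by (induction k arbitrary: \<rho>) (simp_all add: concat_map_concat_map)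

section \<open>Correctness of the reduction\<close>

locale stable_template =
  fixes B :: "'b rel_structure" and D :: "'d set"
    and F :: "('d, 'b) enc_map set" and \<D> :: "'d rel_structure"
  assumes finite_B: "finite_structure B" and encoding: "encoding B D F"
    and stable: "F_stable B D F" and template: "induced_template B D F \<D>"
begin

lemma finite_F: "finite F"
  using encoding by (auto simp: encoding_def)

lemma univ_D: "univ \<D> = D" and finite_\<D>: "finite_structure \<D>"
  using template by (auto simp: induced_template_def)

lemma F_map: "f \<in> F \<Longrightarrow> set xs \<subseteq> D \<Longrightarrow> length xs = fst f \<Longrightarrow> snd f xs \<in> univ B"
  using encoding by (cases f) (fastforce simp: encoding_def tuples_def)

text \<open>
  An atom over the applications has at most \<open>loops\<close> variable occurrences. One more loop is used so that
  the structure \<open>D\<close> is known to be non-empty whenever the loop registers have values in it.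
\<close>

definition loops :: nat where
  "loops = 1 + (2 + (\<Sum>R\<in>sig B. arity B R)) * (\<Sum>f\<in>F. fst f)"

lemma fst_le: "f \<in> F \<Longrightarrow> fst f \<le> (\<Sum>f\<in>F. fst f)"
  by (intro member_le_sum) (auto simp: finite_F)

lemma fst_le_loops: "f \<in> F \<Longrightarrow> fst f \<le> loops"
  using fst_le[of f] by (simp add: loops_def)

text \<open>For empty \<open>D\<close> every pattern atom over the loop registers qualifies, because
  \<open>loops\<close> is positive. This is as it should be: the closure of the empty set is cut out
  by all atoms.\<close>

definition closure_atoms :: "('d, 'b) pattern atom set" where
  "closure_atoms = {a. atom_over B a \<and> atom_vars a \<subseteq> patterns_over F (Loop ` {..<loops}) \<and>
     (\<forall>g. (\<forall>i<loops. g (Loop i) \<in> D) \<longrightarrow> sat_atom B (pattern_value g) a)}"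

text \<open>The translation of an equation: exchanging its two sides at any one position of any
  application, with arbitrary variables elsewhere, keeps the value. Changes at several positions are
  chains of such exchanges.\<close>

definition equality_atoms :: "('d, 'b) pattern atom set" where
  "equality_atoms = (\<lambda>(f, i). Eq (f, (map Loop [0..<fst f])[i := Arg 0]) (f, (map Loop [0..<fst f])[i := Arg 1])) `
     {(f, i). f \<in> F \<and> i < fst f}"

definition expresses :: "name \<Rightarrow> ('d, 'b) pattern atom \<Rightarrow> bool" where
  "expresses R a \<longleftrightarrow> atom_over B a \<and> atom_vars a \<subseteq> patterns_over F (Arg ` {..<arity \<D> R}) \<and>
     (\<forall>g. (\<forall>j<arity \<D> R. g (Arg j) \<in> D) \<longrightarrow>
       (sat_atom B (pattern_value g) a \<longleftrightarrow> map (\<lambda>j. g (Arg j)) [0..<arity \<D> R] \<in> interp \<D> R))"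

definition patterns :: "name option \<Rightarrow> ('d, 'b) pattern atom set" where
  "patterns t = closure_atoms \<union> (case t of None \<Rightarrow> equality_atoms
     | Some R \<Rightarrow> if R \<in> sig \<D> then {SOME a. expresses R a} else {})"

text \<open>Inducedness holds for every tuple of distinct variables, so one convenient tuple
  suffices. Unary words are distinct names whose lengths recover the argument positions; replacing
  them by argument registers turns the inducing applications into patterns.\<close>

lemma ex_expresses:
  assumes "R \<in> sig \<D>"
  shows "\<exists>a. expresses R a"
proof -
  let ?s = "arity \<D> R"
  define us where "us = map (\<lambda>i. replicate i True) [0..<?s]"
  define \<iota> where "\<iota> = (\<lambda>n :: name. Arg (length n))"
  have us: "distinct us" "length us = ?s"
    unfolding us_def distinct_map by (auto simp: inj_on_def dest: arg_cong[of _ _ length])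
  have \<iota>_us: "\<iota> n \<in> Arg ` {..<?s}" if "n \<in> set us" for n
    using that by (auto simp: us_def \<iota>_def)
  have "induced_relation B D F ?s (interp \<D> R)"
    using template assms by (simp add: induced_template_def)
  then obtain r Q \<alpha>s where Q: "base_relation B r Q" "\<alpha>s \<in> tuples (applications (set us) F) r"
    "interp \<D> R = {map g us |g. g \<in> set us \<rightarrow>\<^sub>E D \<and> map (app_map (set us) F g) \<alpha>s \<in> Q}"
    using us unfolding induced_relation_def by meson
  define pat where "pat = (\<lambda>(vs, f). (f, map \<iota> vs) :: ('d, 'b) pattern)"
  have pat_in: "pat \<alpha> \<in> patterns_over F (Arg ` {..<?s})" if "\<alpha> \<in> set \<alpha>s" for \<alpha>
  proof -
    have "\<alpha> \<in> applications (set us) F" using that Q(2) by (auto simp: tuples_def)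
    then show ?thesis using \<iota>_us
      by (fastforce simp: pat_def patterns_over_def applications_def tuples_def)
  qed
  have vars_iff: "map (\<lambda>\<alpha>. pattern_value g (pat \<alpha>)) \<alpha>s \<in> Q \<longleftrightarrow> map (\<lambda>j. g (Arg j)) [0..<?s] \<in> interp \<D> R"
    if g: "\<forall>j<?s. g (Arg j) \<in> D" for g
  proof -
    define g' where "g' = (\<lambda>n\<in>set us. g (\<iota> n))"
    have g'_in: "g' \<in> set us \<rightarrow>\<^sub>E D" using g \<iota>_us by (fastforce simp: g'_def)
    have map_us: "map g' us = map (\<lambda>j. g (Arg j)) [0..<?s]"
      unfolding us_def map_map by (rule map_cong) (auto simp: g'_def us_def \<iota>_def)
    have "app_map (set us) F g' \<alpha> = pattern_value g (pat \<alpha>)" if "\<alpha> \<in> set \<alpha>s" for \<alpha>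
    proof -
      obtain vs k f where \<alpha>: "\<alpha> = (vs, k, f)" by (cases \<alpha>)
      have in_app: "\<alpha> \<in> applications (set us) F" using that Q(2) by (auto simp: tuples_def)
      then have m: "map g' vs = map (g \<circ> \<iota>) vs"
        by (intro map_cong) (auto simp: \<alpha> applications_def tuples_def g'_def)
      show ?thesis unfolding app_map_eq[OF in_app]
        by (simp add: \<alpha> apply_at_def pat_def pattern_value_def m)
    qed
    then have eq: "map (app_map (set us) F g') \<alpha>s = map (\<lambda>\<alpha>. pattern_value g (pat \<alpha>)) \<alpha>s" by simp
    have "map g' us \<in> interp \<D> R \<longleftrightarrow> map (app_map (set us) F g') \<alpha>s \<in> Q"
    proof
      assume "map g' us \<in> interp \<D> R"
      then obtain g'' where g'': "g'' \<in> set us \<rightarrow>\<^sub>E D" "map g' us = map g'' us"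
        "map (app_map (set us) F g'') \<alpha>s \<in> Q" unfolding Q(3) by blast
      \<comment> \<open>A map on \<open>set us\<close> is determined by its values along
        \<open>us\<close>, so the witness of membership is \<open>g'\<close> itself.\<close>
      from g''(2) have "g' n = g'' n" if "n \<in> set us" for n using that by simp
      with PiE_ext[OF g'_in g''(1)] have "g' = g''" by blast
      with g''(3) show "map (app_map (set us) F g') \<alpha>s \<in> Q" by simp
    qed (use g'_in Q(3) in blast)
    then show ?thesis by (simp only: eq map_us)
  qed
  from Q(1) consider R' where "R' \<in> sig B" "r = arity B R'" "Q = interp B R'"
    | "r = 2" "Q = {[b, b] |b. b \<in> univ B}" unfolding base_relation_def by blast
  then show ?thesis
  proof cases
    case 1
    then have "expresses R (Rel R' (map pat \<alpha>s))"
      using pat_in vars_iff Q(2) unfolding expresses_def by (auto simp: tuples_def o_def)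
    then show ?thesis by blast
  next
    case 2
    then obtain \<alpha> \<beta> where \<alpha>s: "\<alpha>s = [\<alpha>, \<beta>]"
      using Q(2) by (auto simp: tuples_def length_Suc_conv numeral_2_eq_2)
    \<comment> \<open>The equality relation contains only pairs over the universe, so membership
      amounts to an equation only for values in \<open>univ B\<close>.\<close>
    have "pattern_value g p \<in> univ B" if "\<forall>j<?s. g (Arg j) \<in> D" "p \<in> patterns_over F (Arg ` {..<?s})" for g p
      using that F_map[of "fst p" "map g (snd p)"]
      by (fastforce simp: patterns_over_def tuples_def pattern_value_def)
    then have "map (\<lambda>\<alpha>. pattern_value g (pat \<alpha>)) \<alpha>s \<in> Q \<longleftrightarrow> pattern_value g (pat \<alpha>) = pattern_value g (pat \<beta>)"
      if "\<forall>j<?s. g (Arg j) \<in> D" for g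
      using that pat_in[of \<alpha>] 2 by (auto simp: \<alpha>s)
    then have "expresses R (Eq (pat \<alpha>) (pat \<beta>))"
      using pat_in vars_iff unfolding expresses_def by (auto simp: \<alpha>s)
    then show ?thesis by blast
  qed
qed

lemma expresses_some: "R \<in> sig \<D> \<Longrightarrow> expresses R (SOME a. expresses R a)"
  by (rule someI_ex[OF ex_expresses])

lemma patterns_over:
  assumes "a \<in> patterns t"
  shows "atom_over B a" "atom_vars a \<subseteq> patterns_over F (Loop ` {..<loops} \<union> range Arg)"
proof -
  have mono: "patterns_over F X \<subseteq> patterns_over F Y" if "X \<subseteq> Y" for X Y
    using that by (auto simp: patterns_over_def tuples_def)
  have "atom_over B a \<and> atom_vars a \<subseteq> patterns_over F (Loop ` {..<loops} \<union> range Arg)"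
  proof (cases "a \<in> closure_atoms")
    case True
    then show ?thesis using mono[of "Loop ` {..<loops}" "Loop ` {..<loops} \<union> range Arg"]
      by (auto simp: closure_atoms_def)
  next
    case nc: False
    show ?thesis
    proof (cases t)
      case None
      then obtain f i where f: "f \<in> F" "i < fst f"
        "a = Eq (f, (map Loop [0..<fst f])[i := Arg 0]) (f, (map Loop [0..<fst f])[i := Arg 1])"
        using assms nc by (auto simp: patterns_def equality_atoms_def)
      have "set ((map Loop [0..<fst f])[i := Arg j]) \<subseteq> Loop ` {..<loops} \<union> range Arg" for j
      proof -
        have "set ((map Loop [0..<fst f])[i := Arg j]) \<subseteq> insert (Arg j) (set (map Loop [0..<fst f]))"
          by (rule set_update_subset_insert)
        also have "\<dots> \<subseteq> Loop ` {..<loops} \<union> range Arg"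
          using fst_le_loops[OF f(1)] by auto
        finally show ?thesis .
      qed
      then show ?thesis using f(1) by (auto simp: f(3) patterns_over_def tuples_def)
    next
      case (Some R)
      then have R: "R \<in> sig \<D>" "a = (SOME a. expresses R a)"
        using assms nc by (auto simp: patterns_def split: if_splits)
      then have "expresses R a" using expresses_some by simp
      then show ?thesis using mono[of "Arg ` {..<arity \<D> R}" "Loop ` {..<loops} \<union> range Arg"]
        by (auto simp: expresses_def)
    qed
  qed
  then show "atom_over B a" "atom_vars a \<subseteq> patterns_over F (Loop ` {..<loops} \<union> range Arg)" by auto
qed

lemma finite_patterns: "finite (patterns t)"
proof -
  have "finite closure_atoms"
    by (rule finite_subset[OF _ finite_atoms[of B "patterns_over F (Loop ` {..<loops})"]])
       (use finite_B in \<open>auto simp: closure_atoms_def finite_structure_def intro: finite_patterns_over finite_F\<close>)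
  moreover have "finite {(f, i). f \<in> F \<and> i < fst f}"
    by (rule finite_subset[of _ "Sigma F (\<lambda>f. {..<fst f})"]) (auto simp: finite_F)
  ultimately show ?thesis
    by (auto simp: patterns_def equality_atoms_def split: option.split)
qed

section \<open>The atoms of the image and their patterns\<close>

definition constraints :: "name wedge_formula \<Rightarrow> ('d, 'b) application atom set" where
  "constraints \<phi> = {map_atom (instantiate (with_loops loops w (env a))) p |a w p.
     a \<in> set \<phi> \<and> (\<forall>i<loops. w i \<in> formula_vars \<phi>) \<and> p \<in> patterns (symbol a)}"

lemma env_Arg: "j < length (args a) \<Longrightarrow> env a (Arg j) = args a ! j"
  by (simp add: env_def)

lemma env_in_vars:
  "a \<in> set \<phi> \<Longrightarrow> j < length (args a) \<Longrightarrow> env a (Arg j) \<in> formula_vars \<phi>"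
  using nth_mem[of j "args a"] by (auto simp: env_Arg formula_vars_def args_vars)

lemma pattern_instance:
  assumes "formula_over \<D> \<phi>" "a \<in> set \<phi>" "p \<in> patterns (symbol a)" "q \<in> atom_vars p"
    "\<And>i. i < loops \<Longrightarrow> w i \<in> formula_vars \<phi>"
  shows "instantiate (with_loops loops w (env a)) q \<in> applications (formula_vars \<phi>) F"
proof -
  let ?\<rho> = "with_loops loops w (env a)"
  have over: "atom_over \<D> a" using assms(1,2) by (auto simp: formula_over_def)
  have "q \<in> patterns_over F (Loop ` {..<loops} \<union> Arg ` {..<length (args a)})"
  proof (cases "p \<in> closure_atoms")
    case True
    then show ?thesis using assms(4) by (auto simp: closure_atoms_def patterns_over_def tuples_def)
  next
    case nc: False
    show ?thesis
    proof (cases a)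
      case (Rel R vs)
      then have R: "R \<in> sig \<D>" "length vs = arity \<D> R" using over by auto
      then have "expresses R p" using assms(3) nc expresses_some Rel by (auto simp: patterns_def)
      then show ?thesis using assms(4) R Rel by (auto simp: expresses_def patterns_over_def tuples_def)
    next
      case (Eq u v)
      then obtain f i where f: "f \<in> F" "i < fst f"
        "p = Eq (f, (map Loop [0..<fst f])[i := Arg 0]) (f, (map Loop [0..<fst f])[i := Arg 1])"
        using assms(3) nc by (auto simp: patterns_def equality_atoms_def)
      have "set ((map Loop [0..<fst f])[i := Arg j]) \<subseteq> Loop ` {..<loops} \<union> Arg ` {..<2}" if "j < 2" for j
      proof -
        have "set ((map Loop [0..<fst f])[i := Arg j]) \<subseteq> insert (Arg j) (set (map Loop [0..<fst f]))"
          by (rule set_update_subset_insert)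
        also have "\<dots> \<subseteq> Loop ` {..<loops} \<union> Arg ` {..<2}"
          using fst_le_loops[OF f(1)] that by auto
        finally show ?thesis .
      qed
      from this[of 0] this[of 1] show ?thesis
        using f(1) assms(4) Eq by (auto simp: f(3) patterns_over_def tuples_def numeral_2_eq_2)
    qed
  qed
  then show ?thesis
  proof (rule instantiate_in)
    fix r assume "r \<in> Loop ` {..<loops} \<union> Arg ` {..<length (args a)}"
    then show "?\<rho> r \<in> formula_vars \<phi>"
      using assms(5) env_in_vars[OF assms(2)] by auto
  qed
qed

lemma constraints_over:
  assumes "formula_over \<D> \<phi>" "c \<in> constraints \<phi>"
  shows "atom_over B c" "atom_vars c \<subseteq> applications (formula_vars \<phi>) F"
  using assms patterns_over(1) pattern_instance by (auto simp: constraints_def)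

lemma sat_instance:
  assumes "formula_over \<D> \<phi>" "a \<in> set \<phi>" "p \<in> patterns (symbol a)" "\<And>i. i < loops \<Longrightarrow> w i \<in> formula_vars \<phi>"
  shows "sat_atom B (app_map (formula_vars \<phi>) F g) (map_atom (instantiate (with_loops loops w (env a))) p) \<longleftrightarrow>
    sat_atom B (pattern_value (g \<circ> with_loops loops w (env a))) p"
  unfolding sat_atom_map
  by (rule sat_atom_cong) (simp add: app_map_eq pattern_instance[OF assms(1-3) _ assms(4)] apply_at_instantiate)

text \<open>Replace each variable of the atom by the loop register of its first occurrence. Equal
  variables share a register, so every register assignment \<open>g\<close> induces the map
  \<open>g \<circ> \<iota>\<close> on \<open>V\<close>, and validity of the atom passes to the
  pattern. Giving the registers their variables back restores the atom.\<close>

lemma valid_atom_instance: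
  assumes "atom_over B c" "atom_vars c \<subseteq> applications V F" "v0 \<in> V"
    "\<And>g. g \<in> V \<rightarrow>\<^sub>E D \<Longrightarrow> sat_atom B (app_map V F g) c"
  shows "\<exists>w p. (\<forall>i<loops. w i \<in> V) \<and> p \<in> closure_atoms \<and> (\<forall>\<rho>. c = map_atom (instantiate (with_loops loops w \<rho>)) p)"
proof -
  define xs where "xs = concat (map fst (args c))"
  \<comment> \<open>Loop registers beyond the occurrences of \<open>c\<close> still need a value in
    \<open>V\<close>.\<close>
  define w where "w = (\<lambda>i. if i < length xs then xs ! i else v0)"
  \<comment> \<open>Variables outside \<open>c\<close> go to register 0, which exists since
    \<open>loops\<close> is positive; this makes \<open>g \<circ> \<iota>\<close> a map from all of
    \<open>V\<close> into \<open>D\<close>.\<close>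
  define \<iota> where "\<iota> = (\<lambda>v. Loop (if v \<in> set xs then position xs v else 0))"
  define p where "p = map_atom (\<lambda>(vs, f). (f, map \<iota> vs)) c"
  have app: "\<alpha> \<in> applications V F" "set (fst \<alpha>) \<subseteq> set xs" if "\<alpha> \<in> atom_vars c" for \<alpha>
    using that assms(2) by (auto simp: xs_def args_vars)
  have len: "length xs \<le> (\<Sum>f\<in>F. fst f) * length (args c)"
  proof -
    have "length (fst \<alpha>) \<le> (\<Sum>f\<in>F. fst f)" if "\<alpha> \<in> set (args c)" for \<alpha>
      using app(1)[of \<alpha>] that fst_le by (fastforce simp: args_vars applications_def tuples_def)
    then have "(\<Sum>\<alpha>\<leftarrow>args c. length (fst \<alpha>)) \<le> (\<Sum>\<alpha>\<leftarrow>args c. \<Sum>f\<in>F. fst f)" by (rule sum_list_mono)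
    then show ?thesis by (simp add: xs_def length_concat o_def sum_list_triv mult.commute)
  qed
  also have "\<dots> \<le> (\<Sum>f\<in>F. fst f) * (2 + (\<Sum>R\<in>sig B. arity B R))"
  proof -
    have "length (args c) \<le> 2 + (\<Sum>R\<in>sig B. arity B R)"
    proof (cases c)
      case (Rel R \<alpha>s)
      then have "R \<in> sig B" "length \<alpha>s = arity B R" using assms(1) by auto
      moreover from this(1) have "arity B R \<le> (\<Sum>R\<in>sig B. arity B R)"
        using finite_B by (intro member_le_sum) (auto simp: finite_structure_def)
      ultimately show ?thesis using Rel by simp
    qed simp
    then show ?thesis by (rule mult_le_mono2)
  qed
  finally have len: "length xs < loops" by (simp add: loops_def mult.commute)
  have xs_V: "set xs \<subseteq> V"
    using app(1) by (fastforce simp: xs_def args_vars applications_def tuples_def)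
  have w_V: "w i \<in> V" for i
    using xs_V assms(3) by (auto simp: w_def)
  have \<iota>_loop: "\<iota> v \<in> Loop ` {..<loops}" for v
    using position(1)[of v xs] len by (auto simp: \<iota>_def)
  have \<iota>_inv: "with_loops loops w \<rho> (\<iota> v) = v" if "v \<in> set xs" for v \<rho>
    using position[OF that] len that by (simp add: \<iota>_def w_def)
  have c_eq: "c = map_atom (instantiate (with_loops loops w \<rho>)) p" for \<rho>
  proof -
    have "map_atom (instantiate (with_loops loops w \<rho>) \<circ> (\<lambda>(vs, f). (f, map \<iota> vs))) c = c"
    proof (rule map_atom_id)
      fix \<alpha> assume \<alpha>: "\<alpha> \<in> atom_vars c"
      obtain vs f where vs: "\<alpha> = (vs, f)" by (cases \<alpha>)
      with app(2)[OF \<alpha>] have "map (\<lambda>v. with_loops loops w \<rho> (\<iota> v)) vs = vs"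
        by (intro map_idI \<iota>_inv) auto
      then show "(instantiate (with_loops loops w \<rho>) \<circ> (\<lambda>(vs, f). (f, map \<iota> vs))) \<alpha> = \<alpha>"
        by (simp add: vs instantiate_def o_def)
    qed
    then show ?thesis by (simp add: p_def atom.map_comp)
  qed
  have "p \<in> closure_atoms"
  proof -
    have "atom_over B p" using assms(1) by (simp add: p_def)
    moreover have "atom_vars p \<subseteq> patterns_over F (Loop ` {..<loops})"
    proof
      fix q assume "q \<in> atom_vars p"
      then obtain \<alpha> where \<alpha>: "\<alpha> \<in> atom_vars c" "q = (\<lambda>(vs, f). (f, map \<iota> vs)) \<alpha>" by (auto simp: p_def)
      then show "q \<in> patterns_over F (Loop ` {..<loops})"
        using app(1)[OF \<alpha>(1)] \<iota>_loop by (auto simp: patterns_over_def applications_def tuples_def)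
    qed
    moreover have "sat_atom B (pattern_value g) p" if g: "\<forall>i<loops. g (Loop i) \<in> D" for g
    proof -
      define g' where "g' = (\<lambda>v\<in>V. g (\<iota> v))"
      have "g (\<iota> v) \<in> D" for v using g \<iota>_loop[of v] by auto
      then have "g' \<in> V \<rightarrow>\<^sub>E D" by (simp add: g'_def)
      from assms(4)[OF this] have "sat_atom B (app_map V F g') c" .
      also have "sat_atom B (app_map V F g') c \<longleftrightarrow> sat_atom B (pattern_value g \<circ> (\<lambda>(vs, f). (f, map \<iota> vs))) c"
      proof (rule sat_atom_cong)
        fix \<alpha> assume \<alpha>: "\<alpha> \<in> atom_vars c"
        obtain vs k f where vs: "\<alpha> = (vs, k, f)" by (cases \<alpha>)
        have m: "map g' vs = map (g \<circ> \<iota>) vs"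
          using app[OF \<alpha>] xs_V by (intro map_cong) (auto simp: vs g'_def)
        show "app_map V F g' \<alpha> = (pattern_value g \<circ> (\<lambda>(vs, f). (f, map \<iota> vs))) \<alpha>"
          unfolding app_map_eq[OF app(1)[OF \<alpha>]] by (simp add: vs apply_at_def pattern_value_def m)
      qed
      finally show ?thesis by (simp add: p_def sat_atom_map)
    qed
    ultimately show ?thesis by (simp add: closure_atoms_def)
  qed
  with w_V c_eq show ?thesis by blast
qed

lemma finite_vars: "finite (formula_vars (\<phi> :: name wedge_formula))"
proof -
  have "finite (atom_vars a)" for a :: "name atom" by (cases a) auto
  then show ?thesis by (simp add: formula_vars_def)
qed

lemma arity_pos: "R \<in> sig \<D> \<Longrightarrow> 1 \<le> arity \<D> R"
  using template by (simp add: induced_template_def induced_relation_def)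

lemma atom_vars_nonempty: "atom_over \<D> a \<Longrightarrow> atom_vars a \<noteq> {}"
  using arity_pos by (cases a) force+

section \<open>Solutions of the formula and of the constraints\<close>

lemma app_map_in:
  assumes "g \<in> V \<rightarrow>\<^sub>E D"
  shows "app_map V F g \<in> applications V F \<rightarrow>\<^sub>E univ B"
proof -
  have "apply_at \<alpha> g \<in> univ B" if "\<alpha> \<in> applications V F" for \<alpha>
  proof -
    obtain vs k f where \<alpha>: "\<alpha> = (vs, k, f)" by (cases \<alpha>)
    have "set (map g vs) \<subseteq> D" using that assms by (auto simp: \<alpha> applications_def tuples_def)
    with that F_map[of "(k, f)" "map g vs"] show ?thesis
      by (simp add: \<alpha> applications_def tuples_def apply_at_def)
  qed
  then show ?thesis by (auto simp: app_map_def)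
qed

text \<open>The map t[g] is the witness: closure atoms hold in it by validity, an expressing atom
  because \<open>g\<close> satisfies the relation, and an equality atom because both sides of the
  equation have the same value under \<open>g\<close>.\<close>

lemma satisfiable_imp:
  assumes "formula_over \<D> \<phi>" "g \<in> formula_vars \<phi> \<rightarrow>\<^sub>E D" "sat \<D> g \<phi>" "c \<in> constraints \<phi>"
  shows "sat_atom B (app_map (formula_vars \<phi>) F g) c"
proof -
  obtain a w p where c: "c = map_atom (instantiate (with_loops loops w (env a))) p" "a \<in> set \<phi>"
    "\<And>i. i < loops \<Longrightarrow> w i \<in> formula_vars \<phi>" "p \<in> patterns (symbol a)"
    using assms(4) unfolding constraints_def by blast
  let ?g = "g \<circ> with_loops loops w (env a)"
  have over: "atom_over \<D> a" and sat: "sat_atom \<D> g a"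
    using assms(1,3) c(2) by (auto simp: formula_over_def sat_def)
  have "sat_atom B (pattern_value ?g) p"
  proof (cases "p \<in> closure_atoms")
    case True
    moreover have "?g (Loop i) \<in> D" if "i < loops" for i
      using c(3)[OF that] assms(2) that by auto
    ultimately show ?thesis unfolding closure_atoms_def by blast
  next
    case nc: False
    show ?thesis
    proof (cases a)
      case (Rel R vs)
      then have R: "R \<in> sig \<D>" "length vs = arity \<D> R" using over by auto
      then have "expresses R p" using c(4) nc expresses_some Rel by (auto simp: patterns_def)
      moreover have "?g (Arg j) \<in> D" if "j < arity \<D> R" for j
        using env_in_vars[OF c(2), of j] that R Rel assms(2) by auto
      moreover have "map (\<lambda>j. ?g (Arg j)) [0..<arity \<D> R] = map g vs"
        using R Rel by (intro nth_equalityI) (auto simp: env_Arg)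
      ultimately show ?thesis using sat Rel by (auto simp: expresses_def)
    next
      case (Eq u v)
      then obtain f i where f: "f \<in> F" "i < fst f"
        "p = Eq (f, (map Loop [0..<fst f])[i := Arg 0]) (f, (map Loop [0..<fst f])[i := Arg 1])"
        using c(4) nc by (auto simp: patterns_def equality_atoms_def)
      have "?g (Arg 0) = ?g (Arg 1)"
        using sat Eq by (simp add: env_Arg)
      then show ?thesis by (simp add: f(3) pattern_value_def map_update del: map_map)
    qed
  qed
  then show ?thesis
    unfolding c(1) by (subst sat_instance[OF assms(1) c(2,4,3)])
qed

text \<open>Automorphisms reflect relations and, being injective, equations. The automorphism that
  surjective closedness supplies can therefore be stripped off.\<close>

lemma sat_automorphism:
  assumes "automorphism B \<gamma>" "atom_over B c" "atom_vars c \<subseteq> A" "t \<in> A \<rightarrow>\<^sub>E univ B"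
    "sat_atom B (compose A \<gamma> t) c"
  shows "sat_atom B t c"
proof (cases c)
  case (Rel R \<alpha>s)
  have m: "map (compose A \<gamma> t) \<alpha>s = map \<gamma> (map t \<alpha>s)"
    using assms(3) Rel by (auto simp: compose_def)
  have "map \<gamma> (map t \<alpha>s) \<in> interp B R" using assms(5) unfolding Rel sat_atom.simps m .
  moreover have "map t \<alpha>s \<in> tuples (univ B) (arity B R)"
    using assms(2,3,4) Rel by (auto simp: tuples_def)
  moreover have "R \<in> sig B" using assms(2) Rel by simp
  ultimately show ?thesis using assms(1) unfolding automorphism_def Rel sat_atom.simps by blast
next
  case (Eq \<alpha> \<beta>)
  then have "\<gamma> (t \<alpha>) = \<gamma> (t \<beta>)" "t \<alpha> \<in> univ B" "t \<beta> \<in> univ B"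
    using assms(3,4,5) by (auto simp: compose_def)
  moreover have "inj_on \<gamma> (univ B)" using assms(1) by (simp add: automorphism_def bij_betw_def)
  ultimately show ?thesis using Eq by (simp add: inj_on_def)
qed

text \<open>
  Equality on \<open>D\<close> need not be expressible. Variables that no map of \<open>F\<close> can distinguish are therefore
  given a common value, which changes the value of no application.
\<close>

lemma imp_satisfiable:
  assumes over: "formula_over \<D> \<phi>" and ne: "\<phi> \<noteq> []"
    and g: "g \<in> formula_vars \<phi> \<rightarrow>\<^sub>E D" and sat: "\<And>c. c \<in> constraints \<phi> \<Longrightarrow> sat_atom B (app_map (formula_vars \<phi>) F g) c"
  shows "\<exists>g \<in> formula_vars \<phi> \<rightarrow>\<^sub>E D. sat \<D> g \<phi>"
proof -
  let ?V = "formula_vars \<phi>"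
  obtain v0 where v0: "v0 \<in> ?V"
  proof -
    obtain a where a: "a \<in> set \<phi>" using ne by (cases \<phi>) auto
    then have "atom_vars a \<noteq> {}" using over by (intro atom_vars_nonempty) (auto simp: formula_over_def)
    with a that show ?thesis by (auto simp: formula_vars_def)
  qed
  \<comment> \<open>Records how \<open>u\<close> acts at a single position of an application under
    \<open>g\<close>, for all fillings \<open>ws\<close> of the other positions. Variables with the
    same record may replace each other one position at a time.\<close>
  define behaviour where "behaviour = (\<lambda>u (f, i, ws).
    if f \<in> F \<and> i < fst f \<and> ws \<in> tuples ?V (fst f) then Some (snd f (map g (ws[i := u]))) else None)"
  define rep where "rep = (\<lambda>u. SOME v. v \<in> ?V \<and> behaviour v = behaviour u)"
  define g' where "g' = (\<lambda>u\<in>?V. g (rep u))"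
  have rep: "rep u \<in> ?V" "behaviour (rep u) = behaviour u" if "u \<in> ?V" for u
    using someI[of "\<lambda>v. v \<in> ?V \<and> behaviour v = behaviour u" u] that by (auto simp: rep_def)
  have g'_in: "g' \<in> ?V \<rightarrow>\<^sub>E D" using g rep(1) by (auto simp: g'_def)
  have app_eq: "apply_at \<alpha> g' = apply_at \<alpha> g" if "\<alpha> \<in> applications ?V F" for \<alpha>
  proof -
    obtain vs k f where \<alpha>: "\<alpha> = (vs, k, f)" by (cases \<alpha>)
    have f: "(k, f) \<in> F" "set vs \<subseteq> ?V" "length vs = k"
      using that by (auto simp: \<alpha> applications_def tuples_def)
    \<comment> \<open>Representatives are inserted from the left, one position per step; each step
      is an equality of behaviours at position \<open>j\<close>.\<close>
    have "f (map g (map rep (take j vs) @ drop j vs)) = f (map g vs)" if "j \<le> k" for j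
      using that
    proof (induction j)
      case (Suc j)
      let ?X = "map rep (take j vs) @ drop j vs"
      have j: "j < length vs" using Suc.prems f by simp
      have "set ?X \<subseteq> ?V"
        using f(2) rep(1) set_take_subset[of j vs] set_drop_subset[of j vs] by auto
      then have X: "?X \<in> tuples ?V k" using f(3) by (auto simp: tuples_def)
      have "vs ! j \<in> ?V" using f(2) j by auto
      then have "behaviour (rep (vs ! j)) ((k, f), j, ?X) = behaviour (vs ! j) ((k, f), j, ?X)"
        using rep(2) by simp
      then have "f (map g (?X[j := rep (vs ! j)])) = f (map g (?X[j := vs ! j]))"
        using f(1) X j f(3) by (simp add: behaviour_def del: list_update_append)
      moreover have "?X[j := vs ! j] = ?X"
        using j by (simp add: list_update_append upd_conv_take_nth_drop Cons_nth_drop_Suc[symmetric])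
      moreover have "?X[j := rep (vs ! j)] = map rep (take (Suc j) vs) @ drop (Suc j) vs"
        using j by (simp add: list_update_append take_Suc_conv_app_nth Cons_nth_drop_Suc[symmetric])
      ultimately show ?case using Suc by simp
    qed simp
    from this[of k] have "f (map g (map rep vs)) = f (map g vs)" using f(3) by simp
    moreover have "map g' vs = map g (map rep vs)" using f(2) by (auto simp: g'_def)
    ultimately show ?thesis unfolding \<alpha> apply_at_def split_conv by metis
  qed
  have "sat_atom \<D> g' a" if a: "a \<in> set \<phi>" for a
  proof (cases a)
    case (Rel R vs)
    then have R: "R \<in> sig \<D>" "length vs = arity \<D> R" using over a by (auto simp: formula_over_def)
    let ?p = "SOME a. expresses R a"
    \<comment> \<open>The expressing atom mentions argument registers only, so the loop registers
      may hold any variable.\<close>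
    let ?\<rho> = "with_loops loops (\<lambda>_. v0) (env a)"
    have ex: "expresses R ?p" by (rule expresses_some[OF R(1)])
    have p: "?p \<in> patterns (symbol a)" using Rel R by (simp add: patterns_def)
    have "map_atom (instantiate ?\<rho>) ?p \<in> constraints \<phi>"
      unfolding constraints_def using a p v0 by blast
    then have "sat_atom B (app_map ?V F g) (map_atom (instantiate ?\<rho>) ?p)" by (rule sat)
    moreover have "app_map ?V F g = app_map ?V F g'"
      using app_eq by (auto simp: app_map_def)
    ultimately have s: "sat_atom B (pattern_value (g' \<circ> ?\<rho>)) ?p"
      using sat_instance[OF over a p, of "\<lambda>_. v0" g'] v0 by simp
    have d: "(g' \<circ> ?\<rho>) (Arg j) \<in> D" if "j < arity \<D> R" for j
      using env_in_vars[OF a, of j] that R Rel g'_in by auto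
    have m: "map (\<lambda>j. (g' \<circ> ?\<rho>) (Arg j)) [0..<arity \<D> R] = map g' vs"
      using R Rel by (intro nth_equalityI) (auto simp: env_Arg)
    have "map (\<lambda>j. (g' \<circ> ?\<rho>) (Arg j)) [0..<arity \<D> R] \<in> interp \<D> R"
      using ex d s unfolding expresses_def by blast
    then have "map g' vs \<in> interp \<D> R" unfolding m .
    then show ?thesis using Rel by simp
  next
    case (Eq u v)
    have uv: "u \<in> ?V" "v \<in> ?V" using a Eq by (force simp: formula_vars_def)+
    have "behaviour u x = behaviour v x" for x
    proof (cases x)
      case (fields f i ws)
      show ?thesis
      proof (cases "f \<in> F \<and> i < fst f \<and> ws \<in> tuples ?V (fst f)")
        case True
        \<comment> \<open>The loop registers supply the entries of \<open>ws\<close>, with position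
          \<open>i\<close> taken over by an argument register; beyond the arity any variable of
          \<phi> will do.\<close>
        define w where "w = (\<lambda>j. if j < fst f then ws ! j else v0)"
        have w: "w j \<in> ?V" for j using True v0 by (auto simp: w_def tuples_def)
        let ?p = "Eq (f, (map Loop [0..<fst f])[i := Arg 0]) (f, (map Loop [0..<fst f])[i := Arg 1])"
        let ?\<rho> = "with_loops loops w (env a)"
        have p: "?p \<in> patterns (symbol a)"
          using True Eq by (force simp: patterns_def equality_atoms_def)
        have "map_atom (instantiate ?\<rho>) ?p \<in> constraints \<phi>"
          unfolding constraints_def using a p w by blast
        then have "sat_atom B (app_map ?V F g) (map_atom (instantiate ?\<rho>) ?p)" by (rule sat)
        then have s: "sat_atom B (pattern_value (g \<circ> ?\<rho>)) ?p"
          using sat_instance[OF over a p, of w g] w by simp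
        have inst: "map ?\<rho> ((map Loop [0..<fst f])[i := Arg j]) = ws[i := args a ! j]" if "j < length (args a)" for j
        proof -
          have "map ?\<rho> (map Loop [0..<fst f]) = ws"
            using True fst_le_loops[of f] by (intro nth_equalityI) (auto simp: w_def tuples_def)
          then show ?thesis using that by (simp add: map_update env_Arg del: map_map)
        qed
        have "snd f (map g (ws[i := args a ! 0])) = snd f (map g (ws[i := args a ! 1]))"
          using s inst[of 0] inst[of 1] Eq by (simp add: pattern_value_def flip: map_map)
        then show ?thesis using True Eq by (simp add: fields behaviour_def)
      qed (auto simp add: fields behaviour_def)
    qed
    then have "behaviour u = behaviour v" by blast
    \<comment> \<open>The choice in \<open>rep\<close> depends on a variable only through its
      behaviour, so the choices coincide.\<close>
    then have "rep u = rep v" by (simp add: rep_def)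
    then show ?thesis using Eq uv by (simp add: g'_def)
  qed
  then show ?thesis using g'_in by (auto simp: sat_def)
qed

text \<open>Stability serves both directions: every t[g] is surjective, and every surjective map in
  the closure comes from some t[g]. It applies because a non-empty \<phi> has a variable, all
  arities being positive.\<close>

theorem satisfiable_iff:
  assumes "formula_over \<D> \<phi>" "\<phi> \<noteq> []"
  defines "A \<equiv> applications (formula_vars \<phi>) F"
  shows "(\<exists>g \<in> formula_vars \<phi> \<rightarrow>\<^sub>E univ \<D>. sat \<D> g \<phi>) \<longleftrightarrow>
    (\<exists>h \<in> A \<rightarrow>\<^sub>E univ B. h ` A = univ B \<and> (\<forall>c\<in>constraints \<phi>. sat_atom B h c))"
proof -
  let ?V = "formula_vars \<phi>"
  obtain a0 where a0: "a0 \<in> set \<phi>" using assms(2) by (cases \<phi>) auto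
  then have "atom_vars a0 \<noteq> {}" using assms(1) by (intro atom_vars_nonempty) (auto simp: formula_over_def)
  with a0 obtain v0 where v0: "v0 \<in> ?V" by (auto simp: formula_vars_def)
  have stable_V: "\<And>t. t \<in> app_maps ?V D F \<Longrightarrow> t ` A = univ B" "surjectively_closed B A (app_maps ?V D F)"
    using stable finite_vars v0 unfolding F_stable_def A_def by blast+
  show ?thesis
  proof
    assume "\<exists>g \<in> ?V \<rightarrow>\<^sub>E univ \<D>. sat \<D> g \<phi>"
    then obtain g where g: "g \<in> ?V \<rightarrow>\<^sub>E D" "sat \<D> g \<phi>" by (auto simp: univ_D)
    then show "\<exists>h \<in> A \<rightarrow>\<^sub>E univ B. h ` A = univ B \<and> (\<forall>c\<in>constraints \<phi>. sat_atom B h c)"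
      using app_map_in[OF g(1)] stable_V(1)[of "app_map ?V F g"] satisfiable_imp[OF assms(1) g]
      unfolding A_def by (intro bexI[of _ "app_map ?V F g"]) (auto simp: app_maps_def)
  next
    assume "\<exists>h \<in> A \<rightarrow>\<^sub>E univ B. h ` A = univ B \<and> (\<forall>c\<in>constraints \<phi>. sat_atom B h c)"
    then obtain h where h: "h \<in> A \<rightarrow>\<^sub>E univ B" "h ` A = univ B" "\<And>c. c \<in> constraints \<phi> \<Longrightarrow> sat_atom B h c"
      by blast
    have T: "app_maps ?V D F \<subseteq> A \<rightarrow>\<^sub>E univ B"
      using app_map_in by (auto simp: app_maps_def A_def)
    have fin: "finite A" unfolding A_def by (intro finite_applications finite_vars finite_F)
    note closure = wedge_closure_least[OF finite_B fin T]
    obtain \<chi> where \<chi>: "formula_over B \<chi>" "formula_vars \<chi> \<subseteq> A"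
      "wedge_closure B A (app_maps ?V D F) = {h \<in> A \<rightarrow>\<^sub>E univ B. sat B h \<chi>}"
      using closure(1) unfolding wedge_definable_def by blast
    have T_\<chi>: "sat B t \<chi>" if "t \<in> app_maps ?V D F" for t
    proof -
      have "t \<in> wedge_closure B A (app_maps ?V D F)" unfolding closure(2) using that by blast
      with \<chi>(3) show ?thesis by blast
    qed
    \<comment> \<open>Each atom of the defining formula holds throughout T_V, so it is an instance
      of a closure pattern and belongs to the constraints; hence \<open>h\<close> lies in the
      closure.\<close>
    have "sat_atom B h c" if "c \<in> set \<chi>" for c
    proof -
      have "\<exists>w p. (\<forall>i<loops. w i \<in> ?V) \<and> p \<in> closure_atoms \<and> (\<forall>\<rho>. c = map_atom (instantiate (with_loops loops w \<rho>)) p)"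
        using \<chi>(1,2) that T_\<chi> v0 unfolding A_def
        by (intro valid_atom_instance) (auto simp: formula_over_def formula_vars_def sat_def app_maps_def)
      \<comment> \<open>The instance is the same for every environment, so that of an arbitrary atom
        of \<phi> can be inserted.\<close>
      then obtain w p where "\<forall>i<loops. w i \<in> ?V" "p \<in> closure_atoms"
        "c = map_atom (instantiate (with_loops loops w (env a0))) p" by blast
      then have "c \<in> constraints \<phi>" unfolding constraints_def patterns_def using a0 by blast
      then show ?thesis by (rule h(3))
    qed
    then have "h \<in> wedge_closure B A (app_maps ?V D F)" using \<chi>(3) h(1) by (simp add: sat_def)
    then obtain \<gamma> t where t: "automorphism B \<gamma>" "t \<in> app_maps ?V D F" "h = compose A \<gamma> t"
      using stable_V(2) h(2) unfolding surjectively_closed_def by blast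
    then obtain g where g: "g \<in> ?V \<rightarrow>\<^sub>E D" "t = app_map ?V F g" by (auto simp: app_maps_def)
    have "sat_atom B t c" if "c \<in> constraints \<phi>" for c
      using sat_automorphism[OF t(1) constraints_over[OF assms(1) that, folded A_def], of t] h(3)[OF that] t(2,3) T
      by blast
    with imp_satisfiable[OF assms(1,2) g(1)] show "\<exists>g \<in> ?V \<rightarrow>\<^sub>E univ \<D>. sat \<D> g \<phi>"
      by (simp add: g(2) univ_D)
  qed
qed

end

section \<open>The reduction as a transducer\<close>

text \<open>The code of a name without its end marker. Unlike \<open>code_name\<close> it respects
  concatenation, so the code of a composite name can be written piece by piece.\<close>

definition dbl :: "bool list \<Rightarrow> bool list" where
  "dbl xs = concat (map (\<lambda>b. [True, b]) xs)"

lemma code_name_dbl: "code_name n = dbl n @ [False]"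
  by (simp add: code_name_def code_list_def dbl_def)

lemma dbl_simps [simp]:
  "dbl [] = []" "dbl (b # xs) = True # b # dbl xs" "dbl (xs @ ys) = dbl xs @ dbl ys"
  by (simp_all add: dbl_def)

lemma dbl_code_name: "dbl (code_name n) = concat (map (\<lambda>b. [True, True, True, b]) n) @ [True, False]"
  by (induction n) simp_all

lemma occs_vars: "set (occs \<phi>) = formula_vars \<phi>"
  by (simp add: occs_def formula_vars_def args_vars)

context stable_template
begin

section \<open>Names of applications and output templates\<close>

definition index :: "('d, 'b) enc_map \<Rightarrow> name" where
  "index = (SOME i. inj_on i F)"

lemma inj_index: "inj_on index F"
proof -
  obtain i :: "('d, 'b) enc_map \<Rightarrow> nat" where "inj_on i F"
    using finite_imp_inj_to_nat_seg[OF finite_F] by blast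
  then have "inj_on (\<lambda>f. replicate (i f) True) F"
    by (auto simp: inj_on_def dest: arg_cong[of _ _ length])
  then show ?thesis unfolding index_def by (rule someI[of "\<lambda>i. inj_on i F"])
qed

text \<open>The variables enter reversed because registers hold and emit them in that order;
  injectivity is unaffected.\<close>

definition app_name :: "('d, 'b) application \<Rightarrow> name" where
  "app_name = (\<lambda>(vs, f). code_list code_name (index f # map rev vs))"

lemma inj_app_name: "inj_on app_name (applications V F)"
proof (rule inj_onI)
  fix \<alpha> \<beta> assume \<alpha>: "\<alpha> \<in> applications V F" "\<beta> \<in> applications V F" "app_name \<alpha> = app_name \<beta>"
  obtain vs f where f: "\<alpha> = (vs, f)" by (cases \<alpha>)
  obtain ws g where g: "\<beta> = (ws, g)" by (cases \<beta>)
  have "code_list code_name (index f # map rev vs) @ [] = code_list code_name (index g # map rev ws) @ []"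
    using \<alpha>(3) by (simp add: f g app_name_def)
  then have eq: "index f # map rev vs = index g # map rev ws"
    using prefix_codeD[OF prefix_code_list[OF prefix_code_name]] by blast
  have "f \<in> F" "g \<in> F" using \<alpha>(1,2) by (auto simp: f g applications_def)
  moreover have "index f = index g" using eq by simp
  ultimately have "f = g" using inj_index by (auto simp: inj_on_def)
  moreover have "map rev (map rev vs) = map rev (map rev ws)" using eq by simp
  ultimately show "\<alpha> = \<beta>" by (simp add: f g comp_def)
qed

text \<open>The name of an application is a coded list that is coded once more.
  \<open>[True, True]\<close> is a doubled list marker; the final bits are the doubled end marker of
  the list and then the end marker of the name.\<close>

definition pattern_items :: "('d, 'b) pattern \<Rightarrow> item list" where
  "pattern_items = (\<lambda>(f, rs). Bits (dbl (True # code_name (index f))) #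
     concat (map (\<lambda>r. [Bits [True, True], Name r]) rs) @ [Bits [True, False, False]])"

lemma pattern_items_string: "items_string (pattern_items p) \<rho> = code_name (app_name (instantiate \<rho> p))"
proof (cases p)
  case (Pair f rs)
  have *: "items_string (concat (map (\<lambda>r. [Bits [True, True], Name r]) rs) @ [Bits [True, False, False]]) \<rho>
      = dbl (code_list code_name (map (\<lambda>r. rev (\<rho> r)) rs)) @ [False]"
    by (induction rs) (simp_all add: dbl_code_name)
  have name: "app_name (instantiate \<rho> p) =
      True # code_name (index f) @ code_list code_name (map (\<lambda>r. rev (\<rho> r)) rs)"
    by (simp add: Pair app_name_def instantiate_def o_def)
  show ?thesis unfolding name code_name_dbl[of "True # _"]
    by (simp only: pattern_items_def Pair split_conv items_string_simps(2) item_string.simps(1) *) simp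
qed

text \<open>The first bit of either case is the list marker of the surrounding formula, the second
  the tag of the constructor.\<close>

fun atom_items :: "('d, 'b) pattern atom \<Rightarrow> item list" where
  "atom_items (Rel R ps) = Bits (True # True # code_name R) #
     concat (map (\<lambda>p. Bits [True] # pattern_items p) ps) @ [Bits [False]]"
| "atom_items (Eq p q) = Bits [True, False] # pattern_items p @ pattern_items q"

lemma atom_items_string:
  "items_string (atom_items a) \<rho> = True # code_atom (map_atom app_name (map_atom (instantiate \<rho>) a))"
proof (cases a)
  case (Rel R ps)
  have "items_string (concat (map (\<lambda>p. Bits [True] # pattern_items p) ps) @ [Bits [False]]) \<rho>
      = code_list code_name (map app_name (map (instantiate \<rho>) ps))"
    by (induction ps) (simp_all add: pattern_items_string)
  then show ?thesis by (simp add: Rel)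
qed (simp add: pattern_items_string)

definition map_list :: "('d, 'b) enc_map list" where
  "map_list = (SOME l. set l = F)"

definition pattern_list :: "name option \<Rightarrow> ('d, 'b) pattern atom list" where
  "pattern_list t = (SOME l. set l = patterns t)"

lemma set_map_list: "set map_list = F"
  unfolding map_list_def using finite_list[OF finite_F] by (rule someI_ex)

lemma set_pattern_list: "set (pattern_list t) = patterns t"
  unfolding pattern_list_def using finite_list[OF finite_patterns] by (rule someI_ex)

text \<open>Over all choices in the loops, its instances are precisely the applications of
  \<open>f\<close>.\<close>

definition loop_pattern :: "('d, 'b) enc_map \<Rightarrow> ('d, 'b) pattern" where
  "loop_pattern f = (f, map Loop [0..<fst f])"

definition vars_items :: "item list" where
  "vars_items = concat (map (\<lambda>f. Bits [True] # pattern_items (loop_pattern f)) map_list)"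

definition form_items :: "name option \<Rightarrow> item list" where
  "form_items t = concat (map atom_items (pattern_list t))"

text \<open>The answer to the empty formula, which the empty map satisfies even for empty
  \<open>D\<close>. With as many variables as \<open>B\<close> has elements and no atoms, any
  bijection is a surjective solution.\<close>

definition positive_instance :: "bool list" where
  "positive_instance = code_instance (map (\<lambda>i. replicate i True) [0..<card (univ B)]) []"

lemma pattern_items_ok: "set (snd p) \<subseteq> value_regs \<Longrightarrow> i \<in> set (pattern_items p) \<Longrightarrow> item_ok i"
  by (cases p) (auto simp: pattern_items_def split: if_splits)

sublocale transducer \<D> vars_items form_items loops positive_instance
proof
  show "finite (sig \<D>)" using finite_\<D> by (simp add: finite_structure_def)
  show "1 \<le> arity \<D> R" if "R \<in> sig \<D>" for R using that by (rule arity_pos)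
  show "\<forall>i\<in>set vars_items. item_ok i"
  proof
    fix i assume "i \<in> set vars_items"
    then obtain f where "i = Bits [True] \<or> i \<in> set (pattern_items (loop_pattern f))"
      by (auto simp: vars_items_def split: if_splits)
    moreover have "set (snd (loop_pattern f)) \<subseteq> value_regs" by (auto simp: loop_pattern_def)
    ultimately show "item_ok i" using pattern_items_ok[of "loop_pattern f" i] by auto
  qed
  show "\<forall>i\<in>set (form_items t). item_ok i" for t
  proof
    fix i assume "i \<in> set (form_items t)"
    then obtain a where a: "a \<in> patterns t" "i \<in> set (atom_items a)"
      by (auto simp: form_items_def set_pattern_list)
    have *: "set (snd p) \<subseteq> value_regs" if "p \<in> atom_vars a" for p
    proof -
      have "p \<in> patterns_over F (Loop ` {..<loops} \<union> range Arg)"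
        using patterns_over(2)[OF a(1)] that by blast
      then show ?thesis by (auto simp: patterns_over_def tuples_def value_regs_def)
    qed
    then have ok: "item_ok j" if "p \<in> atom_vars a" "j \<in> set (pattern_items p)" for p j
      using pattern_items_ok that by blast
    show "item_ok i"
    proof (cases a)
      case (Rel R ps)
      with a(2) have "i \<in> range Bits \<or> (\<exists>p\<in>set ps. i \<in> set (pattern_items p))"
        by (auto split: if_splits)
      with ok Rel show ?thesis by auto
    next
      case (Eq p q)
      with a(2) have "i \<in> range Bits \<or> i \<in> set (pattern_items p) \<or> i \<in> set (pattern_items q)" by auto
      with ok[of p i] ok[of q i] Eq show ?thesis by auto
    qed
  qed
qed

section \<open>The image instance and the reduction\<close>

definition image_vars :: "name wedge_formula \<Rightarrow> name list" where
  "image_vars \<phi> = concat (map (\<lambda>a. gen (occs \<phi>)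
     (\<lambda>\<rho>. map (\<lambda>f. app_name (instantiate \<rho> (loop_pattern f))) map_list) loops (env a)) \<phi>)"

definition image_formula :: "name wedge_formula \<Rightarrow> name wedge_formula" where
  "image_formula \<phi> = concat (map (\<lambda>a. gen (occs \<phi>)
     (\<lambda>\<rho>. map (\<lambda>p. map_atom app_name (map_atom (instantiate \<rho>) p)) (pattern_list (symbol a))) loops (env a)) \<phi>)"

lemma result_eq:
  assumes "\<phi> \<noteq> []"
  shows "result \<phi> = code_instance (image_vars \<phi>) (image_formula \<phi>)"
proof -
  have "items_string vars_items = (\<lambda>\<rho>. concat (map (\<lambda>n. True # code_name n)
      (map (\<lambda>f. app_name (instantiate \<rho> (loop_pattern f))) map_list)))"
  proof
    fix \<rho>
    have "items_string (concat (map (\<lambda>f. Bits [True] # pattern_items (loop_pattern f)) fs)) \<rho> =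
       concat (map (\<lambda>n. True # code_name n) (map (\<lambda>f. app_name (instantiate \<rho> (loop_pattern f))) fs))" for fs
      by (induction fs) (simp_all add: pattern_items_string)
    then show "items_string vars_items \<rho> = concat (map (\<lambda>n. True # code_name n)
      (map (\<lambda>f. app_name (instantiate \<rho> (loop_pattern f))) map_list))" by (simp add: vars_items_def)
  qed
  then have v: "vars_part \<phi> \<phi> = concat (map (\<lambda>n. True # code_name n) (image_vars \<phi>))"
    unfolding vars_part_def image_vars_def by (simp only: gen_concat_map concat_map_concat_map)
  have "items_string (form_items t) = (\<lambda>\<rho>. concat (map (\<lambda>a. True # code_atom a)
      (map (\<lambda>p. map_atom app_name (map_atom (instantiate \<rho>) p)) (pattern_list t))))" for t
  proof
    fix \<rho>
    have "items_string (concat (map atom_items ps)) \<rho> =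
       concat (map (\<lambda>a. True # code_atom a) (map (\<lambda>p. map_atom app_name (map_atom (instantiate \<rho>) p)) ps))" for ps
      by (induction ps) (simp_all add: atom_items_string)
    then show "items_string (form_items t) \<rho> = concat (map (\<lambda>a. True # code_atom a)
      (map (\<lambda>p. map_atom app_name (map_atom (instantiate \<rho>) p)) (pattern_list t)))" by (simp add: form_items_def)
  qed
  then have f: "form_part \<phi> \<phi> = concat (map (\<lambda>a. True # code_atom a) (image_formula \<phi>))"
    unfolding form_part_def image_formula_def by (simp only: gen_concat_map concat_map_concat_map)
  show ?thesis using assms
    by (simp add: result_def v f code_instance_def code_formula_def code_list_def)
qed

lemma set_image_formula: "set (image_formula \<phi>) = map_atom app_name ` constraints \<phi>"
proof -
  have "c \<in> set (image_formula \<phi>) \<longleftrightarrow> (\<exists>a w p. a \<in> set \<phi> \<and> (\<forall>i<loops. w i \<in> formula_vars \<phi>) \<and>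
      p \<in> patterns (symbol a) \<and> c = map_atom app_name (map_atom (instantiate (with_loops loops w (env a))) p))" for c
    by (simp add: image_formula_def set_gen set_pattern_list occs_vars image_iff) blast
  then show ?thesis
    by (intro set_eqI) (simp only: constraints_def image_iff bex_simps mem_Collect_eq, blast)
qed

text \<open>\<open>loops\<close> is at least the arity of each map in \<open>F\<close>, so the first
  loop registers can pick any tuple of variables.\<close>

lemma set_image_vars:
  assumes "formula_over \<D> \<phi>" "\<phi> \<noteq> []"
  shows "set (image_vars \<phi>) = app_name ` applications (formula_vars \<phi>) F"
proof -
  have loop: "map (with_loops loops w \<rho>) (map Loop [0..<fst f]) = map w [0..<fst f]" if "f \<in> F" for w \<rho> f
    using fst_le_loops[OF that] by auto
  obtain a0 where a0: "a0 \<in> set \<phi>" using assms(2) by (cases \<phi>) auto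
  then have "atom_vars a0 \<noteq> {}" using assms(1) by (intro atom_vars_nonempty) (auto simp: formula_over_def)
  with a0 obtain v0 where v0: "v0 \<in> formula_vars \<phi>" by (auto simp: formula_vars_def)
  have mem: "n \<in> set (image_vars \<phi>) \<longleftrightarrow> (\<exists>w f. (\<forall>i<loops. w i \<in> formula_vars \<phi>) \<and> f \<in> F \<and>
      n = app_name (map w [0..<fst f], f))" for n
  proof -
    have "n \<in> set (image_vars \<phi>) \<longleftrightarrow> (\<exists>a\<in>set \<phi>. \<exists>w f. (\<forall>i<loops. w i \<in> formula_vars \<phi>) \<and> f \<in> F \<and>
       n = app_name (instantiate (with_loops loops w (env a)) (loop_pattern f)))"
      by (auto simp: image_vars_def set_gen set_map_list occs_vars)
    also have "\<dots> \<longleftrightarrow> (\<exists>a\<in>set \<phi>. \<exists>w f. (\<forall>i<loops. w i \<in> formula_vars \<phi>) \<and> f \<in> F \<and>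
       n = app_name (map w [0..<fst f], f))"
      unfolding instantiate_def loop_pattern_def split_conv using loop by metis
    finally show ?thesis using a0 by blast
  qed
  show ?thesis
  proof (intro equalityI subsetI)
    fix n assume "n \<in> set (image_vars \<phi>)"
    then obtain w f where w: "\<forall>i<loops. w i \<in> formula_vars \<phi>" "f \<in> F" "n = app_name (map w [0..<fst f], f)"
      unfolding mem by blast
    then have "(map w [0..<fst f], f) \<in> applications (formula_vars \<phi>) F"
      using fst_le_loops[OF w(2)] by (cases f) (auto simp: applications_def tuples_def)
    with w(3) show "n \<in> app_name ` applications (formula_vars \<phi>) F" by blast
  next
    fix n assume "n \<in> app_name ` applications (formula_vars \<phi>) F"
    then obtain vs f where f: "f \<in> F" "set vs \<subseteq> formula_vars \<phi>" "length vs = fst f" "n = app_name (vs, f)"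
      by (auto simp: applications_def tuples_def)
    define w where "w = (\<lambda>i. if i < length vs then vs ! i else v0)"
    have "map w [0..<fst f] = vs" using f(3) by (intro nth_equalityI) (auto simp: w_def)
    moreover have "w i \<in> formula_vars \<phi>" for i using f(2) v0 by (auto simp: w_def)
    ultimately show "n \<in> set (image_vars \<phi>)"
      unfolding mem using f(1,4) by (intro exI[of _ w] exI[of _ f]) simp
  qed
qed

text \<open>Naming is a bijection between the applications and the listed variables, so surjective
  solutions transport in both directions.\<close>

lemma result_in_SCSP:
  assumes "formula_over \<D> \<phi>" "\<phi> \<noteq> []"
  shows "result \<phi> \<in> SCSP B \<longleftrightarrow> (\<exists>h \<in> formula_vars \<phi> \<rightarrow>\<^sub>E univ \<D>. sat \<D> h \<phi>)"
proof -
  let ?A = "applications (formula_vars \<phi>) F" and ?U = "set (image_vars \<phi>)" and ?\<psi> = "image_formula \<phi>"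
  note U = set_image_vars[OF assms]
  have over: "formula_over B ?\<psi>"
    using constraints_over(1)[OF assms(1)] by (auto simp: formula_over_def set_image_formula)
  have vars: "formula_vars ?\<psi> \<subseteq> ?U"
    using constraints_over(2)[OF assms(1)] by (force simp: formula_vars_def set_image_formula U)
  have "result \<phi> \<in> SCSP B \<longleftrightarrow> (\<exists>h \<in> ?U \<rightarrow>\<^sub>E univ B. h ` ?U = univ B \<and> sat B h ?\<psi>)"
    using over vars by (auto simp: SCSP_def result_eq[OF assms(2)] code_instance_inject)
  also have "\<dots> \<longleftrightarrow> (\<exists>h \<in> ?A \<rightarrow>\<^sub>E univ B. h ` ?A = univ B \<and> (\<forall>c\<in>constraints \<phi>. sat_atom B h c))"
  proof
    assume "\<exists>h \<in> ?U \<rightarrow>\<^sub>E univ B. h ` ?U = univ B \<and> sat B h ?\<psi>"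
    then obtain h where h: "h \<in> ?U \<rightarrow>\<^sub>E univ B" "h ` ?U = univ B" "sat B h ?\<psi>" by blast
    let ?h = "\<lambda>\<alpha>\<in>?A. h (app_name \<alpha>)"
    have "?h \<in> ?A \<rightarrow>\<^sub>E univ B" using h(1) U by auto
    moreover have "?h ` ?A = univ B" using h(2) unfolding U by (simp add: image_image)
    moreover have "sat_atom B ?h c" if c: "c \<in> constraints \<phi>" for c
    proof -
      have "sat_atom B h (map_atom app_name c)" using h(3) c by (simp add: sat_def set_image_formula)
      then have "sat_atom B (h \<circ> app_name) c" by (simp only: sat_atom_map)
      also have "sat_atom B (h \<circ> app_name) c \<longleftrightarrow> sat_atom B ?h c"
        using constraints_over(2)[OF assms(1) c] by (intro sat_atom_cong) auto
      finally show ?thesis .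
    qed
    ultimately show "\<exists>h \<in> ?A \<rightarrow>\<^sub>E univ B. h ` ?A = univ B \<and> (\<forall>c\<in>constraints \<phi>. sat_atom B h c)" by blast
  next
    assume "\<exists>h \<in> ?A \<rightarrow>\<^sub>E univ B. h ` ?A = univ B \<and> (\<forall>c\<in>constraints \<phi>. sat_atom B h c)"
    then obtain h where h: "h \<in> ?A \<rightarrow>\<^sub>E univ B" "h ` ?A = univ B" "\<And>c. c \<in> constraints \<phi> \<Longrightarrow> sat_atom B h c" by blast
    \<comment> \<open>Names are decoded here; injectivity of \<open>app_name\<close> makes this
      agree with \<open>h\<close> on every application.\<close>
    define h' where "h' = (\<lambda>n\<in>?U. h (inv_into ?A app_name n))"
    have inv: "h' (app_name \<alpha>) = h \<alpha>" if "\<alpha> \<in> ?A" for \<alpha>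
      using that inv_into_f_f[OF inj_app_name that] by (simp add: h'_def U)
    have "h' ` ?U = h ` ?A" unfolding U image_image using inv U by (intro image_cong) auto
    moreover have "h' \<in> ?U \<rightarrow>\<^sub>E univ B" 
      using h(1) inv by (auto simp: U PiE_iff extensional_def h'_def)
    moreover have "sat_atom B h' (map_atom app_name c)" if c: "c \<in> constraints \<phi>" for c
    proof -
      have "sat_atom B (h' \<circ> app_name) c \<longleftrightarrow> sat_atom B h c"
        using constraints_over(2)[OF assms(1) c] inv by (intro sat_atom_cong) auto
      with h(3)[OF c] show ?thesis by (simp only: sat_atom_map)
    qed
    ultimately show "\<exists>h \<in> ?U \<rightarrow>\<^sub>E univ B. h ` ?U = univ B \<and> sat B h ?\<psi>"
      using h(2) by (intro bexI[of _ h']) (auto simp: sat_def set_image_formula)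
  qed
  also have "\<dots> \<longleftrightarrow> (\<exists>h \<in> formula_vars \<phi> \<rightarrow>\<^sub>E univ \<D>. sat \<D> h \<phi>)"
    using satisfiable_iff[OF assms] by simp
  finally show ?thesis .
qed

lemma positive_instance: "positive_instance \<in> SCSP B"
proof -
  define us where "us = map (\<lambda>i. replicate i True) [0..<card (univ B)]"
  have "distinct us"
    unfolding us_def distinct_map by (auto simp: inj_on_def dest: arg_cong[of _ _ length])
  then have "card (set us) = length us" by (rule distinct_card)
  then have "card (set us) = card (univ B)" by (simp only: us_def length_map) simp
  moreover have "finite (univ B)" using finite_B by (simp add: finite_structure_def)
  ultimately obtain h where h: "bij_betw h (set us) (univ B)"
    using finite_same_card_bij[of "set us" "univ B"] by auto
  then have "(\<lambda>u\<in>set us. h u) ` set us = univ B" by (simp add: bij_betw_def)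
  moreover have "(\<lambda>u\<in>set us. h u) \<in> set us \<rightarrow>\<^sub>E univ B" using h by (auto simp: bij_betw_def)
  moreover have "formula_over B []" "formula_vars [] \<subseteq> set us" "sat B (\<lambda>u\<in>set us. h u) []"
    by (simp_all add: formula_over_def formula_vars_def sat_def)
  ultimately show ?thesis unfolding SCSP_def positive_instance_def us_def[symmetric] by blast
qed

theorem CSP_reduces: "CSP \<D> \<le>\<^sub>p SCSP B"
proof -
  \<comment> \<open>The code is prefix-free, so the formula picked by \<open>THE\<close> is unique;
    the empty word for all other inputs is what the program leaves when it fails.\<close>
  define f where "f = (\<lambda>x. if \<exists>\<phi>. formula_over \<D> \<phi> \<and> x = code_formula \<phi>
    then result (THE \<phi>. x = code_formula \<phi>) else [])"
  have inj: "code_formula \<phi> = code_formula \<psi> \<longleftrightarrow> \<phi> = \<psi>" for \<phi> \<psi>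
    using prefix_codeD[OF prefix_code_formula, of \<phi> "[]" \<psi> "[]"] by auto
  have f_ok: "f (code_formula \<phi>) = result \<phi>" if "formula_over \<D> \<phi>" for \<phi>
    using that by (auto simp: f_def inj)
  have f_bad: "f x = []" if "\<nexists>\<phi>. formula_over \<D> \<phi> \<and> x = code_formula \<phi>" for x
    using that by (auto simp: f_def)
  have "x \<in> CSP \<D> \<longleftrightarrow> f x \<in> SCSP B" for x
  proof (cases "\<exists>\<phi>. formula_over \<D> \<phi> \<and> x = code_formula \<phi>")
    case True
    then obtain \<phi> where \<phi>: "formula_over \<D> \<phi>" "x = code_formula \<phi>" by blast
    have x: "x \<in> CSP \<D> \<longleftrightarrow> (\<exists>h \<in> formula_vars \<phi> \<rightarrow>\<^sub>E univ \<D>. sat \<D> h \<phi>)"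
      using \<phi> by (auto simp: CSP_def inj)
    show ?thesis
    proof (cases "\<phi> = []")
      case True
      then show ?thesis unfolding x
        using f_ok[OF \<phi>(1)] \<phi>(2) positive_instance
        by (auto simp: result_def sat_def formula_vars_def)
    next
      case False
      then show ?thesis unfolding x using f_ok[OF \<phi>(1)] \<phi>(2) result_in_SCSP[OF \<phi>(1)] by simp
    qed
  next
    case False
    \<comment> \<open>Every code contains at least the end marker of a list.\<close>
    have "[] \<notin> SCSP B" by (auto simp: SCSP_def code_instance_def code_list_def)
    with False f_bad[OF False] show ?thesis by (auto simp: CSP_def)
  qed
  moreover have "poly_time f" using f_ok f_bad by (rule poly_time_result)
  ultimately show ?thesis unfolding poly_reduces_def by blast
qed

end

theorem theorem2p7:
  fixes B :: "'b rel_structure" and D :: "'d set"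
    and F :: "('d, 'b) enc_map set" and \<D> :: "'d rel_structure"
  assumes "finite_structure B"
    and "encoding B D F"
    and "F_stable B D F"
    and "induced_template B D F \<D>"
  shows "CSP \<D> \<le>\<^sub>p SCSP B"
proof -
  interpret stable_template B D F \<D> by unfold_locales (fact assms)+
  show ?thesis by (rule CSP_reduces)
qed

end
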